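(* Let either $\beta \in \mathbb{N}_0$ and $m = 1$, or $\beta = -1$ and $m \in \mathbb{N}$ with $m > 1$. Let $(T_n)_{n\ge 1}$ be the random tree sequence with parameters $(\beta, m)$, let $P_n$ be the path length of $T_n$, let $S_n := \frac{P_n - \mathbf{E}[P_n]}{n - \beta/(\beta+m)}$ for $n \ge 1$, and let $S$ be the almost sure limit of $S_n$ as $n\to\infty$. Then the convergence in distribution $\sqrt{\frac{\beta + m}{m}}\sqrt{\frac{n}{\log n}}\,(S_n - S) \to \mathcal{N}$, with $\mathcal{N}$ a standard normal random variable, is with respect to all moments; in other words, for every real $p > 0$, as $n \to \infty$, $$\left(\frac{n}{\log n}\right)^{p/2} \mathbf{E}\left[|S_n - S|^p\right] \to \left(\frac{m}{\beta + m}\right)^{p/2} \mathbf{E}\left[|\mathcal{N}|^p\right].$$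
   Context: Random tree model with parameters $(\beta,m)$: $(T_n)_{n \ge 1}$ is a sequence of random rooted trees, where $T_n$ has $n$ nodes. $T_1$ consists of a single node, the root. For $n \ge 2$, given $T_1,\dots,T_{n-1}$, a node $v \in T_{n-1}$ is chosen with probability proportional to $\beta d_v + m$, where $d_v$ denotes the number of children (outdegree) of $v$ in $T_{n-1}$, and $T_n$ is obtained from $T_{n-1}$ by attaching a new node (the $n$-th inserted node) as a child of $v$. The depth of a node is its graph distance to the root. The path length $P_n$ of $T_n$ is the sum of the depths of all nodes of $T_n$. The sequence $(S_n)$ is an $L_2$-bounded martingale with respect to $\mathcal{F}_n = \sigma(T_1,\dots,T_n)$, so the almost sure limit $S$ exists. *)

theory Defs
  imports "HOL-Probability.Probability"
begin

text \<open>Nodes are labelled by their time of insertion, so the root is \<open>1\<close>. An edge \<open>(v, w)\<close>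
  points from the parent \<open>v\<close> to the child \<open>w\<close>.\<close>

record rtree =
  nodes :: "nat set"
  edges :: "(nat \<times> nat) set"

definition single_node :: rtree where
  "single_node = \<lparr>nodes = {1}, edges = {}\<rparr>"

definition attach :: "rtree \<Rightarrow> nat \<Rightarrow> nat \<Rightarrow> rtree" where
  "attach t v w = \<lparr>nodes = insert w (nodes t), edges = insert (v, w) (edges t)\<rparr>"

definition outdegree :: "rtree \<Rightarrow> nat \<Rightarrow> nat" where
  "outdegree t v = card {w. (v, w) \<in> edges t}"

definition graph_distance :: "rtree \<Rightarrow> nat \<Rightarrow> nat \<Rightarrow> nat" where
  "graph_distance t u v = (LEAST k. (u, v) \<in> (edges t \<union> (edges t)\<inverse>) ^^ k)"

definition depth :: "rtree \<Rightarrow> nat \<Rightarrow> nat" where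
  "depth t v = graph_distance t 1 v"

definition path_length :: "rtree \<Rightarrow> nat" where
  "path_length t = (\<Sum>v\<in>nodes t. depth t v)"

definition weight :: "int \<Rightarrow> int \<Rightarrow> rtree \<Rightarrow> nat \<Rightarrow> real" where
  "weight \<beta> m t v = real_of_int (\<beta> * int (outdegree t v) + m)"

text \<open>The transition law is stated as an elementary conditional probability given the whole history
  \<open>T 1, \<dots>, T (n - 1)\<close>, for all histories of positive probability. The index \<open>0\<close> is not used.\<close>

locale random_tree_process = prob_space M for M :: "'w measure" +
  fixes T :: "nat \<Rightarrow> 'w \<Rightarrow> rtree" and \<beta> m :: int
  assumes measurable_T: "\<And>n. n \<ge> 1 \<Longrightarrow> T n \<in> measurable M (count_space UNIV)"
    and T_1: "AE \<omega> in M. T 1 \<omega> = single_node"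
    and T_step: "\<And>n t v. n \<ge> 2 \<Longrightarrow> v \<in> nodes (t (n - 1)) \<Longrightarrow>
      \<P>(\<omega> in M. \<forall>k\<in>{1..n - 1}. T k \<omega> = t k) > 0 \<Longrightarrow>
      \<P>(\<omega> in M. T n \<omega> = attach (t (n - 1)) v n \<bar> \<forall>k\<in>{1..n - 1}. T k \<omega> = t k) =
        weight \<beta> m (t (n - 1)) v / (\<Sum>u\<in>nodes (t (n - 1)). weight \<beta> m (t (n - 1)) u)"

definition normalized_path_length ::
    "'w measure \<Rightarrow> (nat \<Rightarrow> 'w \<Rightarrow> rtree) \<Rightarrow> int \<Rightarrow> int \<Rightarrow> nat \<Rightarrow> 'w \<Rightarrow> real" where
  "normalized_path_length M T \<beta> m n \<omega> =
    (real (path_length (T n \<omega>)) - (\<integral>\<omega>'. real (path_length (T n \<omega>')) \<partial>M)) /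
    (real n - real_of_int \<beta> / real_of_int (\<beta> + m))"

end

theory Submission
  imports Defs "HOL-Real_Asymp.Real_Asymp"
begin

text \<open>The depths at which successive nodes are attached form an urn scheme: when a node of depth
  \<open>h\<close> becomes a parent, the attachment weight sitting at depth \<open>h\<close> changes by \<open>\<beta>\<close> and that at depth
  \<open>h + 1\<close> by \<open>m\<close>. Let \<open>A\<close> and \<open>V\<close> be the conditional mean and variance of the next parent depth, and
  \<open>c = \<beta> + m\<close>. Then \<open>S\<^sub>n\<close> is \<open>A\<close> minus its mean, and its increments are \<open>c (h - A)\<close> divided by the
  new total weight. The recursion for \<open>V\<close> shows that \<open>V\<close> stays within \<open>O(1)\<close> in \<open>L\<^sub>2\<close> of a deterministic
  sequence equivalent to \<open>(m / c) ln n\<close>; the remaining error terms are controlled by crude moment bounds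
  that come from the generating function of the depths. Hence replacing the martingale increments
  one by one by Gaussian ones yields the limit law of \<open>S - S\<^sub>n\<close>, with variance \<open>(m / c) ln n / n\<close>.
  A Gronwall argument bounds every even moment of \<open>S - S\<^sub>n\<close> by the right power of \<open>ln n / n\<close>, which
  gives uniform integrability of all powers.\<close>

section \<open>The urn of depths\<close>

text \<open>The estimates work at three levels of precision. For the limit law the Fourier variable
  \<open>u\<close> has order \<open>sqrt (n / ln n)\<close>. An error of order
  \<open>1 / j^2\<close> in the mean absolute deviation of the step variances sums to order
  \<open>1 / n\<close> and costs only \<open>u^2 / n\<close>, that is \<open>1 / ln n\<close>. This
  is why an \<open>O(1)\<close> bound on \<open>V\<close> minus its logarithmic centre is the right
  target. The even moments need the powers of \<open>V\<close> with their true logarithmic size,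
  since any loss there would destroy uniform integrability. Taylor remainders and third moments may
  lose a small power of \<open>n\<close>: a cubic error carries \<open>u^3\<close>, of order at most
  \<open>n powr (3/2)\<close>, against tail sums of order \<open>n powr (-7/4)\<close>. This slack
  lets one exponential moment of the depths serve all remainders. A separate obstacle is \<beta> =
  -1, where drawing a depth removes weight from it. There the integrality of the parameters keeps
  the urn meaningful.\<close>

text \<open>The state is the list of the depths of the parents chosen so far, newest first, so that a list
  of length \<open>k\<close> belongs to a tree with \<open>k + 1\<close> nodes; \<open>tot f\<close> is the sum of \<open>f (depth v)\<close> over
  the nodes \<open>v\<close>, each counted with its attachment weight.\<close>

locale depth_urn =
  fixes \<beta> m :: int
  assumes parameters: "(\<beta> \<ge> 0 \<and> m = 1) \<or> (\<beta> = -1 \<and> m > 1)"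
begin

abbreviation b :: real where "b \<equiv> real_of_int \<beta>"
abbreviation a :: real where "a \<equiv> real_of_int m"
definition c :: real where "c = b + a"

lemma c_ge_1: "c \<ge> 1" and a_ge_1: "a \<ge> 1" and b_ge: "b \<ge> -1" and a_le: "a \<le> c + 1"
  using parameters by (auto simp: c_def)

lemma c_pos: "c > 0" and a_pos: "a > 0"
  using c_ge_1 a_ge_1 by simp_all

definition tot :: "(nat \<Rightarrow> real) \<Rightarrow> nat list \<Rightarrow> real" where
  "tot f l = a * f 0 + (\<Sum>x\<leftarrow>l. b * f x + a * f (Suc x))"

definition W :: "nat \<Rightarrow> real" where
  "W k = a + c * real k"

abbreviation mass :: "nat list \<Rightarrow> nat \<Rightarrow> real" where
  "mass l h \<equiv> tot (\<lambda>x. of_bool (x = h)) l"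

text \<open>For \<beta> = -1 a list may draw from a depth more often than its weight permits, and
  \<open>kernel\<close> then has no meaning. This predicate holds on the support of
  \<open>urn\<close> and guards every conditional computation.\<close>

definition nonneg_mass :: "nat list \<Rightarrow> bool" where
  "nonneg_mass l \<longleftrightarrow> (\<forall>h. 0 \<le> mass l h)"

definition kernel :: "nat list \<Rightarrow> nat pmf" where
  "kernel l = embed_pmf (\<lambda>h. mass l h / W (length l))"

primrec urn :: "nat \<Rightarrow> nat list pmf" where
  "urn 0 = return_pmf []"
| "urn (Suc k) = bind_pmf (urn k) (\<lambda>l. map_pmf (\<lambda>h. h # l) (kernel l))"

abbreviation "EK l \<equiv> measure_pmf.expectation (kernel l)"
abbreviation "EU k \<equiv> measure_pmf.expectation (urn k)"

lemma W_ge: "W k \<ge> real k + 1"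
proof -
  have "c * real k \<ge> 1 * real k" using c_ge_1 by (intro mult_right_mono) auto
  then show ?thesis using a_ge_1 by (simp add: W_def)
qed

lemma W_pos: "W k > 0"
  using W_ge[of k] by linarith

lemma W_Suc: "W (Suc k) = W k + c"
  by (simp add: W_def algebra_simps)

lemma tot_Nil [simp]: "tot f [] = a * f 0"
  and tot_Cons [simp]: "tot f (h # l) = tot f l + (b * f h + a * f (Suc h))"
  by (simp_all add: tot_def)

lemma tot_const: "tot (\<lambda>_. d) l = d * W (length l)"
  by (induction l) (auto simp: W_def c_def algebra_simps)

text \<open>The index set is an arbitrary fixed \<open>B\<close>, so that the induction does not
  have to follow the support as it grows.\<close>

lemma tot_eq_sum:
  assumes "finite B" "0 \<in> B" "set l \<subseteq> B" "Suc ` set l \<subseteq> B"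
  shows "tot f l = (\<Sum>h\<in>B. mass l h * f h)"
  using assms
proof (induction l)
  case Nil
  have "(\<Sum>h\<in>B. mass [] h * f h) = (\<Sum>h\<in>B. if h = 0 then a * f 0 else 0)"
    by (intro sum.cong) auto
  then show ?case using Nil by simp
next
  case (Cons y l)
  have "(\<Sum>h\<in>B. mass (y # l) h * f h) = (\<Sum>h\<in>B. mass l h * f h) +
      (\<Sum>h\<in>B. if h = y then b * f y else 0) + (\<Sum>h\<in>B. if h = Suc y then a * f (Suc y) else 0)"
    unfolding sum.distrib[symmetric] by (intro sum.cong) (auto simp: algebra_simps)
  then show ?case using Cons by simp
qed

text \<open>Positive weight is therefore at least \<open>1\<close>, so a depth that can be drawn
  survives the removal of one unit when \<beta> = -1. This is what propagates
  \<open>nonneg_mass\<close>.\<close>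

lemma mass_int: "mass l h \<in> \<int>"
  by (induction l) (auto intro!: Ints_add Ints_mult)

definition support :: "nat list \<Rightarrow> nat set" where
  "support l = insert 0 (set l \<union> Suc ` set l)"

lemma mass_outside: "h \<notin> support l \<Longrightarrow> mass l h = 0"
  by (induction l) (auto simp: support_def)

lemma finite_support [simp]: "finite (support l)"
  by (simp add: support_def)

lemma tot_eq_sum_support: "tot f l = (\<Sum>h\<in>support l. mass l h * f h)"
  by (rule tot_eq_sum) (auto simp: support_def)

lemma pmf_kernel:
  assumes "nonneg_mass l"
  shows "pmf (kernel l) h = mass l h / W (length l)"
proof -
  have W: "W (length l) > 0" by (rule W_pos)
  have "(\<integral>\<^sup>+h. ennreal (mass l h / W (length l)) \<partial>count_space UNIV)
      = (\<Sum>h\<in>support l. ennreal (mass l h / W (length l)))"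
    by (rule nn_integral_count_space') (simp_all add: mass_outside)
  also have "\<dots> = ennreal (\<Sum>h\<in>support l. mass l h / W (length l))"
    using assms W by (intro sum_ennreal) (simp add: nonneg_mass_def)
  also have "(\<Sum>h\<in>support l. mass l h / W (length l)) = tot (\<lambda>_. 1) l / W (length l)"
    by (simp add: tot_eq_sum_support[of "\<lambda>_. 1"] sum_divide_distrib)
  also have "\<dots> = 1"
    using W by (simp add: tot_const)
  finally have "(\<integral>\<^sup>+h. ennreal (mass l h / W (length l)) \<partial>count_space UNIV) = 1" by simp
  then show ?thesis
    unfolding kernel_def using assms W
    by (intro pmf_embed_pmf) (auto simp: nonneg_mass_def)
qed

lemma set_kernel:
  assumes "nonneg_mass l"
  shows "set_pmf (kernel l) = {h. mass l h \<noteq> 0}" "set_pmf (kernel l) \<subseteq> support l"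
proof -
  show *: "set_pmf (kernel l) = {h. mass l h \<noteq> 0}"
    using W_pos[of "length l"] by (auto simp: set_pmf_eq pmf_kernel[OF assms])
  show "set_pmf (kernel l) \<subseteq> support l"
    unfolding * using mass_outside by auto
qed

lemma finite_kernel: "nonneg_mass l \<Longrightarrow> finite (set_pmf (kernel l))"
  using set_kernel(2) finite_subset finite_support by blast

lemma EK_eq:
  assumes "nonneg_mass l"
  shows "EK l f = tot f l / W (length l)"
proof -
  have "EK l f = (\<Sum>h\<in>support l. f h * pmf (kernel l) h)"
    using set_kernel(2)[OF assms] by (intro integral_measure_pmf_real) auto
  then show ?thesis
    by (simp add: pmf_kernel[OF assms] tot_eq_sum_support[of f] sum_divide_distrib mult.commute)
qed

lemma set_urn: "l \<in> set_pmf (urn k) \<Longrightarrow> length l = k \<and> nonneg_mass l"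
proof (induction k arbitrary: l)
  case 0
  then show ?case using a_pos by (auto simp: nonneg_mass_def)
next
  case (Suc k)
  then obtain l' h where l': "l' \<in> set_pmf (urn k)" "h \<in> set_pmf (kernel l')" "l = h # l'"
    by auto
  have l'': "length l' = k" "nonneg_mass l'" using Suc.IH[OF l'(1)] by auto
  have "mass l' h \<noteq> 0" using l'(2) l''(2) set_kernel by auto
  moreover have "mass l' h \<ge> 0" using l'' by (auto simp: nonneg_mass_def)
  ultimately have *: "mass l' h \<ge> 1"
    using Ints_nonzero_abs_ge1[OF mass_int[of h l']] by linarith
  have "mass l i \<ge> 0" for i
  proof -
    have "mass l' i \<ge> 0" using l'' by (auto simp: nonneg_mass_def)
    then show ?thesis using * b_ge a_pos l'(3) by auto
  qed
  then show ?case using l' l'' by (auto simp: nonneg_mass_def)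
qed

text \<open>With finite support every function is integrable, so later expectations can be split and
  compared freely.\<close>

lemma finite_urn: "finite (set_pmf (urn k))"
  by (induction k) (auto dest!: set_urn finite_kernel)

lemma integrable_urn [simp]:
  fixes f :: "nat list \<Rightarrow> 'a::{banach, second_countable_topology}"
  shows "integrable (measure_pmf (urn k)) f"
  by (rule integrable_measure_pmf_finite[OF finite_urn])

lemma integrable_kernel:
  fixes f :: "nat \<Rightarrow> 'a::{banach, second_countable_topology}"
  assumes "nonneg_mass l"
  shows "integrable (measure_pmf (kernel l)) f"
  by (rule integrable_measure_pmf_finite[OF finite_kernel[OF assms]])

lemma EU_Suc:
  fixes F :: "nat list \<Rightarrow> 'a::{banach, second_countable_topology}"
  shows "EU (Suc k) F = EU k (\<lambda>l. EK l (\<lambda>h. F (h # l)))"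
proof -
  have "EU (Suc k) F =
      (\<Sum>l\<in>set_pmf (urn k). pmf (urn k) l *\<^sub>R measure_pmf.expectation (map_pmf (\<lambda>h. h # l) (kernel l)) F)"
    unfolding urn.simps
    by (rule pmf_expectation_bind) (auto simp: finite_urn intro!: finite_kernel dest: set_urn)
  also have "\<dots> = EU k (\<lambda>l. EK l (\<lambda>h. F (h # l)))"
    unfolding integral_map_pmf by (rule integral_measure_pmf[symmetric]) (auto simp: finite_urn)
  finally show ?thesis .
qed

lemma EU_0 [simp]:
  fixes F :: "nat list \<Rightarrow> 'a::{banach, second_countable_topology}"
  shows "EU 0 F = F []"
  by (simp add: integral_measure_pmf[of "{[]}"])

lemma EU_mono:
  assumes "\<And>l. length l = k \<Longrightarrow> nonneg_mass l \<Longrightarrow> F l \<le> (G l :: real)"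
  shows "EU k F \<le> EU k G"
  by (rule integral_mono_AE) (auto simp: AE_measure_pmf_iff assms dest: set_urn)

lemma EU_cong:
  assumes "\<And>l. length l = k \<Longrightarrow> nonneg_mass l \<Longrightarrow> F l = G l"
  shows "EU k F = EU k G"
  by (rule integral_cong_AE) (auto simp: AE_measure_pmf_iff assms dest: set_urn)

lemma EK_mono:
  assumes "nonneg_mass l" "\<And>h. F h \<le> (G h :: real)"
  shows "EK l F \<le> EK l G"
  by (rule integral_mono) (auto intro: integrable_kernel assms)

lemma EU_add: "EU k (\<lambda>h. F h + G h) = EU k F + EU k (G :: nat list \<Rightarrow> real)"
  by (rule Bochner_Integration.integral_add) auto

end

section \<open>Moments of the depths\<close>

lemma power_add_remainder:
  fixes x g :: real
  shows "\<bar>(x + g) ^ r - x ^ r - real r * x ^ (r - 1) * g\<bar> \<le> 2 ^ r * (\<bar>x\<bar> ^ (r - 2) * g\<^sup>2 + \<bar>g\<bar> ^ r)"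
proof (cases "r \<ge> 2")
  case False
  then have "r = 0 \<or> r = 1" by auto
  then show ?thesis by auto
next
  case True
  define t where "t k = real (r choose k) * (g ^ k * x ^ (r - k))" for k
  have split: "{..r} = {0, 1} \<union> {2..r}" using True by auto
  have "(x + g) ^ r = (\<Sum>k\<le>r. t k)"
    unfolding add.commute[of x g] binomial_ring t_def by (simp add: mult.assoc)
  also have "\<dots> = t 0 + t 1 + (\<Sum>k=2..r. t k)"
    unfolding split by (subst sum.union_disjoint) auto
  finally have "\<bar>(x + g) ^ r - x ^ r - real r * x ^ (r - 1) * g\<bar> = \<bar>\<Sum>k=2..r. t k\<bar>"
    by (simp add: t_def)
  also have "\<dots> \<le> (\<Sum>k=2..r. \<bar>t k\<bar>)" by (rule sum_abs)
  also have "\<dots> \<le> (\<Sum>k=2..r. real (r choose k) * (\<bar>x\<bar> ^ (r - 2) * g\<^sup>2 + \<bar>g\<bar> ^ r))"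
  proof (rule sum_mono)
    fix k assume "k \<in> {2..r}"
    then have k: "2 \<le> k" "k \<le> r" by auto
    \<comment> \<open>Each term of order at least two lies below one of the two extreme ones,
      depending on which of \<open>g\<close> and \<open>x\<close> is larger in absolute value. No
      intermediate powers survive, and the binomial coefficients add up to at most
      \<open>2 ^ r\<close>.\<close>
    have "\<bar>g\<bar> ^ k * \<bar>x\<bar> ^ (r - k) \<le> \<bar>x\<bar> ^ (r - 2) * g\<^sup>2 + \<bar>g\<bar> ^ r"
    proof (cases "\<bar>g\<bar> \<le> \<bar>x\<bar>")
      case True
      have "\<bar>g\<bar> ^ k = \<bar>g\<bar> ^ 2 * \<bar>g\<bar> ^ (k - 2)"
        unfolding power_add[symmetric] using k by (simp only: le_add_diff_inverse)
      then have "\<bar>g\<bar> ^ k * \<bar>x\<bar> ^ (r - k) = g\<^sup>2 * (\<bar>g\<bar> ^ (k - 2) * \<bar>x\<bar> ^ (r - k))"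
        by (simp only: power2_abs mult.assoc)
      also have "\<dots> \<le> g\<^sup>2 * (\<bar>x\<bar> ^ (k - 2) * \<bar>x\<bar> ^ (r - k))"
        using True by (intro mult_left_mono mult_right_mono power_mono) auto
      also have "\<bar>x\<bar> ^ (k - 2) * \<bar>x\<bar> ^ (r - k) = \<bar>x\<bar> ^ (r - 2)"
        unfolding power_add[symmetric] using k by simp
      finally show ?thesis by (simp add: mult.commute add_increasing2)
    next
      case False
      have "\<bar>g\<bar> ^ k * \<bar>x\<bar> ^ (r - k) \<le> \<bar>g\<bar> ^ k * \<bar>g\<bar> ^ (r - k)"
        using False by (intro mult_left_mono power_mono) auto
      also have "\<dots> = \<bar>g\<bar> ^ r" unfolding power_add[symmetric] using k by simp
      finally show ?thesis by (simp add: add_increasing)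
    qed
    then show "\<bar>t k\<bar> \<le> real (r choose k) * (\<bar>x\<bar> ^ (r - 2) * g\<^sup>2 + \<bar>g\<bar> ^ r)"
      unfolding t_def abs_mult power_abs by (intro mult_mono) auto
  qed
  also have "\<dots> = (\<Sum>k=2..r. real (r choose k)) * (\<bar>x\<bar> ^ (r - 2) * g\<^sup>2 + \<bar>g\<bar> ^ r)"
    by (simp add: sum_distrib_right)
  also have "\<dots> \<le> 2 ^ r * (\<bar>x\<bar> ^ (r - 2) * g\<^sup>2 + \<bar>g\<bar> ^ r)"
  proof (rule mult_right_mono)
    have "(\<Sum>k=2..r. real (r choose k)) \<le> (\<Sum>k\<le>r. real (r choose k))"
      by (rule sum_mono2) auto
    also have "\<dots> = 2 ^ r" using choose_row_sum[of r]
      by (metis of_nat_numeral of_nat_power of_nat_sum)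
    finally show "(\<Sum>k=2..r. real (r choose k)) \<le> 2 ^ r" .
  qed auto
  finally show ?thesis .
qed

text \<open>Convexity in the form of a supporting line, which is Bernoulli's inequality at
  \<open>x / y\<close>. Integrated with \<open>y\<close> the mean, it yields Jensen's
  inequality.\<close>

lemma power_ge_tangent:
  fixes x y :: real
  assumes "x \<ge> 0" "y \<ge> 0"
  shows "y ^ r + real r * y ^ (r - 1) * (x - y) \<le> x ^ r"
proof (cases "y = 0")
  case True
  then show ?thesis using assms by (cases "r = 0 \<or> r = 1") (auto simp: power_0_left)
next
  case False
  have "1 + real r * (x / y - 1) \<le> (1 + (x / y - 1)) ^ r"
    using assms False by (intro Bernoulli_inequality) auto
  then have "y ^ r * (1 + real r * (x / y - 1)) \<le> y ^ r * (x / y) ^ r"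
    using assms by (intro mult_left_mono) auto
  also have "y ^ r * (x / y) ^ r = x ^ r"
    using False by (simp add: power_divide)
  also have "y ^ r * (1 + real r * (x / y - 1)) = y ^ r + real r * y ^ (r - 1) * (x - y)"
    using False by (cases r) (simp_all add: algebra_simps)
  finally show ?thesis .
qed

lemma power_sum3_le:
  fixes x y z :: real
  assumes "x \<ge> 0" "y \<ge> 0" "z \<ge> 0"
  shows "(x + y + z) ^ r \<le> 3 ^ r * (x ^ r + y ^ r + z ^ r)"
proof -
  define u where "u = max x (max y z)"
  have "(x + y + z) ^ r \<le> (3 * u) ^ r"
    using assms by (intro power_mono) (auto simp: u_def)
  also have "\<dots> = 3 ^ r * u ^ r" by (simp add: power_mult_distrib)
  also have "u ^ r \<le> x ^ r + y ^ r + z ^ r"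
    using assms by (auto simp: u_def max_def)
  finally show ?thesis by simp
qed

lemma power_le_fact_exp:
  fixes x :: real
  assumes "x \<ge> 0"
  shows "x ^ n \<le> fact n * exp x"
proof -
  have "(\<Sum>k\<in>{n}. inverse (fact k) * x ^ k) \<le> (\<Sum>k. inverse (fact k) * x ^ k)"
    using assms summable_exp[of x] by (intro sum_le_suminf) auto
  also have "\<dots> = exp x" by (simp add: exp_def scaleR_conv_of_real field_simps)
  finally show ?thesis by (simp add: field_simps)
qed

text \<open>Any exponent in \<open>(0, 1/2)\<close> would do for this crude upper bound on the moments of the depths.\<close>

definition growth :: "nat \<Rightarrow> real" where
  "growth k = (real k + 1) powr (1/4)"

definition lnp :: "nat \<Rightarrow> real" where
  "lnp k = 1 + ln (real k + 1)"

lemma growth_ge_1: "growth k \<ge> 1"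
  unfolding growth_def by (rule ge_one_powr_ge_zero) auto

lemma lnp_ge_1: "lnp k \<ge> 1"
  by (simp add: lnp_def)

lemma lnp_mono: "j \<le> k \<Longrightarrow> lnp j \<le> lnp k"
  by (simp add: lnp_def)

lemma lnp_squared_le: "(lnp k)\<^sup>2 \<le> 64 * growth k"
proof -
  \<comment> \<open>The eighth root is taken because its square is \<open>growth k\<close>. The
    factor \<open>64\<close> is the square of the \<open>8\<close> in
    \<open>ln (k + 1) = 8 * ln y\<close>.\<close>
  define y where "y = (real k + 1) powr (1/8)"
  have y: "y \<ge> 1" unfolding y_def by (rule ge_one_powr_ge_zero) auto
  have "ln y = 1/8 * ln (real k + 1)" by (simp add: y_def)
  moreover have "ln y \<le> y - 1" using y by (intro ln_le_minus_one) auto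
  ultimately have "lnp k \<le> 8 * y" using y by (simp add: lnp_def)
  then have "(lnp k)\<^sup>2 \<le> (8 * y)\<^sup>2" using lnp_ge_1[of k] by (intro power_mono) auto
  also have "\<dots> = 64 * y\<^sup>2" by (simp add: power_mult_distrib)
  also have "y\<^sup>2 = growth k" unfolding y_def growth_def
    by (simp add: power2_eq_square flip: powr_add)
  finally show ?thesis .
qed

text \<open>Makes \<open>growth\<close> a supersolution of the recursion for the generating
  function. The coefficient \<open>1/8\<close> is half of the exponent \<open>1/4\<close>, which
  leaves room for the higher terms of the fourth power.\<close>

lemma growth_step: "growth k * (1 + 1 / (8 * (real k + 1))) \<le> growth (Suc k)"
proof -
  define x where "x = 1 / (real k + 1)"
  have x: "0 < x" "x \<le> 1" by (auto simp: x_def)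
  have "(1 + x / 8) ^ 4 \<le> 1 + x"
  proof -
    have *: "x ^ 2 \<le> x" "x ^ 3 \<le> x" "x ^ 4 \<le> x"
      using x power_decreasing[of 1 2 x] power_decreasing[of 1 3 x] power_decreasing[of 1 4 x] by auto
    have "(1 + x / 8) ^ 4 = 1 + x / 2 + 6/64 * x ^ 2 + 4/512 * x ^ 3 + 1/4096 * x ^ 4"
      by (simp add: power2_eq_square power3_eq_cube power4_eq_xxxx field_simps)
    then show ?thesis using * x by linarith
  qed
  then have "((1 + x / 8) ^ 4) powr (1/4) \<le> (1 + x) powr (1/4)"
    using x by (intro powr_mono2) auto
  also have "((1 + x / 8) ^ 4) powr (1/4) = 1 + x / 8"
    using x powr_powr[of "1 + x / 8" 4 "1/4"] by simp
  finally have "growth k * (1 + x / 8) \<le> (real k + 1) powr (1/4) * (1 + x) powr (1/4)"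
    unfolding growth_def by (intro mult_left_mono) auto
  also have "\<dots> = growth (Suc k)"
  proof -
    have "(real k + 1) * (1 + x) = real (Suc k) + 1" by (simp add: x_def field_simps)
    then show ?thesis
      unfolding growth_def using x powr_mult[of "real k + 1" "1 + x" "1/4"] by simp
  qed
  finally show ?thesis by (simp add: x_def mult.commute)
qed

text \<open>A quarter power over a square has exponent \<open>-7/4\<close> and is summable.
  Remainders bounded by \<open>growth\<close> over a square thus contribute \<open>O(1)\<close> in
  total.\<close>

lemma sum_growth_bounded: "\<exists>B\<ge>0. \<forall>k. (\<Sum>j<k. growth j / (real j + 2)\<^sup>2) \<le> B"
proof -
  have s: "summable (\<lambda>j. real (Suc j) powr (-7/4))"
    by (subst summable_Suc_iff) (simp add: summable_real_powr_iff)
  have le: "growth j / (real j + 2)\<^sup>2 \<le> real (Suc j) powr (-7/4)" for j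
  proof -
    have "growth j / (real j + 2)\<^sup>2 \<le> growth j / (real j + 1)\<^sup>2"
      using growth_ge_1[of j] by (intro divide_left_mono power_mono) auto
    also have "\<dots> = real (Suc j) powr (1/4 - 2)"
      unfolding growth_def powr_diff by (simp add: add.commute)
    finally show ?thesis by simp
  qed
  have "(\<Sum>j<k. growth j / (real j + 2)\<^sup>2) \<le> (\<Sum>j. real (Suc j) powr (-7/4))" for k
  proof -
    have "(\<Sum>j<k. growth j / (real j + 2)\<^sup>2) \<le> (\<Sum>j<k. real (Suc j) powr (-7/4))"
      by (rule sum_mono) (rule le)
    also have "\<dots> \<le> (\<Sum>j. real (Suc j) powr (-7/4))"
      by (rule sum_le_suminf[OF s]) auto
    finally show ?thesis .
  qed
  moreover have "(\<Sum>j. real (Suc j) powr (-7/4)) \<ge> 0" by (rule suminf_nonneg[OF s]) auto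
  ultimately show ?thesis by blast
qed

lemma sum_inverse_le_ln: "(\<Sum>j<k. 1 / (real j + 2)) \<le> ln (real k + 1)"
proof (induction k)
  case (Suc k)
  have "ln ((real k + 1) / (real k + 2)) \<le> (real k + 1) / (real k + 2) - 1"
    by (rule ln_le_minus_one) auto
  also have "\<dots> = - (1 / (real k + 2))" by (simp add: field_simps)
  also have "ln ((real k + 1) / (real k + 2)) = ln (real k + 1) - ln (real k + 2)"
    by (rule ln_divide_pos) auto
  finally show ?case using Suc by (simp add: add.commute)
qed simp

section \<open>Conditional mean and variance, and crude moments of the depths\<close>

context depth_urn begin

lemma tot_add: "tot (\<lambda>h. f h + g h) l = tot f l + tot g l"
  and tot_mult: "tot (\<lambda>h. d * f h) l = d * tot f l"
  by (induction l) (auto simp: algebra_simps)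

text \<open>Written with \<open>tot\<close> instead of \<open>EK\<close>, so that the recursions for
  \<open>A\<close> and \<open>V\<close> are algebraic identities valid for every list.\<close>

definition A :: "nat list \<Rightarrow> real" where
  "A l = tot real l / W (length l)"

definition V :: "nat list \<Rightarrow> real" where
  "V l = tot (\<lambda>h. (real h)\<^sup>2) l / W (length l) - (A l)\<^sup>2"

lemma A_Cons: "A (h # l) = A l + (a + c * (real h - A l)) / W (Suc (length l))"
proof -
  have "tot real l = A l * (W (Suc (length l)) - c)"
    unfolding W_Suc using W_pos[of "length l"] by (simp add: A_def)
  then show ?thesis using W_pos[of "Suc (length l)"]
    by (simp add: A_def[of "h # l"] field_simps c_def)
qed

text \<open>The new variance is the new second moment minus the square of the new mean. The terms
  proportional to \<open>A l\<close> cancel, and what is subtracted at the end is the squared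
  increment of \<open>A\<close>.\<close>

lemma V_Cons:
  defines "w \<equiv> \<lambda>l. W (Suc (length l))"
  shows "V (h # l) = V l + (a + c * ((real h - A l)\<^sup>2 - V l) + 2 * a * (real h - A l)) / w l
    - ((a + c * (real h - A l)) / w l)\<^sup>2"
proof -
  have t: "tot (\<lambda>h. (real h)\<^sup>2) l = (V l + (A l)\<^sup>2) * (w l - c)"
    unfolding W_Suc w_def using W_pos[of "length l"] by (simp add: V_def)
  have w: "w l > 0" unfolding w_def by (rule W_pos)
  have "tot (\<lambda>h. (real h)\<^sup>2) (h # l) / w l
      = ((V l + (A l)\<^sup>2) * (w l - c) + b * (real h)\<^sup>2 + a * (real h + 1)\<^sup>2) / w l"
    by (simp add: t add.commute)
  also have "\<dots> = V l + (A l)\<^sup>2 + (a + c * ((real h)\<^sup>2 - V l - (A l)\<^sup>2) + 2 * a * real h) / w l"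
    using w by (simp add: field_simps c_def power2_eq_square)
  finally have 1: "V (h # l) = V l + (A l)\<^sup>2
      + (a + c * ((real h)\<^sup>2 - V l - (A l)\<^sup>2) + 2 * a * real h) / w l
      - (A l + (a + c * (real h - A l)) / w l)\<^sup>2"
    by (simp add: V_def[of "h # l"] A_Cons w_def)
  have 2: "(a + c * ((real h)\<^sup>2 - V l - (A l)\<^sup>2) + 2 * a * real h)
    = (a + c * ((real h - A l)\<^sup>2 - V l) + 2 * a * (real h - A l)) + 2 * A l * (a + c * (real h - A l))"
    by (simp add: power2_eq_square algebra_simps)
  show ?thesis unfolding 1 2
    by (simp add: power2_eq_square algebra_simps add_divide_distrib diff_divide_distrib)
qed

lemma V_Nil [simp]: "V [] = 0" and A_Nil [simp]: "A [] = 0"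
  by (simp_all add: V_def A_def)

context
  fixes l :: "nat list"
  assumes l: "nonneg_mass l"
begin

text \<open>The normal form for conditional expectations: integrands are first brought into this
  shape, where necessary with dummy summands \<open>0 * f h\<close>, and are then evaluated by
  unfolding.\<close>

lemma EK_affine: "EK l (\<lambda>h. p * f h + q * g h + r) = p * EK l f + q * EK l g + r" for p q r :: real
  using W_pos[of "length l"] tot_const[of r l]
  by (simp add: EK_eq[OF l] tot_add tot_mult field_simps)

lemma EK_mult: "EK l (\<lambda>h. p * f h) = p * EK l f" for p :: real
  using EK_affine[of p f 0 f 0] by simp

lemma EK_id: "EK l real = A l"
  by (simp add: EK_eq[OF l] A_def)

lemma EK_centered: "EK l (\<lambda>h. real h - A l) = 0"
  using EK_affine[of 1 real 0 real "- A l"] by (simp add: EK_id)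

lemma EK_square: "EK l (\<lambda>h. (real h - A l)\<^sup>2) = V l"
proof -
  have "EK l (\<lambda>h. (real h - A l)\<^sup>2)
      = EK l (\<lambda>h. 1 * (real h)\<^sup>2 + (- 2 * A l) * real h + (A l)\<^sup>2)"
    by (intro Bochner_Integration.integral_cong) (auto simp: power2_eq_square algebra_simps)
  also have "\<dots> = V l"
    unfolding EK_affine EK_id by (simp add: EK_eq[OF l] V_def power2_eq_square)
  finally show ?thesis .
qed

lemma EK_nonneg: "(\<And>h. 0 \<le> f h) \<Longrightarrow> 0 \<le> EK l (f :: nat \<Rightarrow> real)"
  by (rule Bochner_Integration.integral_nonneg) auto

lemma V_nonneg: "V l \<ge> 0"
  unfolding EK_square[symmetric] by (rule EK_nonneg) auto

lemma EK_power_le: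
  fixes f :: "nat \<Rightarrow> real"
  assumes f: "\<And>h. 0 \<le> f h"
  shows "(EK l f) ^ r \<le> EK l (\<lambda>h. f h ^ r)"
proof -
  define y where "y = EK l f"
  have y: "y \<ge> 0" unfolding y_def by (rule EK_nonneg) (rule f)
  have "y ^ r = EK l (\<lambda>h. (real r * y ^ (r - 1)) * f h + 0 * f h + (y ^ r - real r * y ^ (r - 1) * y))"
    unfolding EK_affine y_def[symmetric] by simp
  also have "\<dots> \<le> EK l (\<lambda>h. f h ^ r)"
    using power_ge_tangent[OF f y, where r = r] by (intro EK_mono[OF l]) (simp add: algebra_simps)
  finally show ?thesis by (simp add: y_def)
qed

end

text \<open>The generating function of the depths is multiplicative along the recursion; the base is
  chosen so close to \<open>1\<close> that it grows slower than \<open>growth\<close>.\<close>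

definition base :: real where
  "base = 1 + c / (8 * a)"

lemma base_gt_1: "base > 1"
  using c_pos a_pos by (simp add: base_def)

lemma EU_EK_base: "EU k (\<lambda>l. EK l (\<lambda>h. base ^ h)) \<le> growth k"
proof -
  define G where "G l = tot (\<lambda>h. base ^ h) l / W (length l)" for l
  have G_Cons: "EK l (\<lambda>h. G (h # l)) = G l * (1 + c / (8 * W (Suc k)))"
    if l: "length l = k" "nonneg_mass l" for l k
  proof -
    have "G (h # l) = (tot (\<lambda>h. base ^ h) l + (b + a * base) * base ^ h) / W (Suc k)" for h
      using l by (simp add: G_def algebra_simps)
    also have "\<dots> h = ((b + a * base) / W (Suc k)) * base ^ h + 0 * base ^ h + tot (\<lambda>h. base ^ h) l / W (Suc k)" for h
      by (simp add: add_divide_distrib ring_distribs)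
    finally have "EK l (\<lambda>h. G (h # l)) = EK l (\<lambda>h. ((b + a * base) / W (Suc k)) * base ^ h + 0 * base ^ h + tot (\<lambda>h. base ^ h) l / W (Suc k))"
      by presburger
    also have "\<dots> = ((b + a * base) / W (Suc k)) * G l + G l * W k / W (Suc k)"
      unfolding EK_affine[OF l(2)] using l W_pos[of k] by (simp add: EK_eq G_def)
    also have "\<dots> = G l * ((b + a * base + W k) / W (Suc k))"
      by (simp add: add_divide_distrib algebra_simps)
    \<comment> \<open>The choice of \<open>base\<close> gives \<open>a * base = a + c / 8\<close>,
      so the relative growth per step is exactly \<open>c / 8\<close> over the new total
      weight.\<close>
    also have "b + a * base + W k = W (Suc k) + c / 8"
      using a_pos by (simp add: W_Suc base_def c_def field_simps)
    finally show ?thesis using W_pos[of "Suc k"] by (simp add: add_divide_distrib)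
  qed
  have G_nonneg: "EU k G \<ge> 0" for k
  proof -
    have "EU k (\<lambda>_. 0) \<le> EU k G"
      using W_pos base_gt_1 by (intro EU_mono) (auto simp: G_def EK_eq[symmetric] intro!: EK_nonneg)
    then show ?thesis by simp
  qed
  have "EU k G \<le> growth k"
  proof (induction k)
    case 0
    then show ?case using W_pos[of 0] by (simp add: G_def growth_def W_def)
  next
    case (Suc k)
    have "EU (Suc k) G = EU k (\<lambda>l. G l * (1 + c / (8 * W (Suc k))))"
      unfolding EU_Suc using G_Cons by (intro EU_cong) auto
    also have "\<dots> = EU k G * (1 + c / (8 * W (Suc k)))" by simp
    also have "\<dots> \<le> growth k * (1 + 1 / (8 * (real k + 1)))"
    proof (intro mult_mono add_left_mono)
      have "c * (real k + 1) \<le> W (Suc k)" using a_pos by (simp add: W_def add.commute)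
      then show "c / (8 * W (Suc k)) \<le> 1 / (8 * (real k + 1))"
        using W_pos[of "Suc k"] by (simp add: field_simps)
    qed (use Suc growth_ge_1[of k] W_pos[of "Suc k"] c_pos in auto)
    also have "\<dots> \<le> growth (Suc k)" by (rule growth_step)
    finally show ?case .
  qed
  moreover have "EU k (\<lambda>l. EK l (\<lambda>h. base ^ h)) = EU k G"
    by (intro EU_cong) (simp add: EK_eq G_def)
  ultimately show ?thesis by simp
qed

text \<open>Any power is dominated by a multiple of the exponential \<open>base ^ h\<close>, so
  moments of all orders share one growth rate and only the constant depends on
  \<open>q\<close>.\<close>

lemma depth_moments: "\<exists>C\<ge>0. \<forall>k. EU k (\<lambda>l. EK l (\<lambda>h. real h ^ q)) \<le> C * growth k"
proof -
  define s where "s = ln base"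
  have s: "s > 0" using base_gt_1 by (simp add: s_def)
  define C where "C = fact q / s ^ q"
  have le: "real h ^ q \<le> C * base ^ h" for h
  proof -
    have "(s * real h) ^ q \<le> fact q * exp (s * real h)" using s by (intro power_le_fact_exp) auto
    also have "exp (s * real h) = base ^ h"
      using base_gt_1 by (simp add: s_def exp_of_nat2_mult)
    finally show ?thesis using s by (simp add: C_def field_simps)
  qed
  have C: "C \<ge> 0" using s by (simp add: C_def)
  have "EU k (\<lambda>l. EK l (\<lambda>h. real h ^ q)) \<le> C * growth k" for k
  proof -
    have "EU k (\<lambda>l. EK l (\<lambda>h. real h ^ q)) \<le> EU k (\<lambda>l. C * EK l (\<lambda>h. base ^ h))"
    proof (rule EU_mono)
      fix l :: "nat list" assume l: "nonneg_mass l"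
      show "EK l (\<lambda>h. real h ^ q) \<le> C * EK l (\<lambda>h. base ^ h)"
        unfolding EK_mult[OF l, symmetric] by (rule EK_mono[OF l le])
    qed
    also have "\<dots> = C * EU k (\<lambda>l. EK l (\<lambda>h. base ^ h))" by simp
    also have "\<dots> \<le> C * growth k" using EU_EK_base C by (intro mult_left_mono) auto
    finally show ?thesis .
  qed
  then show ?thesis using C by blast
qed

text \<open>A common majorant of \<open>1\<close>, the deviation from the mean, its square, and
  \<open>V\<close>. Every remainder becomes a power of \<open>Q\<close>.\<close>

definition Q :: "nat list \<Rightarrow> nat \<Rightarrow> real" where
  "Q l h = (real h - A l)\<^sup>2 + V l + 1"

lemma Q_bounds:
  assumes "nonneg_mass l"
  shows "1 \<le> Q l h" "(real h - A l)\<^sup>2 \<le> Q l h" "V l \<le> Q l h" "\<bar>real h - A l\<bar> \<le> Q l h"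
proof -
  show 1: "1 \<le> Q l h" "(real h - A l)\<^sup>2 \<le> Q l h" "V l \<le> Q l h"
    using V_nonneg[OF assms] by (auto simp: Q_def)
  define d where "d = \<bar>real h - A l\<bar>"
  have "d \<ge> 0" "Q l h = d\<^sup>2 + V l + 1" by (auto simp: d_def Q_def)
  moreover have "0 \<le> (d - 1)\<^sup>2" by simp
  ultimately show "d \<le> Q l h"
    using V_nonneg[OF assms] by (simp add: power2_diff)
qed

text \<open>Both \<open>V\<close> and the square of \<open>A\<close> are parts of the conditional
  second moment \<open>y\<close>, so \<open>Q\<close> is at most \<open>2 * h^2 + 2 * y + 1\<close>.
  Jensen's inequality moves the power of \<open>y\<close> inside the expectation and leaves pure
  depth moments.\<close>

lemma Q_moments: "\<exists>C\<ge>0. \<forall>k. EU k (\<lambda>l. EK l (\<lambda>h. Q l h ^ r)) \<le> C * growth k"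
proof -
  obtain C where C: "C \<ge> 0" "\<And>k. EU k (\<lambda>l. EK l (\<lambda>h. real h ^ (2 * r))) \<le> C * growth k"
    using depth_moments[of "2 * r"] by auto
  have le: "EK l (\<lambda>h. Q l h ^ r) \<le> 3 ^ r * (2 * 2 ^ r) * EK l (\<lambda>h. real h ^ (2 * r)) + 3 ^ r"
    if l: "nonneg_mass l" for l
  proof -
    define y where "y = EK l (\<lambda>h. (real h)\<^sup>2)"
    have y: "y \<ge> 0" unfolding y_def by (rule EK_nonneg[OF l]) auto
    have Vy: "V l + (A l)\<^sup>2 = y" by (simp add: V_def y_def EK_eq[OF l])
    have Q: "Q l h ^ r \<le> (3 ^ r * 2 ^ r) * (real h ^ (2 * r)) + 0 * (real h) + (3 ^ r * 2 ^ r * y ^ r + 3 ^ r)" for h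
    proof -
      have "0 \<le> (real h + A l)\<^sup>2" by simp
      then have "(real h - A l)\<^sup>2 \<le> 2 * (real h)\<^sup>2 + 2 * (A l)\<^sup>2"
        by (simp add: power2_sum power2_diff)
      then have "Q l h \<le> 2 * (real h)\<^sup>2 + 2 * y + 1"
        unfolding Q_def Vy[symmetric] using V_nonneg[OF l] by simp
      then have "Q l h ^ r \<le> (2 * (real h)\<^sup>2 + 2 * y + 1) ^ r"
        using Q_bounds(1)[OF l, of h] by (intro power_mono) auto
      also have "\<dots> \<le> 3 ^ r * ((2 * (real h)\<^sup>2) ^ r + (2 * y) ^ r + 1 ^ r)"
        using y by (intro power_sum3_le) auto
      finally show ?thesis unfolding power_mult by (simp add: algebra_simps)
    qed
    have "EK l (\<lambda>h. Q l h ^ r) \<le> (3 ^ r * 2 ^ r) * EK l (\<lambda>h. real h ^ (2 * r)) + 0 * EK l real + (3 ^ r * 2 ^ r * y ^ r + 3 ^ r)"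
      unfolding EK_affine[OF l, symmetric] using Q by (rule EK_mono[OF l])
    also have "y ^ r \<le> EK l (\<lambda>h. real h ^ (2 * r))"
      unfolding y_def power_mult by (rule EK_power_le[OF l]) auto
    finally show ?thesis by (simp add: algebra_simps)
  qed
  define D where "D = 3 ^ r * (2 * 2 ^ r) * C + 3 ^ r"
  have "EU k (\<lambda>l. EK l (\<lambda>h. Q l h ^ r)) \<le> D * growth k" for k
  proof -
    have "EU k (\<lambda>l. EK l (\<lambda>h. Q l h ^ r))
        \<le> EU k (\<lambda>l. 3 ^ r * (2 * 2 ^ r) * EK l (\<lambda>h. real h ^ (2 * r)) + 3 ^ r)"
      using le by (intro EU_mono) auto
    also have "\<dots> = 3 ^ r * (2 * 2 ^ r) * EU k (\<lambda>l. EK l (\<lambda>h. real h ^ (2 * r))) + 3 ^ r"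
      unfolding EU_add by simp
    also have "\<dots> \<le> 3 ^ r * (2 * 2 ^ r) * (C * growth k) + 3 ^ r * growth k"
      using C growth_ge_1[of k] by (intro add_mono mult_left_mono) auto
    finally show ?thesis by (simp add: D_def algebra_simps)
  qed
  moreover have "D \<ge> 0" using C by (simp add: D_def)
  ultimately show ?thesis by blast
qed

end

section \<open>The conditional variance\<close>

context depth_urn begin

lemma inverse_W_le: "1 / W (Suc k) \<le> 1 / (real k + 2)" "1 / (W (Suc k))\<^sup>2 \<le> 1 / (real k + 2)\<^sup>2"
proof -
  have "W (Suc k) \<ge> real k + 2" using W_ge[of "Suc k"] by simp
  then show "1 / W (Suc k) \<le> 1 / (real k + 2)" "1 / (W (Suc k))\<^sup>2 \<le> 1 / (real k + 2)\<^sup>2"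
    by (intro divide_left_mono power_mono mult_pos_pos zero_less_power; simp add: W_pos)+
qed

definition V_drift :: "nat list \<Rightarrow> nat \<Rightarrow> real" where
  "V_drift l h = (a + c * ((real h - A l)\<^sup>2 - V l) + 2 * a * (real h - A l)) / W (Suc (length l))"

context
  fixes l :: "nat list" and k :: nat
  assumes l: "nonneg_mass l" and k: "length l = k"
begin

lemma V_Cons_eq: "V (h # l) = V l + V_drift l h - ((a + c * (real h - A l)) / W (Suc k))\<^sup>2"
  using V_Cons[of h l] by (simp add: V_drift_def k)

text \<open>The deviation and the squared deviation minus \<open>V\<close> are both centred given
  the past. The mean drift is therefore deterministic and harmonic, the origin of the
  logarithm.\<close>

lemma EK_V_drift: "EK l (V_drift l) = a / W (Suc k)"
proof -
  have "EK l (V_drift l) = EK l (\<lambda>h. (c / W (Suc k)) * (real h - A l)\<^sup>2 + (2 * a / W (Suc k)) * (real h - A l) + (a - c * V l) / W (Suc k))"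
    by (intro Bochner_Integration.integral_cong) (simp_all add: V_drift_def k add_divide_distrib diff_divide_distrib algebra_simps)
  also have "\<dots> = a / W (Suc k)"
    unfolding EK_affine[OF l] EK_square[OF l] EK_centered[OF l] by (simp add: diff_divide_distrib)
  finally show ?thesis .
qed

lemma square_diff_V_le: "\<bar>(real h - A l)\<^sup>2 - V l\<bar> \<le> Q l h"
  using V_nonneg[OF l] zero_le_power2[of "real h - A l"] unfolding Q_def abs_le_iff by linarith

lemma V_drift_le: "\<bar>V_drift l h\<bar> \<le> (3 * a + c) * Q l h / W (Suc k)"
proof -
  have "\<bar>a + c * ((real h - A l)\<^sup>2 - V l) + 2 * a * (real h - A l)\<bar>
      \<le> a * 1 + c * \<bar>(real h - A l)\<^sup>2 - V l\<bar> + 2 * a * \<bar>real h - A l\<bar>"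
    using a_pos c_pos by (auto simp: abs_mult intro!: abs_triangle_ineq[THEN order_trans] add_mono)
  also have "\<dots> \<le> a * Q l h + c * Q l h + 2 * a * Q l h"
    using a_pos c_pos Q_bounds[OF l, of h] square_diff_V_le[of h] by (intro add_mono mult_left_mono) auto
  finally show ?thesis
    unfolding V_drift_def k abs_divide using W_pos[of "Suc k"]
    by (simp add: divide_right_mono algebra_simps)
qed

text \<open>Expansion around \<open>V l\<close>: the linear term is evaluated by the deterministic
  drift, and everything of second or higher order is a power of \<open>Q\<close> over a squared
  weight.\<close>

lemma EK_V_power:
  assumes r: "r \<ge> 2"
  shows "EK l (\<lambda>h. V (h # l) ^ r) \<le> V l ^ r + real r * (a / W (Suc k)) * V l ^ (r - 1)
    + (2 ^ r * (2 * (3 * a + c) ^ r)) * EK l (\<lambda>h. Q l h ^ r) / (real k + 2)\<^sup>2"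
proof -
  define K where "K = 3 * a + c"
  define w where "w = W (Suc k)"
  have K: "K \<ge> 1" using a_ge_1 c_pos by (simp add: K_def)
  have w: "w \<ge> 1" using W_ge[of "Suc k"] by (simp add: w_def)
  \<comment> \<open>Dropping the negative square before raising to the power \<open>r\<close>
    requires \<open>V (h # l)\<close> to be nonnegative, which is available for depths that can
    actually be drawn. Hence the comparison below is only made on the support of the kernel.\<close>
  have nonneg: "V (h # l) \<ge> 0" if "h \<in> set_pmf (kernel l)" for h
  proof -
    show ?thesis
    proof (rule V_nonneg)
      have "mass l h > 0" using that set_kernel(1)[OF l] l by (auto simp: nonneg_mass_def less_le)
      then have "mass l h \<ge> 1" using Ints_nonzero_abs_ge1[OF mass_int[of h l]] by simp
      then have "0 \<le> mass (h # l) i" for i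
        using l b_ge a_pos by (cases "i = h") (auto simp: nonneg_mass_def)
      then show "nonneg_mass (h # l)" by (simp add: nonneg_mass_def)
    qed
  qed
  have le: "V (h # l) ^ r \<le> (real r * V l ^ (r - 1)) * V_drift l h
      + (2 ^ r * (2 * K ^ r) / w\<^sup>2) * Q l h ^ r + V l ^ r" if h: "h \<in> set_pmf (kernel l)" for h
  proof -
    define g where "g = V_drift l h"
    have q: "Q l h \<ge> 1" "V l \<ge> 0" "V l \<le> Q l h"
      using Q_bounds[OF l, of h] V_nonneg[OF l] by auto
    have g: "\<bar>g\<bar> \<le> K * Q l h / w" using V_drift_le[of h] by (simp add: g_def K_def w_def)
    have "\<bar>g\<bar>\<^sup>2 \<le> (K * Q l h / w)\<^sup>2" using g by (rule power_mono) simp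
    then have "V l ^ (r - 2) * g\<^sup>2 \<le> Q l h ^ (r - 2) * (K * Q l h / w)\<^sup>2"
      using q by (intro mult_mono power_mono[of "V l"]) simp_all
    also have "\<dots> = K\<^sup>2 * (Q l h ^ (r - 2) * Q l h ^ 2) / w\<^sup>2"
      by (simp add: power_divide power_mult_distrib)
    also have "Q l h ^ (r - 2) * Q l h ^ 2 = Q l h ^ r"
      unfolding power_add[symmetric] using r by (simp only: le_add_diff_inverse2)
    also have "K\<^sup>2 * Q l h ^ r / w\<^sup>2 \<le> K ^ r * Q l h ^ r / w\<^sup>2"
      using K r q by (intro divide_right_mono mult_right_mono power_increasing) auto
    finally have 1: "\<bar>V l\<bar> ^ (r - 2) * g\<^sup>2 \<le> K ^ r * Q l h ^ r / w\<^sup>2" using q by simp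
    have "\<bar>g\<bar> ^ r \<le> (K * Q l h / w) ^ r" using g by (intro power_mono) auto
    also have "\<dots> = K ^ r * Q l h ^ r / w ^ r" by (simp add: power_divide power_mult_distrib)
    also have "\<dots> \<le> K ^ r * Q l h ^ r / w\<^sup>2"
      using w r q K by (intro divide_left_mono power_increasing mult_pos_pos mult_nonneg_nonneg) auto
    finally have 2: "\<bar>g\<bar> ^ r \<le> K ^ r * Q l h ^ r / w\<^sup>2" .
    have "V (h # l) \<le> V l + g" unfolding V_Cons_eq g_def by simp
    then have "V (h # l) ^ r \<le> (V l + g) ^ r" using nonneg[OF h] by (intro power_mono)
    also have "\<dots> \<le> V l ^ r + real r * V l ^ (r - 1) * g + 2 ^ r * (\<bar>V l\<bar> ^ (r - 2) * g\<^sup>2 + \<bar>g\<bar> ^ r)"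
      using power_add_remainder[of "V l" g r] by linarith
    also have "\<dots> \<le> V l ^ r + real r * V l ^ (r - 1) * g + 2 ^ r * (K ^ r * Q l h ^ r / w\<^sup>2 + K ^ r * Q l h ^ r / w\<^sup>2)"
      using 1 2 by (intro add_left_mono mult_left_mono add_mono) auto
    finally show ?thesis by (simp add: g_def algebra_simps)
  qed
  have "EK l (\<lambda>h. V (h # l) ^ r) \<le> EK l (\<lambda>h. (real r * V l ^ (r - 1)) * V_drift l h
      + (2 ^ r * (2 * K ^ r) / w\<^sup>2) * Q l h ^ r + V l ^ r)"
    using le by (intro integral_mono_AE integrable_kernel[OF l]) (auto simp: AE_measure_pmf_iff)
  also have "\<dots> = V l ^ r + real r * (a / W (Suc k)) * V l ^ (r - 1)
    + (2 ^ r * (2 * K ^ r)) * EK l (\<lambda>h. Q l h ^ r) * (1 / w\<^sup>2)"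
    unfolding EK_affine[OF l] EK_V_drift by simp
  also have "\<dots> \<le> V l ^ r + real r * (a / W (Suc k)) * V l ^ (r - 1)
    + (2 ^ r * (2 * K ^ r)) * EK l (\<lambda>h. Q l h ^ r) * (1 / (real k + 2)\<^sup>2)"
    unfolding w_def using K Q_bounds(1)[OF l]
    by (intro add_left_mono mult_left_mono inverse_W_le mult_nonneg_nonneg EK_nonneg[OF l] zero_le_power)
      (auto intro: order_trans[of 0 1])
  finally show ?thesis by (simp add: K_def)
qed

lemma EK_V_le: "EK l (\<lambda>h. V (h # l)) \<le> V l + a / W (Suc k)"
proof -
  have "EK l (\<lambda>h. V (h # l)) \<le> EK l (\<lambda>h. 1 * V_drift l h + 0 * V_drift l h + V l)"
    by (rule EK_mono[OF l]) (simp add: V_Cons_eq)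
  then show ?thesis unfolding EK_affine[OF l] EK_V_drift by simp
qed

end

lemma EU_V_recursion:
  assumes "r \<ge> 1"
  shows "\<exists>C\<ge>0. \<forall>k. EU (Suc k) (\<lambda>l. V l ^ r) \<le> EU k (\<lambda>l. V l ^ r)
    + real r * a / (real k + 2) * EU k (\<lambda>l. V l ^ (r - 1)) + C * (growth k / (real k + 2)\<^sup>2)"
proof -
  have drift: "real r * (a / W (Suc k)) * V l ^ (r - 1) \<le> (real r * a / (real k + 2)) * V l ^ (r - 1)"
    if "nonneg_mass l" for k l
  proof (rule mult_right_mono)
    have "real r * a * (1 / W (Suc k)) \<le> real r * a * (1 / (real k + 2))"
      using a_pos by (intro mult_left_mono inverse_W_le) auto
    then show "real r * (a / W (Suc k)) \<le> real r * a / (real k + 2)" by simp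
  qed (use V_nonneg[OF that] in auto)
  show ?thesis
  proof (cases "r = 1")
    case True
    have "EU (Suc k) (\<lambda>l. V l ^ r) \<le> EU k (\<lambda>l. V l + a / (real k + 2))" for k
      unfolding EU_Suc using True
      by (intro EU_mono) (use EK_V_le drift[of _ k] in \<open>force intro: order_trans\<close>)
    then show ?thesis unfolding EU_add using True by (intro exI[of _ 0]) auto
  next
    case False
    then have r: "r \<ge> 2" using assms by simp
    define D where "D = 2 ^ r * (2 * (3 * a + c) ^ r)"
    have D: "D \<ge> 0" using a_pos c_pos by (simp add: D_def)
    obtain C where C: "C \<ge> 0" "\<And>k. EU k (\<lambda>l. EK l (\<lambda>h. Q l h ^ r)) \<le> C * growth k"
      using Q_moments[of r] by auto
    have "EU (Suc k) (\<lambda>l. V l ^ r) \<le> EU k (\<lambda>l. V l ^ r)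
      + real r * a / (real k + 2) * EU k (\<lambda>l. V l ^ (r - 1)) + (D * C) * (growth k / (real k + 2)\<^sup>2)" for k
    proof -
      have "EU (Suc k) (\<lambda>l. V l ^ r) \<le> EU k (\<lambda>l. V l ^ r + (real r * a / (real k + 2)) * V l ^ (r - 1)
          + D / (real k + 2)\<^sup>2 * EK l (\<lambda>h. Q l h ^ r))"
        unfolding EU_Suc
      proof (rule EU_mono)
        fix l :: "nat list" assume l: "length l = k" "nonneg_mass l"
        show "EK l (\<lambda>h. V (h # l) ^ r) \<le> V l ^ r + (real r * a / (real k + 2)) * V l ^ (r - 1)
          + D / (real k + 2)\<^sup>2 * EK l (\<lambda>h. Q l h ^ r)"
          using EK_V_power[OF l(2,1) r] drift[OF l(2), of k] by (simp add: D_def)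
      qed
      also have "\<dots> = EU k (\<lambda>l. V l ^ r) + real r * a / (real k + 2) * EU k (\<lambda>l. V l ^ (r - 1))
          + D / (real k + 2)\<^sup>2 * EU k (\<lambda>l. EK l (\<lambda>h. Q l h ^ r))"
        unfolding EU_add by simp
      also have "\<dots> \<le> EU k (\<lambda>l. V l ^ r) + real r * a / (real k + 2) * EU k (\<lambda>l. V l ^ (r - 1))
          + D / (real k + 2)\<^sup>2 * (C * growth k)"
        using C D by (intro add_left_mono mult_left_mono) auto
      finally show ?thesis by (simp add: mult.assoc)
    qed
    then show ?thesis using C D by (intro exI[of _ "D * C"]) auto
  qed
qed

text \<open>Induction on the order: the moment of order \<open>r + 1\<close> is driven by that of
  order \<open>r\<close> divided by \<open>k + 2\<close>. Each order thus costs one harmonic sum,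
  that is one factor \<open>lnp k\<close>, while the crude remainders sum to a constant.\<close>

lemma V_moments: "\<exists>C\<ge>0. \<forall>k. EU k (\<lambda>l. V l ^ r) \<le> C * lnp k ^ r"
proof (induction r)
  case 0
  then show ?case by (intro exI[of _ 1]) auto
next
  case (Suc r)
  then obtain C where C: "C \<ge> 0" "\<And>k. EU k (\<lambda>l. V l ^ r) \<le> C * lnp k ^ r" by auto
  obtain D where D: "D \<ge> 0" "\<And>k. EU (Suc k) (\<lambda>l. V l ^ Suc r) \<le> EU k (\<lambda>l. V l ^ Suc r)
    + real (Suc r) * a / (real k + 2) * EU k (\<lambda>l. V l ^ r) + D * (growth k / (real k + 2)\<^sup>2)"
    using EU_V_recursion[of "Suc r"] by auto
  obtain B where B: "B \<ge> 0" "\<And>k. (\<Sum>j<k. growth j / (real j + 2)\<^sup>2) \<le> B"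
    using sum_growth_bounded by auto
  define E where "E = real (Suc r) * a * C"
  have E: "E \<ge> 0" using C a_pos by (simp add: E_def)
  have "EU k (\<lambda>l. V l ^ Suc r) \<le> (\<Sum>j<k. E * lnp j ^ r * (1 / (real j + 2)) + D * (growth j / (real j + 2)\<^sup>2))" for k
  proof (induction k)
    case 0
    then show ?case by simp
  next
    case (Suc k)
    have "real (Suc r) * a / (real k + 2) * EU k (\<lambda>l. V l ^ r) \<le> real (Suc r) * a / (real k + 2) * (C * lnp k ^ r)"
      using C a_pos by (intro mult_left_mono) auto
    also have "\<dots> = E * lnp k ^ r * (1 / (real k + 2))" by (simp add: E_def)
    finally show ?case using Suc D(2)[of k] by simp
  qed
  also have "(\<Sum>j<k. E * lnp j ^ r * (1 / (real j + 2)) + D * (growth j / (real j + 2)\<^sup>2))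
      \<le> (E + D * B) * lnp k ^ Suc r" for k
  proof -
    have "(\<Sum>j<k. E * lnp j ^ r * (1 / (real j + 2))) \<le> (\<Sum>j<k. E * lnp k ^ r * (1 / (real j + 2)))"
      using E by (intro sum_mono mult_right_mono mult_left_mono power_mono lnp_mono)
        (auto intro: order_trans[OF _ lnp_ge_1])
    also have "\<dots> = E * lnp k ^ r * (\<Sum>j<k. 1 / (real j + 2))" by (simp add: sum_distrib_left)
    also have "\<dots> \<le> E * lnp k ^ r * lnp k"
    proof (rule mult_left_mono)
      show "(\<Sum>j<k. 1 / (real j + 2)) \<le> lnp k" using sum_inverse_le_ln[of k] by (simp add: lnp_def)
    qed (use E lnp_ge_1[of k] in auto)
    finally have 1: "(\<Sum>j<k. E * lnp j ^ r * (1 / (real j + 2))) \<le> E * lnp k ^ Suc r" by (simp add: mult_ac)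
    have "(\<Sum>j<k. D * (growth j / (real j + 2)\<^sup>2)) = D * (\<Sum>j<k. growth j / (real j + 2)\<^sup>2)"
      by (simp add: sum_distrib_left)
    also have "\<dots> \<le> D * B * 1" using B D by (simp add: mult_left_mono)
    also have "\<dots> \<le> D * B * lnp k ^ Suc r"
      using B D lnp_ge_1[of k] by (intro mult_left_mono one_le_power) auto
    finally show ?thesis using 1 unfolding sum.distrib distrib_right by linarith
  qed
  finally show ?case using E B D by (intro exI[of _ "E + D * B"]) auto
qed

text \<open>The sequence has two roles: it is the mean of \<open>A\<close>, and, as the accumulated
  mean of \<open>V_drift\<close>, it is the centre of \<open>V\<close>.\<close>

definition alpha :: "nat \<Rightarrow> real" where
  "alpha k = (\<Sum>j<k. a / W (Suc j))"

lemma alpha_bounds: "0 \<le> alpha k" "alpha k \<le> a * lnp k"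
proof -
  show "0 \<le> alpha k" unfolding alpha_def using a_pos W_pos by (intro sum_nonneg) (auto intro: less_imp_le)
  have "alpha k \<le> (\<Sum>j<k. a * (1 / (real j + 2)))"
    unfolding alpha_def
  proof (rule sum_mono)
    fix j
    have "a * (1 / W (Suc j)) \<le> a * (1 / (real j + 2))"
      using a_pos by (intro mult_left_mono inverse_W_le) auto
    then show "a / W (Suc j) \<le> a * (1 / (real j + 2))" by simp
  qed
  also have "\<dots> = a * (\<Sum>j<k. 1 / (real j + 2))" by (simp add: sum_distrib_left)
  also have "\<dots> \<le> a * lnp k"
    using a_pos sum_inverse_le_ln[of k] by (intro mult_left_mono) (auto simp: lnp_def)
  finally show "alpha k \<le> a * lnp k" .
qed

text \<open>The increment of \<open>V - alpha\<close> has conditional mean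
  \<open>- (a^2 + c^2 * V l)\<close> over the squared weight. In the cross term the part with
  \<open>V l\<close> has a favourable sign and is dropped. The part with \<open>alpha k\<close> is
  split by the inequality between arithmetic and geometric means. In \<open>K\<close>, the terms
  \<open>2 * a + c\<close> bound the drift and the squares bound the squared increment of
  \<open>A\<close>.\<close>

lemma EK_V_variance:
  assumes l: "nonneg_mass l" and k: "length l = k"
  defines "K \<equiv> 2 * a + c + 2 * a\<^sup>2 + 2 * c\<^sup>2"
  shows "EK l (\<lambda>h. (V (h # l) - alpha (Suc k))\<^sup>2) \<le> (V l - alpha k)\<^sup>2
    + (2 * K\<^sup>2 * EK l (\<lambda>h. (Q l h)\<^sup>2) + (alpha k)\<^sup>2) / (real k + 2)\<^sup>2"
proof -
  define w where "w = W (Suc k)"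
  have w: "w \<ge> 1" using W_ge[of "Suc k"] by (simp add: w_def)
  have K: "K \<ge> 0" using a_pos c_pos by (simp add: K_def)
  define e where "e h = V_drift l h - ((a + c * (real h - A l)) / w)\<^sup>2 - a / w" for h
  have step: "V (h # l) - alpha (Suc k) = (V l - alpha k) + e h" for h
    by (simp add: V_Cons_eq[OF l k] e_def w_def alpha_def)
  have e_le: "\<bar>e h\<bar> \<le> K * Q l h / w" for h
  proof -
    define d where "d = real h - A l"
    have q: "d\<^sup>2 \<le> Q l h" "\<bar>d\<bar> \<le> Q l h" "1 \<le> Q l h" "\<bar>d\<^sup>2 - V l\<bar> \<le> Q l h"
      using Q_bounds[OF l, of h] square_diff_V_le[OF l k, of h] by (simp_all add: d_def)
    have "e h = (c * (d\<^sup>2 - V l) + 2 * a * d) / w - (a + c * d)\<^sup>2 / w\<^sup>2"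
      unfolding e_def V_drift_def k w_def[symmetric] d_def[symmetric]
      by (simp add: power_divide add.assoc diff_divide_distrib[symmetric])
    also have "\<bar>\<dots>\<bar> \<le> \<bar>c * (d\<^sup>2 - V l) + 2 * a * d\<bar> / w + (a + c * d)\<^sup>2 / w\<^sup>2"
      using w by (intro abs_triangle_ineq4[THEN order_trans]) simp
    also have "\<dots> \<le> (c + 2 * a) * Q l h / w + (2 * a\<^sup>2 + 2 * c\<^sup>2) * Q l h / w"
    proof (rule add_mono)
      have "\<bar>c * (d\<^sup>2 - V l) + 2 * a * d\<bar> \<le> c * \<bar>d\<^sup>2 - V l\<bar> + 2 * a * \<bar>d\<bar>"
        using a_pos c_pos by (intro abs_triangle_ineq[THEN order_trans]) (simp add: abs_mult)
      also have "\<dots> \<le> c * Q l h + 2 * a * Q l h"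
        using a_pos c_pos q by (intro add_mono mult_left_mono) auto
      finally show "\<bar>c * (d\<^sup>2 - V l) + 2 * a * d\<bar> / w \<le> (c + 2 * a) * Q l h / w"
        using w by (intro divide_right_mono) (auto simp: algebra_simps)
      have "0 \<le> (a - c * d)\<^sup>2" by simp
      then have "(a + c * d)\<^sup>2 \<le> 2 * a\<^sup>2 * 1 + 2 * c\<^sup>2 * d\<^sup>2"
        by (simp add: power2_sum power2_diff power_mult_distrib mult.commute[of "d\<^sup>2"])
      also have "\<dots> \<le> 2 * a\<^sup>2 * Q l h + 2 * c\<^sup>2 * Q l h"
        using q by (intro add_mono mult_left_mono) auto
      finally have "(a + c * d)\<^sup>2 / w\<^sup>2 \<le> (2 * a\<^sup>2 + 2 * c\<^sup>2) * Q l h / w\<^sup>2"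
        by (intro divide_right_mono) (auto simp: algebra_simps)
      also have "\<dots> \<le> (2 * a\<^sup>2 + 2 * c\<^sup>2) * Q l h / w"
        using w q by (intro divide_left_mono self_le_power mult_pos_pos mult_nonneg_nonneg) auto
      finally show "(a + c * d)\<^sup>2 / w\<^sup>2 \<le> (2 * a\<^sup>2 + 2 * c\<^sup>2) * Q l h / w" .
    qed
    finally show ?thesis by (simp add: K_def add_divide_distrib algebra_simps)
  qed
  have EK_e: "EK l e = - (a\<^sup>2 + c\<^sup>2 * V l) / w\<^sup>2"
  proof -
    have "EK l e = EK l (\<lambda>h. 1 * V_drift l h + (- 1) * ((c / w)\<^sup>2 * (real h - A l)\<^sup>2 + (2 * a * c / w\<^sup>2) * (real h - A l) + (a / w)\<^sup>2) + (- (a / w)))"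
    proof (intro Bochner_Integration.integral_cong refl)
      fix h
      define d where "d = real h - A l"
      have "((a + c * d) / w)\<^sup>2 = (c / w)\<^sup>2 * d\<^sup>2 + (2 * a * c / w\<^sup>2) * d + (a / w)\<^sup>2"
        using w by (simp add: power2_eq_square field_simps)
      then show "e h = 1 * V_drift l h + (- 1) * ((c / w)\<^sup>2 * (real h - A l)\<^sup>2 + (2 * a * c / w\<^sup>2) * (real h - A l) + (a / w)\<^sup>2) + (- (a / w))"
        by (simp add: e_def d_def)
    qed
    also have "\<dots> = - ((c / w)\<^sup>2 * V l + (a / w)\<^sup>2)"
      unfolding EK_affine[OF l] EK_V_drift[OF l k] EK_square[OF l] EK_centered[OF l] by (simp add: w_def)
    finally show ?thesis by (simp add: power_divide add_divide_distrib diff_divide_distrib)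
  qed
  define q2 where "q2 = EK l (\<lambda>h. (Q l h)\<^sup>2)"
  have cross: "2 * alpha k * (a\<^sup>2 + c\<^sup>2 * V l) \<le> (alpha k)\<^sup>2 + K\<^sup>2 * q2"
  proof -
    have "(a\<^sup>2 + c\<^sup>2 * V l)\<^sup>2 = EK l (\<lambda>h. (a\<^sup>2 + c\<^sup>2 * V l)\<^sup>2)" by simp
    also have "\<dots> \<le> EK l (\<lambda>h. K\<^sup>2 * (Q l h)\<^sup>2)"
    proof (rule EK_mono[OF l])
      fix h
      have "a\<^sup>2 * 1 + c\<^sup>2 * V l \<le> a\<^sup>2 * Q l h + c\<^sup>2 * Q l h"
        using Q_bounds[OF l, of h] by (intro add_mono mult_left_mono) auto
      also have "\<dots> \<le> K * Q l h"
        using Q_bounds(1)[OF l, of h] a_pos c_pos unfolding distrib_right[symmetric]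
        by (intro mult_right_mono) (auto simp: K_def)
      finally have "(a\<^sup>2 + c\<^sup>2 * V l)\<^sup>2 \<le> (K * Q l h)\<^sup>2"
        using V_nonneg[OF l] by (intro power_mono) auto
      then show "(a\<^sup>2 + c\<^sup>2 * V l)\<^sup>2 \<le> K\<^sup>2 * (Q l h)\<^sup>2" by (simp add: power_mult_distrib)
    qed
    also have "\<dots> = K\<^sup>2 * q2" by (simp add: q2_def)
    finally have *: "(a\<^sup>2 + c\<^sup>2 * V l)\<^sup>2 \<le> K\<^sup>2 * q2" .
    have "0 \<le> (alpha k - (a\<^sup>2 + c\<^sup>2 * V l))\<^sup>2" by simp
    then show ?thesis using * unfolding power2_diff[of "alpha k"] by simp
  qed
  have "EK l (\<lambda>h. (V (h # l) - alpha (Suc k))\<^sup>2)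
      \<le> EK l (\<lambda>h. (2 * (V l - alpha k)) * e h + (K\<^sup>2 / w\<^sup>2) * (Q l h)\<^sup>2 + (V l - alpha k)\<^sup>2)"
  proof (rule EK_mono[OF l])
    fix h
    have "\<bar>e h\<bar>\<^sup>2 \<le> (K * Q l h / w)\<^sup>2" by (intro power_mono e_le) auto
    then show "(V (h # l) - alpha (Suc k))\<^sup>2 \<le> (2 * (V l - alpha k)) * e h + (K\<^sup>2 / w\<^sup>2) * (Q l h)\<^sup>2 + (V l - alpha k)\<^sup>2"
      unfolding step power2_sum by (simp add: power_divide power_mult_distrib)
  qed
  also have "\<dots> = (V l - alpha k)\<^sup>2 + (2 * (alpha k - V l) * (a\<^sup>2 + c\<^sup>2 * V l) + K\<^sup>2 * q2) / w\<^sup>2"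
    unfolding EK_affine[OF l] EK_e q2_def[symmetric] by (simp add: add_divide_distrib algebra_simps diff_divide_distrib)
  also have "\<dots> \<le> (V l - alpha k)\<^sup>2 + ((alpha k)\<^sup>2 + 2 * K\<^sup>2 * q2) / w\<^sup>2"
  proof (intro add_left_mono divide_right_mono)
    have "V l * (a\<^sup>2 + c\<^sup>2 * V l) \<ge> 0" using V_nonneg[OF l] by (intro mult_nonneg_nonneg) auto
    then show "2 * (alpha k - V l) * (a\<^sup>2 + c\<^sup>2 * V l) + K\<^sup>2 * q2 \<le> (alpha k)\<^sup>2 + 2 * K\<^sup>2 * q2"
      using cross left_diff_distrib[of "2 * alpha k" "2 * V l" "a\<^sup>2 + c\<^sup>2 * V l"]
      unfolding right_diff_distrib mult.assoc by linarith
  qed auto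
  also have "\<dots> \<le> (V l - alpha k)\<^sup>2 + ((alpha k)\<^sup>2 + 2 * K\<^sup>2 * q2) * (1 / (real k + 2)\<^sup>2)"
  proof -
    have "q2 \<ge> 0" unfolding q2_def by (intro EK_nonneg[OF l]) auto
    then have "((alpha k)\<^sup>2 + 2 * K\<^sup>2 * q2) * (1 / w\<^sup>2) \<le> ((alpha k)\<^sup>2 + 2 * K\<^sup>2 * q2) * (1 / (real k + 2)\<^sup>2)"
      unfolding w_def by (intro mult_left_mono inverse_W_le) auto
    then show ?thesis by simp
  qed
  finally show ?thesis by (simp add: q2_def add.commute)
qed

text \<open>Since \<open>alpha\<close> grows logarithmically, its square is absorbed by
  \<open>growth\<close>, and all increments of the variance are summable. The fluctuations of
  \<open>V\<close> are thus bounded in \<open>L_2\<close> although \<open>V\<close> itself grows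
  logarithmically.\<close>

lemma V_variance: "\<exists>C\<ge>0. \<forall>k. EU k (\<lambda>l. (V l - alpha k)\<^sup>2) \<le> C"
proof -
  define K where "K = 2 * a + c + 2 * a\<^sup>2 + 2 * c\<^sup>2"
  obtain C where C: "C \<ge> 0" "\<And>k. EU k (\<lambda>l. EK l (\<lambda>h. (Q l h)\<^sup>2)) \<le> C * growth k"
    using Q_moments[of 2] by auto
  obtain B where B: "B \<ge> 0" "\<And>k. (\<Sum>j<k. growth j / (real j + 2)\<^sup>2) \<le> B"
    using sum_growth_bounded by auto
  define D where "D = 2 * K\<^sup>2 * C + 64 * a\<^sup>2"
  have D: "D \<ge> 0" using C by (simp add: D_def)
  have "EU k (\<lambda>l. (V l - alpha k)\<^sup>2) \<le> D * (\<Sum>j<k. growth j / (real j + 2)\<^sup>2)" for k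
  proof (induction k)
    case 0
    then show ?case by (simp add: alpha_def)
  next
    case (Suc k)
    have "EU (Suc k) (\<lambda>l. (V l - alpha (Suc k))\<^sup>2) \<le> EU k (\<lambda>l. (V l - alpha k)\<^sup>2
        + ((2 * K\<^sup>2 / (real k + 2)\<^sup>2) * EK l (\<lambda>h. (Q l h)\<^sup>2) + (alpha k)\<^sup>2 / (real k + 2)\<^sup>2))"
      unfolding EU_Suc
    proof (rule EU_mono)
      fix l :: "nat list" assume l: "length l = k" "nonneg_mass l"
      show "EK l (\<lambda>h. (V (h # l) - alpha (Suc k))\<^sup>2) \<le> (V l - alpha k)\<^sup>2
        + ((2 * K\<^sup>2 / (real k + 2)\<^sup>2) * EK l (\<lambda>h. (Q l h)\<^sup>2) + (alpha k)\<^sup>2 / (real k + 2)\<^sup>2)"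
        using EK_V_variance[OF l(2,1)] by (simp add: K_def add_divide_distrib)
    qed
    also have "\<dots> = EU k (\<lambda>l. (V l - alpha k)\<^sup>2)
        + (2 * K\<^sup>2 * EU k (\<lambda>l. EK l (\<lambda>h. (Q l h)\<^sup>2)) + (alpha k)\<^sup>2) / (real k + 2)\<^sup>2"
      unfolding EU_add by (simp add: add_divide_distrib)
    also have "\<dots> \<le> EU k (\<lambda>l. (V l - alpha k)\<^sup>2) + (2 * K\<^sup>2 * (C * growth k) + 64 * a\<^sup>2 * growth k) / (real k + 2)\<^sup>2"
    proof (intro add_left_mono divide_right_mono add_mono mult_left_mono C)
      have "(alpha k)\<^sup>2 \<le> (a * lnp k)\<^sup>2" using alpha_bounds by (intro power_mono)
      also have "\<dots> \<le> a\<^sup>2 * (64 * growth k)"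
        unfolding power_mult_distrib by (intro mult_left_mono lnp_squared_le) auto
      finally show "(alpha k)\<^sup>2 \<le> 64 * a\<^sup>2 * growth k" by simp
    qed auto
    also have "\<dots> = EU k (\<lambda>l. (V l - alpha k)\<^sup>2) + D * (growth k / (real k + 2)\<^sup>2)"
      by (simp add: D_def add_divide_distrib algebra_simps)
    finally show ?case using Suc by (simp add: distrib_left)
  qed
  also have "D * (\<Sum>j<k. growth j / (real j + 2)\<^sup>2) \<le> D * B" for k
    using B D by (intro mult_left_mono) auto
  finally show ?thesis using B D by (intro exI[of _ "D * B"]) auto
qed

end

section \<open>Moments of the martingale tails\<close>

text \<open>This is \<open>ln N / N\<close> at \<open>N = n + 1\<close>, the number of nodes of the
  tree that belongs to a list of length \<open>n\<close>.\<close>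

definition tailvar :: "nat \<Rightarrow> real" where
  "tailvar n = ln (real n + 1) / (real n + 1)"

lemma half_le_ln_2: "1 / 2 \<le> ln (2::real)"
  using ln_le_minus_one[of "1/2 :: real"] by (simp add: ln_div)

lemma half_le_ln: "n \<ge> 1 \<Longrightarrow> 1 / 2 \<le> ln (real n + 1)"
  using half_le_ln_2 ln_le_cancel_iff[of 2 "real n + 1"] by linarith

lemma tailvar_pos: "n \<ge> 1 \<Longrightarrow> tailvar n > 0"
  using half_le_ln[of n] by (auto simp: tailvar_def)

lemma tailvar_ge:
  assumes "1 \<le> n" "n \<le> k"
  shows "1 / (2 * (real k + 2)) \<le> tailvar n"
proof -
  have "1 / (2 * (real k + 2)) \<le> (1 / 2) / (real n + 1)"
    using assms by (simp add: field_simps)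
  also have "\<dots> \<le> tailvar n"
    unfolding tailvar_def using half_le_ln[OF assms(1)] by (intro divide_right_mono) auto
  finally show ?thesis .
qed

lemma ln_increment:
  fixes y :: real
  assumes "y > 0"
  shows "1 / (y + 1) \<le> ln (y + 1) - ln y" "ln (y + 1) - ln y \<le> 1 / y"
proof -
  have "ln ((y + 1) / y) \<le> (y + 1) / y - 1" using assms by (intro ln_le_minus_one) auto
  then show "ln (y + 1) - ln y \<le> 1 / y" using assms by (simp add: ln_div field_simps)
  have "ln (y / (y + 1)) \<le> y / (y + 1) - 1" using assms by (intro ln_le_minus_one) auto
  moreover have "y / (y + 1) - 1 = - (1 / (y + 1))" using assms by (simp add: field_simps)
  ultimately show "1 / (y + 1) \<le> ln (y + 1) - ln y" using assms by (simp add: ln_div)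
qed

lemma sum_lnp_le:
  assumes "1 \<le> n"
  shows "(\<Sum>j=n..<k. lnp j / (real j + 2)\<^sup>2) \<le> 5 * tailvar n"
proof -
  \<comment> \<open>With \<open>y = j + 1\<close>, the derivative of \<open>(2 + ln y) / y\<close>
    is \<open>- (1 + ln y) / y^2\<close>, so the differences of \<open>f\<close> dominate the
    summands and telescope.\<close>
  define f where "f j = (2 + ln (real j + 1)) / (real j + 1)" for j :: nat
  have step: "lnp j / (real j + 2)\<^sup>2 \<le> f j - f (Suc j)" for j
  proof -
    define y where "y = real j + 1"
    have y: "y \<ge> 1" by (simp add: y_def)
    have "y * (ln (y + 1) - ln y) \<le> y * (1 / y)"
      using y by (intro mult_left_mono ln_increment) auto
    then have *: "1 + ln y \<le> (2 + ln y) * (y + 1) - (2 + ln (y + 1)) * y"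
      using y by (simp add: algebra_simps)
    have "lnp j / (real j + 2)\<^sup>2 = (1 + ln y) / (y + 1)\<^sup>2"
      by (simp add: lnp_def y_def add.commute)
    also have "\<dots> \<le> (1 + ln y) / (y * (y + 1))"
      using y by (intro divide_left_mono) (auto simp: power2_eq_square)
    also have "\<dots> \<le> ((2 + ln y) * (y + 1) - (2 + ln (y + 1)) * y) / (y * (y + 1))"
      using y * by (intro divide_right_mono) auto
    also have "\<dots> = (2 + ln y) / y - (2 + ln (y + 1)) / (y + 1)"
      using y by (simp add: diff_frac_eq)
    finally show ?thesis by (simp add: f_def y_def add.commute)
  qed
  have "(\<Sum>j=n..<k. lnp j / (real j + 2)\<^sup>2) \<le> f n"
  proof (cases "n \<le> k")
    case True
    have "(\<Sum>j=n..<k. lnp j / (real j + 2)\<^sup>2) \<le> (\<Sum>j=n..<k. f j - f (Suc j))"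
      by (intro sum_mono step)
    also have "\<dots> = f n - f k" using sum_Suc_diff'[OF True, of "\<lambda>j. - f j"] by simp
    also have "\<dots> \<le> f n" by (simp add: f_def)
    finally show ?thesis .
  qed (simp add: f_def)
  \<comment> \<open>Since \<open>ln (n + 1)\<close> is at least \<open>1/2\<close>, the summand
    \<open>2\<close> is at most \<open>4 * ln (n + 1)\<close>; hence the factor
    \<open>5\<close>.\<close>
  also have "f n \<le> 5 * tailvar n"
    unfolding f_def tailvar_def times_divide_eq_right
    using half_le_ln[OF assms] by (intro divide_right_mono) auto
  finally show ?thesis .
qed

lemma sum_inverse_squares_le: "(\<Sum>j=n..<k. 1 / (real j + 1)\<^sup>2) \<le> 2 / (real n + 1)"
proof (cases "n \<le> k")
  case True
  define f where "f j = 2 / (real j + 1)" for j :: nat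
  have step: "1 / (real j + 1)\<^sup>2 \<le> f j - f (Suc j)" for j
  proof -
    define y where "y = real j + 1"
    have y: "y \<ge> 1" by (simp add: y_def)
    have "1 / y\<^sup>2 = 2 / (y * (y + y))" by (simp add: power2_eq_square)
    also have "\<dots> \<le> 2 / (y * (y + 1))" using y by (intro divide_left_mono mult_left_mono) auto
    also have "\<dots> = 2 / y - 2 / (y + 1)" using y by (simp add: diff_frac_eq)
    finally show ?thesis by (simp add: f_def y_def add.commute)
  qed
  have "(\<Sum>j=n..<k. 1 / (real j + 1)\<^sup>2) \<le> (\<Sum>j=n..<k. f j - f (Suc j))"
    by (intro sum_mono step)
  also have "\<dots> = f n - f k" using sum_Suc_diff'[OF True, of "\<lambda>j. - f j"] by simp
  also have "\<dots> \<le> f n" by (simp add: f_def)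
  finally show ?thesis by (simp add: f_def)
qed simp

lemma growth_le: "growth k \<le> real k + 1"
  using powr_mono[of "1/4" 1 "real k + 1"] by (simp add: growth_def)

text \<open>A crude form of Young's inequality: replace the smaller of the two numbers by the
  larger.\<close>

lemma power_mult_le_add:
  fixes x y :: real
  assumes "0 \<le> x" "0 \<le> y"
  shows "x ^ p * y \<le> x ^ Suc p + y ^ Suc p"
proof (cases "y \<le> x")
  case True
  then have "x ^ p * y \<le> x ^ p * x" using assms by (intro mult_left_mono) auto
  then show ?thesis using assms by (simp add: mult.commute add_increasing2)
next
  case False
  then have "x ^ p * y \<le> y ^ p * y" using assms by (intro mult_right_mono power_mono) auto
  then show ?thesis using assms by (simp add: mult.commute add_increasing)
qed

section \<open>Even moments of the martingale tails\<close>

context depth_urn begin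

definition incr :: "nat list \<Rightarrow> nat \<Rightarrow> real" where
  "incr l h = c * (real h - A l) / W (Suc (length l))"

text \<open>\<open>R n l\<close> is the increment of the martingale between the times \<open>n\<close> and \<open>length l\<close>.\<close>

primrec R :: "nat \<Rightarrow> nat list \<Rightarrow> real" where
  "R n [] = 0"
| "R n (h # l) = (if length l < n then 0 else R n l + incr l h)"

lemma R_short: "length l \<le> n \<Longrightarrow> R n l = 0"
  by (cases l) auto

lemma EK_incr: "nonneg_mass l \<Longrightarrow> EK l (incr l) = 0"
proof -
  assume l: "nonneg_mass l"
  have "EK l (incr l) = EK l (\<lambda>h. (c / W (Suc (length l))) * (real h - A l))"
    by (intro Bochner_Integration.integral_cong) (simp_all add: incr_def)
  then show ?thesis unfolding EK_mult[OF l] EK_centered[OF l] by simp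
qed

lemma EK_incr_square:
  assumes l: "nonneg_mass l"
  shows "EK l (\<lambda>h. (incr l h)\<^sup>2) = c\<^sup>2 * V l / (W (Suc (length l)))\<^sup>2"
proof -
  have "EK l (\<lambda>h. (incr l h)\<^sup>2) = EK l (\<lambda>h. (c\<^sup>2 / (W (Suc (length l)))\<^sup>2) * (real h - A l)\<^sup>2)"
    by (intro Bochner_Integration.integral_cong) (simp_all add: incr_def power_divide power_mult_distrib)
  then show ?thesis unfolding EK_mult[OF l] EK_square[OF l] by simp
qed

lemma incr_le:
  assumes l: "nonneg_mass l" and k: "length l = k"
  shows "\<bar>incr l h\<bar> \<le> c * Q l h / (real k + 2)"
proof -
  have "\<bar>incr l h\<bar> = c * \<bar>real h - A l\<bar> * (1 / W (Suc k))"
    using c_pos W_pos[of "Suc k"] by (simp add: incr_def k abs_mult)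
  also have "\<dots> \<le> c * Q l h * (1 / (real k + 2))"
    using c_pos Q_bounds[OF l, of h] W_pos[of "Suc k"]
    by (intro mult_mono mult_left_mono inverse_W_le mult_nonneg_nonneg) auto
  finally show ?thesis by simp
qed

lemma incr_square_le:
  assumes l: "nonneg_mass l" and k: "length l = k"
  shows "(incr l h)\<^sup>2 \<le> c\<^sup>2 * Q l h / (real k + 2)\<^sup>2"
proof -
  have "(incr l h)\<^sup>2 = c\<^sup>2 * (real h - A l)\<^sup>2 * (1 / (W (Suc k))\<^sup>2)"
    by (simp add: incr_def k power_divide power_mult_distrib)
  also have "\<dots> \<le> c\<^sup>2 * Q l h * (1 / (real k + 2)\<^sup>2)"
    using Q_bounds[OF l, of h]
    by (intro mult_mono mult_left_mono inverse_W_le mult_nonneg_nonneg) auto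
  finally show ?thesis by simp
qed

text \<open>In the expansion of the even power the linear term vanishes by the martingale property,
  the quadratic one produces \<open>V\<close>, and the rest goes into \<open>Q\<close>. The mixed
  product of \<open>R\<close> and \<open>V\<close> has to be separated, because only their
  individual moments are controlled.\<close>

lemma EK_R_power:
  assumes l: "nonneg_mass l" and k: "length l = k" "n \<le> k" "1 \<le> n" and p: "p \<ge> 1"
  defines "K \<equiv> 2 ^ (2 * p) * c ^ (2 * p)"
  shows "EK l (\<lambda>h. R n (h # l) ^ (2 * p)) \<le> R n l ^ (2 * p) * (1 + K * (lnp k / (real k + 2)\<^sup>2) / tailvar n)
    + K * (lnp k / (real k + 2)\<^sup>2) * tailvar n ^ (p - 1) * (V l ^ p / lnp k ^ p)
    + K * EK l (\<lambda>h. Q l h ^ p) / (real k + 2) ^ (2 * p)"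
proof -
  define q where "q = 2 * p"
  define \<sigma> where "\<sigma> = tailvar n"
  define L where "L = lnp k"
  have pos: "\<sigma> > 0" "L > 0" using tailvar_pos k lnp_ge_1[of k] by (auto simp: \<sigma>_def L_def)
  have V: "V l \<ge> 0" by (rule V_nonneg[OF l])
  have K: "K \<ge> 0" using c_pos by (simp add: K_def)
  have c: "1 \<le> c" "c ^ 2 \<le> c ^ q" using c_ge_1 p by (auto simp: q_def intro!: power_increasing)
  have "R n (h # l) ^ q \<le> (real q * R n l ^ (q - 1)) * incr l h
      + (2 ^ q) * (R n l ^ (q - 2) * (incr l h)\<^sup>2 + c ^ q / (real k + 2) ^ q * Q l h ^ p) + R n l ^ q" for h
  proof -
    have "R n (h # l) ^ q = (R n l + incr l h) ^ q" using k by simp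
    also have "\<dots> \<le> R n l ^ q + real q * R n l ^ (q - 1) * incr l h
        + 2 ^ q * (\<bar>R n l\<bar> ^ (q - 2) * (incr l h)\<^sup>2 + \<bar>incr l h\<bar> ^ q)"
      using power_add_remainder[of "R n l" "incr l h" q] by linarith
    also have "\<bar>R n l\<bar> ^ (q - 2) = R n l ^ (q - 2)"
      by (rule power_even_abs) (simp add: q_def)
    also have "\<bar>incr l h\<bar> ^ q = ((incr l h)\<^sup>2) ^ p" by (simp add: q_def power_mult)
    also have "((incr l h)\<^sup>2) ^ p \<le> (c\<^sup>2 * Q l h / (real k + 2)\<^sup>2) ^ p"
      using incr_square_le[OF l k(1)] by (intro power_mono) auto
    also have "(c\<^sup>2 * Q l h / (real k + 2)\<^sup>2) ^ p = c ^ q / (real k + 2) ^ q * Q l h ^ p"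
      by (simp add: q_def power_divide power_mult_distrib power_mult)
    finally show ?thesis by (simp add: algebra_simps)
  qed
  then have "EK l (\<lambda>h. R n (h # l) ^ q) \<le> EK l (\<lambda>h. (real q * R n l ^ (q - 1)) * incr l h
      + (2 ^ q) * (R n l ^ (q - 2) * (incr l h)\<^sup>2 + c ^ q / (real k + 2) ^ q * Q l h ^ p + 0) + R n l ^ q)"
    by (intro EK_mono[OF l]) simp
  also have "\<dots> = R n l ^ q + 2 ^ q * (R n l ^ (q - 2) * (c\<^sup>2 * V l * (1 / (W (Suc k))\<^sup>2)) + c ^ q / (real k + 2) ^ q * EK l (\<lambda>h. Q l h ^ p))"
    unfolding EK_affine[OF l] EK_incr[OF l] EK_incr_square[OF l] k by simp
  also have "\<dots> \<le> R n l ^ q + 2 ^ q * (R n l ^ (q - 2) * (c ^ q * V l * (1 / (real k + 2)\<^sup>2)) + c ^ q / (real k + 2) ^ q * EK l (\<lambda>h. Q l h ^ p))"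
  proof (intro add_left_mono mult_left_mono add_right_mono mult_mono inverse_W_le c(2))
    show "0 \<le> R n l ^ (q - 2)" by (rule zero_le_even_power) (simp add: q_def)
  qed (use V c in auto)
  also have "\<dots> = R n l ^ q + K * ((R n l)\<^sup>2 ^ (p - 1) * V l) / (real k + 2)\<^sup>2 + K * EK l (\<lambda>h. Q l h ^ p) / (real k + 2) ^ q"
  proof -
    have "q - 2 = 2 * (p - 1)" using p by (simp add: q_def)
    then have "R n l ^ (q - 2) = (R n l)\<^sup>2 ^ (p - 1)" by (simp only: power_mult)
    then show ?thesis unfolding K_def q_def[symmetric] by (simp add: distrib_left mult_ac)
  qed
  also have "(R n l)\<^sup>2 ^ (p - 1) * V l \<le> (L / \<sigma>) * (R n l ^ q + \<sigma> ^ p * (V l ^ p / L ^ p))"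
  proof -
    \<comment> \<open>Young's inequality is applied after scaling \<open>V l\<close> by \<sigma> /
      \<open>L\<close>. The scaled variable has size \<sigma>, the expected size of the square of
      \<open>R\<close>, so neither summand is out of proportion.\<close>
    have "(R n l)\<^sup>2 ^ (p - 1) * (\<sigma> * V l / L) \<le> (R n l)\<^sup>2 ^ p + (\<sigma> * V l / L) ^ p"
      using power_mult_le_add[of "(R n l)\<^sup>2" "\<sigma> * V l / L" "p - 1"] pos V p by simp
    then have "(L / \<sigma>) * ((R n l)\<^sup>2 ^ (p - 1) * (\<sigma> * V l / L)) \<le> (L / \<sigma>) * ((R n l)\<^sup>2 ^ p + (\<sigma> * V l / L) ^ p)"
      using pos by (intro mult_left_mono) auto
    then show ?thesis using pos by (simp add: q_def power_mult power_divide power_mult_distrib)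
  qed
  also have "(L / \<sigma>) * (R n l ^ q + \<sigma> ^ p * (V l ^ p / L ^ p)) = L * (R n l ^ q / \<sigma>) + L * \<sigma> ^ (p - 1) * (V l ^ p / L ^ p)"
    using pos p by (cases p) (simp_all add: distrib_left field_simps)
  finally have "EK l (\<lambda>h. R n (h # l) ^ q) \<le> R n l ^ q
      + K * (L * (R n l ^ q / \<sigma>) + L * \<sigma> ^ (p - 1) * (V l ^ p / L ^ p)) / (real k + 2)\<^sup>2
      + K * EK l (\<lambda>h. Q l h ^ p) / (real k + 2) ^ q"
    using K by (simp add: divide_right_mono mult_left_mono del: R.simps)
  then show ?thesis
    unfolding q_def[symmetric] \<sigma>_def[symmetric] L_def[symmetric]
    by (simp add: algebra_simps add_divide_distrib del: R.simps)
qed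

text \<open>A discrete Gronwall argument: the relative growth rates over all steps after
  \<open>n\<close> sum to a constant independent of \<open>n\<close>. The bound is uniform in
  \<open>k\<close>, as needed for passing to the limit.\<close>

lemma R_moments:
  assumes p: "p \<ge> 2"
  shows "\<exists>C\<ge>0. \<forall>n\<ge>1. \<forall>k. EU k (\<lambda>l. R n l ^ (2 * p)) \<le> C * tailvar n ^ p"
proof -
  obtain CV where CV: "CV \<ge> 0" "\<And>k. EU k (\<lambda>l. V l ^ p) \<le> CV * lnp k ^ p"
    using V_moments[of p] by auto
  obtain CQ where CQ: "CQ \<ge> 0" "\<And>k. EU k (\<lambda>l. EK l (\<lambda>h. Q l h ^ p)) \<le> CQ * growth k"
    using Q_moments[of p] by auto
  define K where "K = 2 ^ (2 * p) * c ^ (2 * p)"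
  \<comment> \<open>The three summands account for the terms in \<open>R\<close>, in
    \<open>V\<close> and in \<open>Q\<close>.\<close>
  define D where "D = K * (1 + CV + CQ * 2 ^ (p - 1))"
  have K: "K \<ge> 0" using c_pos by (simp add: K_def)
  have "EU k (\<lambda>l. R n l ^ (2 * p)) \<le> exp (5 * D) * tailvar n ^ p" if n: "1 \<le> n" for n k
  proof -
    define \<theta> where "\<theta> k = lnp k / (real k + 2)\<^sup>2" for k
    define \<sigma> where "\<sigma> = tailvar n"
    define u where "u k = EU k (\<lambda>l. R n l ^ (2 * p))" for k
    have \<sigma>: "\<sigma> > 0" using tailvar_pos[OF n] by (simp add: \<sigma>_def)
    have \<theta>: "\<theta> k \<ge> 0" for k using lnp_ge_1[of k] by (simp add: \<theta>_def)
    have D: "D \<ge> 0" using K CV CQ by (simp add: D_def)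
    have u0: "u k \<ge> 0" for k
      unfolding u_def by (intro Bochner_Integration.integral_nonneg) (auto simp: power_mult)
    \<comment> \<open>Adding \<sigma>\<open>^ p\<close> to the moment absorbs the source terms and
      makes the recursion purely multiplicative.\<close>
    have rec: "u (Suc k) + \<sigma> ^ p \<le> (1 + D * \<theta> k / \<sigma>) * (u k + \<sigma> ^ p)" if k: "n \<le> k" for k
    proof -
      \<comment> \<open>Estimating \<open>growth\<close> by one full power of \<open>y\<close>
        leaves \<open>2 * p - 1\<close> powers in the denominator, at least \<open>p + 1\<close>
        because \<open>p\<close> is at least \<open>2\<close>. Two of them go into \<theta>, the
        other \<open>p - 1\<close> are compared with \<sigma> at the price of a factor
        \<open>2\<close> each.\<close>
      have small: "growth k / (real k + 2) ^ (2 * p) \<le> 2 ^ (p - 1) * (\<theta> k * \<sigma> ^ (p - 1))"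
      proof -
        define y where "y = real k + 2"
        have y: "y \<ge> 2" by (simp add: y_def)
        have "growth k / y ^ (2 * p) \<le> y / y ^ (2 * p)"
          using growth_le[of k] y by (intro divide_right_mono) (auto simp: y_def)
        also have "\<dots> = 1 / y ^ (2 * p - 1)"
          using y p by (cases "2 * p") (auto simp: field_simps)
        also have "\<dots> \<le> 1 / y ^ (p + 1)"
          using y p by (intro divide_left_mono power_increasing mult_pos_pos) auto
        also have "\<dots> = 2 ^ (p - 1) * ((1 / y\<^sup>2) * (1 / (2 * y)) ^ (p - 1))"
        proof -
          have "p + 1 = 2 + (p - 1)" using p by simp
          then have "y ^ (p + 1) = y\<^sup>2 * y ^ (p - 1)" by (simp only: power_add)
          then show ?thesis by (simp add: power_divide power_mult_distrib)
        qed
        also have "\<dots> \<le> 2 ^ (p - 1) * (\<theta> k * \<sigma> ^ (p - 1))"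
        proof (intro mult_left_mono mult_mono power_mono)
          show "1 / y\<^sup>2 \<le> \<theta> k" unfolding \<theta>_def y_def using lnp_ge_1[of k] by (intro divide_right_mono) auto
          show "1 / (2 * y) \<le> \<sigma>" unfolding \<sigma>_def y_def by (rule tailvar_ge[OF n k])
        qed (use y \<theta> in auto)
        finally show ?thesis by (simp add: y_def)
      qed
      have L: "lnp k > 0" using lnp_ge_1[of k] by simp
      have "u (Suc k) \<le> EU k (\<lambda>l. R n l ^ (2 * p) * (1 + K * \<theta> k / \<sigma>)
          + ((K * \<theta> k * \<sigma> ^ (p - 1) / lnp k ^ p) * V l ^ p + (K / (real k + 2) ^ (2 * p)) * EK l (\<lambda>h. Q l h ^ p)))"
        unfolding u_def EU_Suc
      proof (rule EU_mono)
        fix l :: "nat list" assume l: "length l = k" "nonneg_mass l"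
        show "EK l (\<lambda>h. R n (h # l) ^ (2 * p)) \<le> R n l ^ (2 * p) * (1 + K * \<theta> k / \<sigma>)
          + ((K * \<theta> k * \<sigma> ^ (p - 1) / lnp k ^ p) * V l ^ p + (K / (real k + 2) ^ (2 * p)) * EK l (\<lambda>h. Q l h ^ p))"
          using EK_R_power[OF l(2,1) k n, of p] p by (simp add: K_def \<theta>_def \<sigma>_def add.assoc)
      qed
      also have "\<dots> = u k * (1 + K * \<theta> k / \<sigma>) + (K * \<theta> k * \<sigma> ^ (p - 1) / lnp k ^ p) * EU k (\<lambda>l. V l ^ p)
          + (K / (real k + 2) ^ (2 * p)) * EU k (\<lambda>l. EK l (\<lambda>h. Q l h ^ p))"
        unfolding EU_add u_def by simp
      also have "\<dots> \<le> u k * (1 + K * \<theta> k / \<sigma>) + (K * \<theta> k * \<sigma> ^ (p - 1) / lnp k ^ p) * (CV * lnp k ^ p)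
          + (K / (real k + 2) ^ (2 * p)) * (CQ * growth k)"
        using K \<theta>[of k] \<sigma> L by (intro add_mono mult_left_mono CV CQ order_refl) auto
      also have "\<dots> = u k * (1 + K * \<theta> k / \<sigma>) + K * CV * (\<theta> k * \<sigma> ^ (p - 1))
          + K * CQ * (growth k / (real k + 2) ^ (2 * p))"
        using L by simp
      also have "\<dots> \<le> u k * (1 + K * \<theta> k / \<sigma>) + K * CV * (\<theta> k * \<sigma> ^ (p - 1))
          + K * CQ * (2 ^ (p - 1) * (\<theta> k * \<sigma> ^ (p - 1)))"
        using K CQ small by (intro add_left_mono mult_left_mono) auto
      also have "\<theta> k * \<sigma> ^ (p - 1) = (\<theta> k / \<sigma>) * \<sigma> ^ p"
        using \<sigma> p by (cases p) auto
      finally have 1: "u (Suc k) \<le> u k * (1 + K * (\<theta> k / \<sigma>)) + (D - K) * ((\<theta> k / \<sigma>) * \<sigma> ^ p)"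
        by (simp add: D_def algebra_simps)
      have 2: "K * (\<theta> k / \<sigma>) * u k \<le> D * (\<theta> k / \<sigma>) * u k"
        using K CV CQ \<theta>[of k] \<sigma> u0[of k] by (intro mult_right_mono) (auto simp: D_def algebra_simps)
      have 3: "(D - K) * ((\<theta> k / \<sigma>) * \<sigma> ^ p) \<le> D * ((\<theta> k / \<sigma>) * \<sigma> ^ p)"
        using K \<theta>[of k] \<sigma> by (intro mult_right_mono) auto
      have "(1 + D * \<theta> k / \<sigma>) * (u k + \<sigma> ^ p) = u k + D * (\<theta> k / \<sigma>) * u k + D * ((\<theta> k / \<sigma>) * \<sigma> ^ p) + \<sigma> ^ p"
        by (simp add: algebra_simps add_divide_distrib)
      moreover have "u k * (1 + K * (\<theta> k / \<sigma>)) = u k + K * (\<theta> k / \<sigma>) * u k"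
        by (simp add: algebra_simps)
      ultimately show ?thesis using 1 2 3 by linarith
    qed
    have claim: "u k + \<sigma> ^ p \<le> exp (\<Sum>j=n..<k. D * \<theta> j / \<sigma>) * \<sigma> ^ p" if k: "n \<le> k" for k
      using k
    proof (induction k rule: dec_induct)
      case base
      have "u n = EU n (\<lambda>_. 0)" unfolding u_def using p by (intro EU_cong) (simp add: R_short)
      then show ?case by simp
    next
      case (step k)
      have "u (Suc k) + \<sigma> ^ p \<le> (1 + D * \<theta> k / \<sigma>) * (u k + \<sigma> ^ p)" using step.hyps by (intro rec)
      also have "\<dots> \<le> exp (D * \<theta> k / \<sigma>) * (exp (\<Sum>j=n..<k. D * \<theta> j / \<sigma>) * \<sigma> ^ p)"
        using D \<theta>[of k] \<sigma> u0[of k] by (intro mult_mono step.IH exp_ge_add_one_self) auto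
      also have "\<dots> = exp (\<Sum>j=n..<Suc k. D * \<theta> j / \<sigma>) * \<sigma> ^ p"
        using step.hyps by (simp add: exp_add mult.commute)
      finally show ?case .
    qed
    have "u k \<le> exp (5 * D) * \<sigma> ^ p"
    proof (cases "n \<le> k")
      case True
      have "(\<Sum>j=n..<k. D * \<theta> j / \<sigma>) = D / \<sigma> * (\<Sum>j=n..<k. \<theta> j)" by (simp add: sum_distrib_left)
      also have "\<dots> \<le> D / \<sigma> * (5 * \<sigma>)"
        unfolding \<theta>_def \<sigma>_def using D tailvar_pos[OF n] by (intro mult_left_mono sum_lnp_le n) auto
      finally have "(\<Sum>j=n..<k. D * \<theta> j / \<sigma>) \<le> 5 * D" using \<sigma> by simp
      then have "exp (\<Sum>j=n..<k. D * \<theta> j / \<sigma>) * \<sigma> ^ p \<le> exp (5 * D) * \<sigma> ^ p"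
        using \<sigma> by (intro mult_right_mono) auto
      moreover have "\<sigma> ^ p \<ge> 0" using \<sigma> by simp
      ultimately show ?thesis using claim[OF True] by linarith
    next
      case False
      have "u k = EU k (\<lambda>_. 0)" unfolding u_def using p False by (intro EU_cong) (simp add: R_short)
      then show ?thesis using \<sigma> by simp
    qed
    then show ?thesis by (simp add: u_def \<sigma>_def)
  qed
  then show ?thesis by (intro exI[of _ "exp (5 * D)"]) auto
qed

end

section \<open>Characteristic functions of the martingale tails\<close>

lemma exp_minus_approx:
  fixes z :: real
  assumes "z \<ge> 0"
  shows "\<bar>1 - z - exp (- z)\<bar> \<le> z\<^sup>2"
proof -
  have "1 - z \<le> exp (- z)" using exp_ge_add_one_self[of "- z"] by simp
  moreover have "exp (- z) \<le> 1 / (1 + z)"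
    using exp_ge_add_one_self[of z] assms by (simp add: exp_minus inverse_eq_divide frac_le)
  moreover have "1 / (1 + z) \<le> 1 - z + z\<^sup>2"
  proof -
    have "(1 - z + z\<^sup>2) * (1 + z) = 1 + z ^ 3" by (simp add: power2_eq_square power3_eq_cube algebra_simps)
    then have "1 \<le> (1 - z + z\<^sup>2) * (1 + z)" using assms by simp
    then show ?thesis using assms by (simp add: divide_le_eq)
  qed
  ultimately show ?thesis by simp
qed

text \<open>A factor of order \<open>-3/4\<close> is frozen at its value for \<open>n\<close>, and
  an inverse square is left for the summation over the tail.\<close>

lemma growth_cube_le:
  assumes "n \<le> j"
  shows "growth j / (real j + 2) ^ 3 \<le> (real n + 1) powr (-3/4) * (1 / (real j + 1)\<^sup>2)"
proof -
  define y where "y = real j + 1"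
  have y: "y > 0" by (simp add: y_def)
  have "growth j / (real j + 2) ^ 3 \<le> growth j / y ^ 3"
    using growth_ge_1[of j] unfolding y_def by (intro divide_left_mono power_mono) auto
  also have "\<dots> = y powr (1/4) / (y * y\<^sup>2)"
    by (simp add: growth_def y_def power3_eq_cube power2_eq_square)
  also have "\<dots> = (y powr (1/4) / y) * (1 / y\<^sup>2)" by simp
  also have "y powr (1/4) / y = y powr (1/4 - 1)"
    using y powr_diff[of y "1/4" 1] by simp
  also have "y powr (1/4 - 1) * (1 / y\<^sup>2) \<le> (real n + 1) powr (1/4 - 1) * (1 / y\<^sup>2)"
    using assms by (intro mult_right_mono powr_mono2') (auto simp: y_def)
  finally show ?thesis by (simp add: y_def)
qed

section \<open>Deterministic step variances and Gaussian replacement\<close>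

context depth_urn begin

text \<open>Besides being the constant in the limiting variance, this is the shift in the weights:
  \<open>W k / c\<close> equals \<open>k +\<close> \<kappa>, which is the denominator of
  \<open>S_n\<close> at \<open>n = k + 1\<close>.\<close>

definition \<kappa> :: real where
  "\<kappa> = a / c"

lemma kappa_bounds: "0 < \<kappa>" "\<kappa> \<le> 2"
  using a_pos c_pos a_le c_ge_1 by (auto simp: \<kappa>_def divide_le_eq)

lemma W_kappa: "W k = c * (real k + \<kappa>)"
  using c_pos by (simp add: W_def \<kappa>_def field_simps)

lemma alpha_Suc: "alpha (Suc k) = alpha k + \<kappa> / (real k + 1 + \<kappa>)"
proof -
  have "a / W (Suc k) = (c * \<kappa>) / (c * (real (Suc k) + \<kappa>))"
    using c_pos by (simp add: W_kappa \<kappa>_def)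
  also have "\<dots> = \<kappa> / (real k + 1 + \<kappa>)" using c_pos by (simp add: add_ac)
  finally show ?thesis by (simp add: alpha_def)
qed

text \<open>The bounds are sharpened by explicit corrections so that the induction closes. With
  \<open>y = k + 1\<close>, they are the partial sums of \<open>1 / y - 1 / (y + 2)\<close> and of
  \<open>1 / y - 1 / (y + 1)\<close>. These bound the errors of one step because \<kappa> lies
  between \<open>0\<close> and \<open>2\<close>.\<close>

lemma alpha_ln:
  "- (\<kappa> * (3 / 2 - 1 / (real k + 1) - 1 / (real k + 2))) \<le> alpha k - \<kappa> * ln (real k + 1)"
  "alpha k - \<kappa> * ln (real k + 1) \<le> \<kappa> * (1 - 1 / (real k + 1))"
proof (induction k)
  case 0
  {
    case 1
    then show ?case by (simp add: alpha_def)
  next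
    case 2
    then show ?case by (simp add: alpha_def)
  }
next
  case (Suc k)
  define y where "y = real k + 1"
  have y: "y > 0" by (simp add: y_def)
  have eq: "alpha (Suc k) - \<kappa> * ln (real (Suc k) + 1)
      = (alpha k - \<kappa> * ln (real k + 1)) + (\<kappa> / (y + \<kappa>) - \<kappa> * (ln (y + 1) - ln y))"
    by (simp add: alpha_Suc y_def algebra_simps)
  {
    case 1
    have "1 / (y + 2) \<le> 1 / (y + \<kappa>)" using y kappa_bounds by (intro divide_left_mono) auto
    moreover have "ln (y + 1) - ln y \<le> 1 / y" by (rule ln_increment[OF y])
    ultimately have "\<kappa> * (1 / (y + 2) - 1 / y) \<le> \<kappa> * (1 / (y + \<kappa>) - (ln (y + 1) - ln y))"
      using kappa_bounds by (intro mult_left_mono) auto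
    then have "\<kappa> * (1 / (y + 2) - 1 / y) \<le> \<kappa> / (y + \<kappa>) - \<kappa> * (ln (y + 1) - ln y)"
      by (simp add: right_diff_distrib)
    moreover have "- (\<kappa> * (3 / 2 - 1 / y - 1 / (y + 1))) \<le> alpha k - \<kappa> * ln (real k + 1)"
      using Suc(1) by (simp add: y_def add.assoc)
    moreover have "- (\<kappa> * (3 / 2 - 1 / (y + 1) - 1 / (y + 2)))
        = - (\<kappa> * (3 / 2 - 1 / y - 1 / (y + 1))) + \<kappa> * (1 / (y + 2) - 1 / y)"
      by (simp add: right_diff_distrib)
    moreover have "real (Suc k) + 1 = y + 1" "real (Suc k) + 2 = y + 2"
      by (auto simp: y_def)
    ultimately show ?case unfolding eq by simp
  next
    case 2
    have "1 / (y + \<kappa>) \<le> 1 / y" using y kappa_bounds by (intro divide_left_mono) auto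
    moreover have "1 / (y + 1) \<le> ln (y + 1) - ln y" by (rule ln_increment[OF y])
    ultimately have "\<kappa> * (1 / (y + \<kappa>) - (ln (y + 1) - ln y)) \<le> \<kappa> * (1 / y - 1 / (y + 1))"
      using kappa_bounds by (intro mult_left_mono) auto
    then have "\<kappa> / (y + \<kappa>) - \<kappa> * (ln (y + 1) - ln y) \<le> \<kappa> * (1 / y - 1 / (y + 1))"
      by (simp add: right_diff_distrib)
    moreover have "real (Suc k) + 1 = y + 1" "real k + 1 = y"
      by (auto simp: y_def)
    ultimately show ?case using Suc(2) unfolding eq by (simp add: algebra_simps)
  }
qed

lemma alpha_ln_le: "\<bar>alpha k - \<kappa> * ln (real k + 1)\<bar> \<le> 3"
proof -
  have "\<kappa> * (1 - 1 / (real k + 1)) \<le> 2 * 1" using kappa_bounds by (intro mult_mono) auto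
  moreover have "\<kappa> * (3 / 2 - 1 / (real k + 1) - 1 / (real k + 2)) \<le> \<kappa> * (3 / 2)"
  proof (rule mult_left_mono)
    have "0 \<le> 1 / (real k + 1)" "0 \<le> 1 / (real k + 2)" by simp_all
    then show "3 / 2 - 1 / (real k + 1) - 1 / (real k + 2) \<le> 3 / 2" by linarith
  qed (use kappa_bounds in simp)
  ultimately show ?thesis using alpha_ln[of k] kappa_bounds(2) by linarith
qed

text \<open>The step variances are chosen to telescope, so that their tail sums are exactly \<open>\<kappa> * tailvar n\<close>.\<close>

definition stepvar :: "nat \<Rightarrow> real" where
  "stepvar j = \<kappa> * (tailvar j - tailvar (Suc j))"

lemma stepvar_eq:
  defines "y \<equiv> \<lambda>j. real j + 1"
  shows "stepvar j = \<kappa> * ((ln (y j) - y j * (ln (y j + 1) - ln (y j))) / (y j * (y j + 1)))"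
proof -
  have y: "y j > 0" by (simp add: y_def)
  have "tailvar j - tailvar (Suc j) = ln (y j) / y j - ln (y j + 1) / (y j + 1)"
    by (simp add: tailvar_def y_def add.commute)
  also have "\<dots> = (ln (y j) - y j * (ln (y j + 1) - ln (y j))) / (y j * (y j + 1))"
    using y by (simp add: diff_frac_eq algebra_simps)
  finally show ?thesis by (simp add: stepvar_def)
qed

text \<open>The error is smaller than the step variance itself by a logarithm. Its tail sums are
  therefore \<open>O(1 / n)\<close>, negligible against \<open>tailvar n\<close>.\<close>

lemma stepvar_compare: "\<bar>c\<^sup>2 * alpha j / (W (Suc j))\<^sup>2 - stepvar j\<bar> \<le> 23 * (1 / (real j + 1)\<^sup>2)"
proof -
  define y where "y = real j + 1"
  have y: "y \<ge> 1" by (simp add: y_def)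
  have k: "0 < \<kappa>" "\<kappa> \<le> 2" by (fact kappa_bounds)+
  have ln: "0 \<le> ln y" "ln y \<le> y" using y ln_le_minus_one[of y] by auto
  have 1: "c\<^sup>2 * alpha j / (W (Suc j))\<^sup>2 = alpha j / (y + \<kappa>)\<^sup>2"
    using c_pos by (simp add: W_kappa y_def power_mult_distrib add.commute)
  have yy: "y\<^sup>2 \<le> (y + \<kappa>)\<^sup>2" using y k by (intro power_mono) auto
  have yy': "y\<^sup>2 \<le> y * (y + 1)" "y\<^sup>2 > 0"
    using y by (auto simp: power2_eq_square)
  \<comment> \<open>Three replacements: \<open>alpha\<close> by its logarithm, the squared weight by
    \<open>y * (y + 1)\<close>, and the logarithmic increment by zero. They cost \<open>3\<close>,
    \<open>18\<close> and \<open>2\<close> over \<open>y^2\<close>, in total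
    \<open>23\<close>.\<close>
  define d1 where "d1 = (alpha j - \<kappa> * ln y) / (y + \<kappa>)\<^sup>2"
  define d2 where "d2 = \<kappa> * ln y * (1 / (y + \<kappa>)\<^sup>2 - 1 / (y * (y + 1)))"
  define d3 where "d3 = \<kappa> * (y * (ln (y + 1) - ln y)) / (y * (y + 1))"
  have eq: "alpha j / (y + \<kappa>)\<^sup>2 - stepvar j = d1 + d2 + d3"
    unfolding stepvar_eq y_def[symmetric] d1_def d2_def d3_def
    by (simp add: diff_divide_distrib add_divide_distrib right_diff_distrib)
  have "\<bar>d1\<bar> \<le> 3 / y\<^sup>2"
    unfolding d1_def abs_divide using alpha_ln_le[of j] yy yy'
    by (intro frac_le) (auto simp: y_def)
  moreover have "\<bar>d2\<bar> \<le> 18 / y\<^sup>2"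
  proof -
    have "1 / (y + \<kappa>)\<^sup>2 - 1 / (y * (y + 1)) = (y * (y + 1) - (y + \<kappa>)\<^sup>2) / ((y + \<kappa>)\<^sup>2 * (y * (y + 1)))"
      using y k by (simp add: diff_frac_eq)
    moreover have "\<bar>y * (y + 1) - (y + \<kappa>)\<^sup>2\<bar> \<le> 9 * y"
    proof -
      have "y * (y + 1) - (y + \<kappa>)\<^sup>2 = y - 2 * (\<kappa> * y) - \<kappa>\<^sup>2"
        by (simp add: power2_eq_square algebra_simps)
      moreover have "0 \<le> \<kappa> * y" "\<kappa> * y \<le> 2 * y" using k y by auto
      moreover have "\<kappa>\<^sup>2 \<le> 4" using k power_mono[of \<kappa> 2 2] by simp
      ultimately show ?thesis using y zero_le_power2[of \<kappa>] by linarith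
    qed
    moreover have "(y + \<kappa>)\<^sup>2 * (y * (y + 1)) > 0" using y k by simp
    ultimately have "\<bar>1 / (y + \<kappa>)\<^sup>2 - 1 / (y * (y + 1))\<bar>
        = \<bar>y * (y + 1) - (y + \<kappa>)\<^sup>2\<bar> / ((y + \<kappa>)\<^sup>2 * (y * (y + 1)))"
      by (simp only: abs_divide abs_of_pos)
    also have "\<dots> \<le> 9 * y / (y\<^sup>2 * y\<^sup>2)"
      using y \<open>\<bar>y * (y + 1) - (y + \<kappa>)\<^sup>2\<bar> \<le> 9 * y\<close>
      by (intro frac_le mult_mono yy yy' mult_pos_pos) auto
    finally have "\<bar>d2\<bar> \<le> (2 * y) * (9 * y / (y\<^sup>2 * y\<^sup>2))"
      unfolding d2_def abs_mult using k ln y by (intro mult_mono) auto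
    also have "\<dots> = 18 / y\<^sup>2" using y by (simp add: power2_eq_square)
    finally show ?thesis .
  qed
  moreover have "\<bar>d3\<bar> \<le> 2 / y\<^sup>2"
  proof -
    have "0 \<le> ln (y + 1) - ln y" "y * (ln (y + 1) - ln y) \<le> y * (1 / y)"
      using y by (auto intro!: mult_left_mono ln_increment simp del: times_divide_eq_right)
    then have "\<bar>\<kappa> * (y * (ln (y + 1) - ln y))\<bar> \<le> 2 * 1"
      unfolding abs_mult using k y by (intro mult_mono) auto
    then show ?thesis unfolding d3_def abs_divide using yy' y by (intro frac_le) auto
  qed
  ultimately have "\<bar>d1 + d2 + d3\<bar> \<le> 3 / y\<^sup>2 + 18 / y\<^sup>2 + 2 / y\<^sup>2" by linarith
  then show ?thesis unfolding 1 eq by (simp add: y_def)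
qed

lemma stepvar_bounds:
  assumes "j \<ge> 2"
  shows "0 \<le> stepvar j" "(stepvar j)\<^sup>2 \<le> 256 * (1 / (real j + 1) ^ 3)"
proof -
  define y where "y = real j + 1"
  have y: "y \<ge> 3" using assms by (simp add: y_def)
  \<comment> \<open>Here \<open>j >= 2\<close> enters: \<open>y >= 3\<close> exceeds
    \<open>e\<close>, so \<open>ln y\<close> is at least \<open>1\<close>, which outweighs
    \<open>y\<close> times the logarithmic increment. For smaller \<open>j\<close> the telescoping
    difference can be negative.\<close>
  have "ln (exp 1) \<le> ln y" using y exp_le by (intro ln_mono) auto
  then have ln: "1 \<le> ln y" by simp
  have inc: "0 \<le> ln (y + 1) - ln y" "y * (ln (y + 1) - ln y) \<le> y * (1 / y)"
    using y by (auto intro!: mult_left_mono ln_increment simp del: times_divide_eq_right)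
  moreover have "y * (1 / y) = 1" using y by simp
  ultimately have inc': "y * (ln (y + 1) - ln y) \<le> 1" by linarith
  show nonneg: "0 \<le> stepvar j"
    unfolding stepvar_eq y_def[symmetric] using inc' ln y kappa_bounds by simp
  have "stepvar j \<le> 2 * (lnp j / y\<^sup>2)"
    unfolding stepvar_eq y_def[symmetric]
  proof (intro mult_mono frac_le)
    have "0 \<le> y * (ln (y + 1) - ln y)" using inc y by (intro mult_nonneg_nonneg) auto
    then show "ln y - y * (ln (y + 1) - ln y) \<le> lnp j"
      unfolding lnp_def y_def[symmetric] by linarith
  qed (use inc' ln y kappa_bounds lnp_ge_1[of j] in \<open>auto simp: power2_eq_square\<close>)
  then have "(stepvar j)\<^sup>2 \<le> (2 * (lnp j / y\<^sup>2))\<^sup>2" using nonneg by (rule power_mono)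
  also have "\<dots> = 4 * (lnp j)\<^sup>2 / y ^ 4"
    by (simp add: power_divide power_mult_distrib power_mult[symmetric])
  also have "\<dots> \<le> 4 * (64 * y) / y ^ 4"
    using lnp_squared_le[of j] growth_le[of j] y by (intro divide_right_mono) (auto simp: y_def)
  also have "\<dots> = 256 * (1 / y ^ 3)" using y by (simp add: power3_eq_cube power4_eq_xxxx)
  finally show "(stepvar j)\<^sup>2 \<le> 256 * (1 / (real j + 1) ^ 3)" by (simp add: y_def)
qed

text \<open>Taylor expansion to third order; the linear term vanishes since the increment is
  centred. The variance \<open>v\<close> of the Gaussian factor is a free parameter because the
  conditional variance is random while the replacement has to be deterministic.\<close>

lemma EK_iexp:
  fixes u v :: real
  assumes l: "nonneg_mass l" and v: "v \<ge> 0"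
  shows "cmod (EK l (\<lambda>h. iexp (u * incr l h)) - complex_of_real (exp (- (u\<^sup>2 * v / 2))))
    \<le> \<bar>u\<bar> ^ 3 * EK l (\<lambda>h. \<bar>incr l h\<bar> ^ 3) + (u\<^sup>2 * \<bar>EK l (\<lambda>h. (incr l h)\<^sup>2) - v\<bar> + u ^ 4 * v\<^sup>2)"
proof -
  define s2 where "s2 = EK l (\<lambda>h. (incr l h)\<^sup>2)"
  let ?p = "\<lambda>h. complex_of_real (1 - (u * incr l h)\<^sup>2 / 2) + \<i> * complex_of_real (u * incr l h)"
  have "EK l ?p = complex_of_real (EK l (\<lambda>h. 1 - (u * incr l h)\<^sup>2 / 2)) + \<i> * complex_of_real (EK l (\<lambda>h. u * incr l h))"
    by (simp add: integrable_kernel[OF l] del: of_real_diff of_real_mult)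
  also have "EK l (\<lambda>h. u * incr l h) = 0" unfolding EK_mult[OF l] EK_incr[OF l] by simp
  also have "EK l (\<lambda>h. 1 - (u * incr l h)\<^sup>2 / 2) = EK l (\<lambda>h. (- (u\<^sup>2 / 2)) * (incr l h)\<^sup>2 + 0 * (incr l h)\<^sup>2 + 1)"
    by (intro Bochner_Integration.integral_cong) (auto simp: power_mult_distrib)
  also have "\<dots> = 1 - u\<^sup>2 * s2 / 2" unfolding EK_affine[OF l] s2_def by simp
  finally have poly: "EK l ?p = complex_of_real (1 - u\<^sup>2 * s2 / 2)" by simp
  have "cmod (EK l (\<lambda>h. iexp (u * incr l h)) - EK l ?p) = cmod (EK l (\<lambda>h. iexp (u * incr l h) - ?p h))"
    by (simp add: integrable_kernel[OF l])
  also have "\<dots> \<le> EK l (\<lambda>h. cmod (iexp (u * incr l h) - ?p h))" by (rule integral_norm_bound)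
  also have "\<dots> \<le> EK l (\<lambda>h. \<bar>u\<bar> ^ 3 * \<bar>incr l h\<bar> ^ 3)"
  proof (rule EK_mono[OF l])
    fix h
    define x where "x = u * incr l h"
    have p: "?p h = complex_of_real (1 - x\<^sup>2 / 2) + \<i> * complex_of_real x" by (simp add: x_def)
    have "(\<Sum>k\<le>2. (\<i> * complex_of_real x) ^ k / fact k) = ?p h"
      unfolding p by (simp add: numeral_2_eq_2 atMost_Suc) (simp add: algebra_simps)
    moreover have "Suc 2 = 3" by simp
    ultimately have "cmod (iexp x - ?p h) \<le> \<bar>x\<bar> ^ 3 / fact 3"
      using iexp_approx1[of x 2] by (simp only:)
    also have "\<dots> \<le> \<bar>x\<bar> ^ 3 / 1" by (intro divide_left_mono) (auto simp: fact_numeral)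
    finally show "cmod (iexp (u * incr l h) - ?p h) \<le> \<bar>u\<bar> ^ 3 * \<bar>incr l h\<bar> ^ 3"
      by (simp add: x_def abs_mult power_mult_distrib)
  qed
  also have "\<dots> = \<bar>u\<bar> ^ 3 * EK l (\<lambda>h. \<bar>incr l h\<bar> ^ 3)" by simp
  finally have 1: "cmod (EK l (\<lambda>h. iexp (u * incr l h)) - complex_of_real (1 - u\<^sup>2 * s2 / 2))
      \<le> \<bar>u\<bar> ^ 3 * EK l (\<lambda>h. \<bar>incr l h\<bar> ^ 3)" unfolding poly .
  have "\<bar>(1 - u\<^sup>2 * s2 / 2) - exp (- (u\<^sup>2 * v / 2))\<bar> \<le> u\<^sup>2 * \<bar>s2 - v\<bar> + u ^ 4 * v\<^sup>2"
  proof -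
    have "\<bar>1 - u\<^sup>2 * v / 2 - exp (- (u\<^sup>2 * v / 2))\<bar> \<le> (u\<^sup>2 * v / 2)\<^sup>2"
      using v by (intro exp_minus_approx) auto
    moreover have "(u\<^sup>2 * v / 2)\<^sup>2 \<le> u ^ 4 * v\<^sup>2"
      by (simp add: power_divide power_mult_distrib power_mult[symmetric])
    moreover have "\<bar>u\<^sup>2 * s2 / 2 - u\<^sup>2 * v / 2\<bar> \<le> u\<^sup>2 * \<bar>s2 - v\<bar>"
    proof -
      have "u\<^sup>2 * s2 / 2 - u\<^sup>2 * v / 2 = (u\<^sup>2 / 2) * (s2 - v)" by (simp add: algebra_simps diff_divide_distrib)
      then have "\<bar>u\<^sup>2 * s2 / 2 - u\<^sup>2 * v / 2\<bar> = (u\<^sup>2 / 2) * \<bar>s2 - v\<bar>"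
        by (simp only: abs_mult) simp
      also have "\<dots> \<le> u\<^sup>2 * \<bar>s2 - v\<bar>" by (intro mult_right_mono) auto
      finally show ?thesis .
    qed
    ultimately show ?thesis by linarith
  qed
  then have 2: "cmod (complex_of_real (1 - u\<^sup>2 * s2 / 2) - complex_of_real (exp (- (u\<^sup>2 * v / 2)))) \<le> u\<^sup>2 * \<bar>s2 - v\<bar> + u ^ 4 * v\<^sup>2"
    unfolding of_real_diff[symmetric] norm_of_real .
  show ?thesis
    unfolding s2_def[symmetric]
    using norm_triangle_ineq[of "EK l (\<lambda>h. iexp (u * incr l h)) - complex_of_real (1 - u\<^sup>2 * s2 / 2)"
        "complex_of_real (1 - u\<^sup>2 * s2 / 2) - complex_of_real (exp (- (u\<^sup>2 * v / 2)))"] 1 2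
    by simp
qed

lemma EU_EK_incr_cube: "\<exists>C\<ge>0. \<forall>k. EU k (\<lambda>l. EK l (\<lambda>h. \<bar>incr l h\<bar> ^ 3)) \<le> C * (growth k / (real k + 2) ^ 3)"
proof -
  obtain C where C: "C \<ge> 0" "\<And>k. EU k (\<lambda>l. EK l (\<lambda>h. Q l h ^ 3)) \<le> C * growth k"
    using Q_moments[of 3] by auto
  have "EU k (\<lambda>l. EK l (\<lambda>h. \<bar>incr l h\<bar> ^ 3)) \<le> (c ^ 3 * C) * (growth k / (real k + 2) ^ 3)" for k
  proof -
    have "EU k (\<lambda>l. EK l (\<lambda>h. \<bar>incr l h\<bar> ^ 3)) \<le> EU k (\<lambda>l. (c / (real k + 2)) ^ 3 * EK l (\<lambda>h. Q l h ^ 3))"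
    proof (rule EU_mono)
      fix l :: "nat list" assume l: "length l = k" "nonneg_mass l"
      have "\<bar>incr l h\<bar> ^ 3 \<le> (c / (real k + 2)) ^ 3 * Q l h ^ 3" for h
        unfolding power_mult_distrib[symmetric] using incr_le[OF l(2,1), of h] by (intro power_mono) auto
      then show "EK l (\<lambda>h. \<bar>incr l h\<bar> ^ 3) \<le> (c / (real k + 2)) ^ 3 * EK l (\<lambda>h. Q l h ^ 3)"
        unfolding EK_mult[OF l(2), symmetric] by (rule EK_mono[OF l(2)])
    qed
    also have "\<dots> = (c / (real k + 2)) ^ 3 * EU k (\<lambda>l. EK l (\<lambda>h. Q l h ^ 3))" by simp
    also have "\<dots> \<le> (c / (real k + 2)) ^ 3 * (C * growth k)"
      using c_pos C by (intro mult_left_mono) auto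
    finally show ?thesis by (simp add: power_divide)
  qed
  then show ?thesis using C c_pos by (intro exI[of _ "c ^ 3 * C"]) auto
qed

text \<open>The \<open>L_2\<close> bound on \<open>V - alpha\<close> is turned into an
  \<open>L_1\<close> bound by estimating an absolute value by its square plus one. Its
  \<open>O(1)\<close> size is enough because the squared weight supplies the decay.\<close>

lemma EU_stepvar: "\<exists>C\<ge>0. \<forall>k. EU k (\<lambda>l. \<bar>EK l (\<lambda>h. (incr l h)\<^sup>2) - stepvar k\<bar>) \<le> C * (1 / (real k + 1)\<^sup>2)"
proof -
  obtain C where C: "C \<ge> 0" "\<And>k. EU k (\<lambda>l. (V l - alpha k)\<^sup>2) \<le> C" using V_variance by auto
  have "EU k (\<lambda>l. \<bar>EK l (\<lambda>h. (incr l h)\<^sup>2) - stepvar k\<bar>) \<le> (c\<^sup>2 * (1 + C) + 23) * (1 / (real k + 1)\<^sup>2)" for k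
  proof -
    have "EU k (\<lambda>l. \<bar>EK l (\<lambda>h. (incr l h)\<^sup>2) - stepvar k\<bar>)
      \<le> EU k (\<lambda>l. (c\<^sup>2 * (1 / (real k + 1)\<^sup>2)) * (V l - alpha k)\<^sup>2 + (c\<^sup>2 + 23) * (1 / (real k + 1)\<^sup>2))"
    proof (rule EU_mono)
      fix l :: "nat list" assume l: "length l = k" "nonneg_mass l"
      define x where "x = V l - alpha k"
      have "\<bar>x\<bar> \<le> x\<^sup>2 + 1"
      proof -
        have "0 \<le> (\<bar>x\<bar> - 1)\<^sup>2" by simp
        then show ?thesis unfolding power2_diff by simp
      qed
      have "\<bar>c\<^sup>2 * V l / (W (Suc k))\<^sup>2 - c\<^sup>2 * alpha k / (W (Suc k))\<^sup>2\<bar> = c\<^sup>2 * \<bar>x\<bar> * (1 / (W (Suc k))\<^sup>2)"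
      proof -
        have "c\<^sup>2 * V l / (W (Suc k))\<^sup>2 - c\<^sup>2 * alpha k / (W (Suc k))\<^sup>2 = c\<^sup>2 * x * (1 / (W (Suc k))\<^sup>2)"
          by (simp add: x_def diff_divide_distrib right_diff_distrib)
        then show ?thesis by (simp add: abs_mult)
      qed
      also have "\<dots> \<le> c\<^sup>2 * (x\<^sup>2 + 1) * (1 / (real k + 1)\<^sup>2)"
      proof (intro mult_mono mult_left_mono)
        show "1 / (W (Suc k))\<^sup>2 \<le> 1 / (real k + 1)\<^sup>2"
          using W_ge[of "Suc k"] W_pos[of "Suc k"] by (intro divide_left_mono power_mono) auto
      qed (use \<open>\<bar>x\<bar> \<le> x\<^sup>2 + 1\<close> in auto)
      finally have "\<bar>c\<^sup>2 * V l / (W (Suc k))\<^sup>2 - stepvar k\<bar>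
          \<le> c\<^sup>2 * (x\<^sup>2 + 1) * (1 / (real k + 1)\<^sup>2) + 23 * (1 / (real k + 1)\<^sup>2)"
        using stepvar_compare[of k] by linarith
      then show "\<bar>EK l (\<lambda>h. (incr l h)\<^sup>2) - stepvar k\<bar>
          \<le> (c\<^sup>2 * (1 / (real k + 1)\<^sup>2)) * (V l - alpha k)\<^sup>2 + (c\<^sup>2 + 23) * (1 / (real k + 1)\<^sup>2)"
        unfolding EK_incr_square[OF l(2)] l(1) x_def by (simp add: algebra_simps add_divide_distrib)
    qed
    also have "\<dots> = (c\<^sup>2 * (1 / (real k + 1)\<^sup>2)) * EU k (\<lambda>l. (V l - alpha k)\<^sup>2) + (c\<^sup>2 + 23) * (1 / (real k + 1)\<^sup>2)"
      unfolding EU_add by simp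
    also have "\<dots> \<le> (c\<^sup>2 * (1 / (real k + 1)\<^sup>2)) * C + (c\<^sup>2 + 23) * (1 / (real k + 1)\<^sup>2)"
      using C by (intro add_right_mono mult_left_mono) auto
    finally show ?thesis by (simp add: algebra_simps add_divide_distrib)
  qed
  then show ?thesis using C by (intro exI[of _ "c\<^sup>2 * (1 + C) + 23"]) auto
qed

text \<open>Lindeberg's replacement argument, one increment at a time: conditionally on the past, the
  characteristic function of each increment is replaced by a Gaussian one of deterministic variance.\<close>

lemma R_char: "\<exists>C\<ge>0. \<forall>u n k. 2 \<le> n \<longrightarrow> n \<le> k \<longrightarrow>
  cmod (EU k (\<lambda>l. iexp (u * R n l)) - complex_of_real (exp (- (u\<^sup>2 * (\<kappa> * (tailvar n - tailvar k)) / 2))))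
    \<le> C * (\<bar>u\<bar> ^ 3 * (real n + 1) powr (-3/4) + u\<^sup>2 + u ^ 4 / (real n + 1)) / (real n + 1)"
proof -
  obtain C3 where C3: "C3 \<ge> 0" "\<And>k. EU k (\<lambda>l. EK l (\<lambda>h. \<bar>incr l h\<bar> ^ 3)) \<le> C3 * (growth k / (real k + 2) ^ 3)"
    using EU_EK_incr_cube by auto
  obtain C2 where C2: "C2 \<ge> 0" "\<And>k. EU k (\<lambda>l. \<bar>EK l (\<lambda>h. (incr l h)\<^sup>2) - stepvar k\<bar>) \<le> C2 * (1 / (real k + 1)\<^sup>2)"
    using EU_stepvar by auto
  \<comment> \<open>A common constant for the cubic terms, the step variances and the factor
    \<open>256\<close> of \<open>stepvar_bounds\<close>. The additional factor \<open>2\<close>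
    below comes from summing the inverse squares.\<close>
  define C where "C = C3 + C2 + 256"
  have "cmod (EU k (\<lambda>l. iexp (u * R n l)) - complex_of_real (exp (- (u\<^sup>2 * (\<kappa> * (tailvar n - tailvar k)) / 2))))
    \<le> (2 * C) * (\<bar>u\<bar> ^ 3 * (real n + 1) powr (-3/4) + u\<^sup>2 + u ^ 4 / (real n + 1)) / (real n + 1)"
    if n: "2 \<le> n" and k: "n \<le> k" for u n k
  proof -
    define B where "B = C * (\<bar>u\<bar> ^ 3 * (real n + 1) powr (-3/4) + u\<^sup>2 + u ^ 4 / (real n + 1))"
    define D where "D k = EU k (\<lambda>l. iexp (u * R n l)) - complex_of_real (exp (- (u\<^sup>2 * (\<kappa> * (tailvar n - tailvar k)) / 2)))" for k
    have C: "C \<ge> 0" "C3 \<le> C" "C2 \<le> C" "256 \<le> C" using C2 C3 by (auto simp: C_def)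
    have B: "B \<ge> 0" unfolding B_def using C by (intro mult_nonneg_nonneg add_nonneg_nonneg) auto
    have rec: "cmod (D (Suc j)) \<le> cmod (D j) + B * (1 / (real j + 1)\<^sup>2)" if j: "n \<le> j" for j
    proof -
      define E where "E = complex_of_real (exp (- (u\<^sup>2 * stepvar j / 2)))"
      have v: "stepvar j \<ge> 0" "(stepvar j)\<^sup>2 \<le> 256 * (1 / (real j + 1) ^ 3)" using stepvar_bounds n j by auto
      let ?F = "\<lambda>l. iexp (u * R n l) * (EK l (\<lambda>h. iexp (u * incr l h)) - E)"
      have "EU (Suc j) (\<lambda>l. iexp (u * R n l)) = EU j (\<lambda>l. ?F l + E * iexp (u * R n l))"
        unfolding EU_Suc
      proof (rule EU_cong)
        fix l :: "nat list" assume l: "length l = j" "nonneg_mass l"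
        have "EK l (\<lambda>h. iexp (u * R n (h # l))) = EK l (\<lambda>h. iexp (u * R n l) * iexp (u * incr l h))"
          using l j by (intro Bochner_Integration.integral_cong) (auto simp: distrib_left exp_add)
        also have "\<dots> = iexp (u * R n l) * EK l (\<lambda>h. iexp (u * incr l h))" by (rule integral_mult_right_zero)
        finally show "EK l (\<lambda>h. iexp (u * R n (h # l))) = ?F l + E * iexp (u * R n l)"
          by (simp add: algebra_simps)
      qed
      also have "\<dots> = EU j ?F + E * EU j (\<lambda>l. iexp (u * R n l))"
        by simp
      also have "complex_of_real (exp (- (u\<^sup>2 * (\<kappa> * (tailvar n - tailvar (Suc j))) / 2)))
          = E * complex_of_real (exp (- (u\<^sup>2 * (\<kappa> * (tailvar n - tailvar j)) / 2)))"
        unfolding E_def of_real_mult[symmetric] exp_add[symmetric] stepvar_def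
        by (simp add: algebra_simps diff_divide_distrib add_divide_distrib)
      ultimately have D: "D (Suc j) = EU j ?F + E * D j"
        by (simp add: D_def algebra_simps)
      \<comment> \<open>Multiplication by the Gaussian factor does not increase norms, so earlier
        errors are not amplified and the errors of the single steps simply add up.\<close>
      have E: "cmod E \<le> 1" using v by (simp add: E_def)
      have "cmod (EU j ?F) \<le> EU j (\<lambda>l. cmod (?F l))" by (rule integral_norm_bound)
      also have "\<dots> \<le> EU j (\<lambda>l. \<bar>u\<bar> ^ 3 * EK l (\<lambda>h. \<bar>incr l h\<bar> ^ 3) + (u\<^sup>2 * \<bar>EK l (\<lambda>h. (incr l h)\<^sup>2) - stepvar j\<bar> + u ^ 4 * (stepvar j)\<^sup>2))"
        unfolding E_def by (rule EU_mono) (simp only: norm_mult norm_exp_i_times mult_1_left EK_iexp v)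
      also have "\<dots> = \<bar>u\<bar> ^ 3 * EU j (\<lambda>l. EK l (\<lambda>h. \<bar>incr l h\<bar> ^ 3)) + (u\<^sup>2 * EU j (\<lambda>l. \<bar>EK l (\<lambda>h. (incr l h)\<^sup>2) - stepvar j\<bar>) + u ^ 4 * (stepvar j)\<^sup>2)"
        unfolding EU_add by simp
      also have "\<dots> \<le> \<bar>u\<bar> ^ 3 * (C * ((real n + 1) powr (-3/4) * (1 / (real j + 1)\<^sup>2))) + (u\<^sup>2 * (C * (1 / (real j + 1)\<^sup>2)) + u ^ 4 * (C * (1 / (real n + 1) * (1 / (real j + 1)\<^sup>2))))"
      proof (intro add_mono mult_left_mono)
        have "EU j (\<lambda>l. EK l (\<lambda>h. \<bar>incr l h\<bar> ^ 3)) \<le> C3 * (growth j / (real j + 2) ^ 3)" by (rule C3)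
        also have "\<dots> \<le> C * ((real n + 1) powr (-3/4) * (1 / (real j + 1)\<^sup>2))"
          using C C3 growth_cube_le[OF j] growth_ge_1[of j] by (intro mult_mono) auto
        finally show "EU j (\<lambda>l. EK l (\<lambda>h. \<bar>incr l h\<bar> ^ 3)) \<le> C * ((real n + 1) powr (-3/4) * (1 / (real j + 1)\<^sup>2))" .
        have "EU j (\<lambda>l. \<bar>EK l (\<lambda>h. (incr l h)\<^sup>2) - stepvar j\<bar>) \<le> C2 * (1 / (real j + 1)\<^sup>2)" by (rule C2)
        also have "\<dots> \<le> C * (1 / (real j + 1)\<^sup>2)" using C by (intro mult_right_mono) auto
        finally show "EU j (\<lambda>l. \<bar>EK l (\<lambda>h. (incr l h)\<^sup>2) - stepvar j\<bar>) \<le> C * (1 / (real j + 1)\<^sup>2)" .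
        have "(1 / (real j + 1) ^ 3) = (1 / (real j + 1)) * (1 / (real j + 1)\<^sup>2)"
          by (simp add: power3_eq_cube power2_eq_square)
        also have "\<dots> \<le> (1 / (real n + 1)) * (1 / (real j + 1)\<^sup>2)"
          using j by (intro mult_right_mono divide_left_mono) auto
        finally have "256 * (1 / (real j + 1) ^ 3) \<le> C * ((1 / (real n + 1)) * (1 / (real j + 1)\<^sup>2))"
          using C by (intro mult_mono) auto
        then show "(stepvar j)\<^sup>2 \<le> C * ((1 / (real n + 1)) * (1 / (real j + 1)\<^sup>2))" using v by simp
      qed auto
      also have "\<dots> = B * (1 / (real j + 1)\<^sup>2)" by (simp add: B_def algebra_simps add_divide_distrib)
      finally have F: "cmod (EU j ?F) \<le> B * (1 / (real j + 1)\<^sup>2)" .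
      have "cmod (E * D j) \<le> 1 * cmod (D j)" unfolding norm_mult using E by (intro mult_right_mono) auto
      then show ?thesis unfolding D using F norm_triangle_ineq[of "EU j ?F" "E * D j"] by simp
    qed
    have "cmod (D k) \<le> (\<Sum>j=n..<k. B * (1 / (real j + 1)\<^sup>2))"
      using k
    proof (induction k rule: dec_induct)
      case base
      have "EU n (\<lambda>l. iexp (u * R n l)) = EU n (\<lambda>l. 1)" by (intro EU_cong) (simp add: R_short)
      then show ?case by (simp add: D_def)
    next
      case (step j)
      then show ?case using rec[of j] by simp
    qed
    also have "\<dots> = B * (\<Sum>j=n..<k. 1 / (real j + 1)\<^sup>2)" by (simp add: sum_distrib_left)
    also have "\<dots> \<le> B * (2 / (real n + 1))" using B by (intro mult_left_mono sum_inverse_squares_le)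
    finally show ?thesis by (simp add: D_def B_def mult_ac)
  qed
  moreover have "2 * C \<ge> 0" using C2 C3 by (simp add: C_def)
  ultimately show ?thesis by blast
qed

end

section \<open>From the tree process to the urn\<close>

text \<open>A tree history is encoded by the list of parents, newest node first; the node inserted by
  \<open>v # vs\<close> carries the label \<open>length vs + 2\<close>.\<close>

primrec tree_of :: "nat list \<Rightarrow> rtree" where
  "tree_of [] = single_node"
| "tree_of (v # vs) = attach (tree_of vs) v (length vs + 2)"

primrec recursive :: "nat list \<Rightarrow> bool" where
  "recursive [] = True"
| "recursive (v # vs) = (recursive vs \<and> v \<in> {1..length vs + 1})"

text \<open>The depth read off from the construction; labels outside the tree get the default value
  \<open>0\<close>.\<close>

primrec depth_of :: "nat list \<Rightarrow> nat \<Rightarrow> nat" where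
  "depth_of [] u = 0"
| "depth_of (v # vs) u = (if u = length vs + 2 then Suc (depth_of vs v) else depth_of vs u)"

primrec parent_depths :: "nat list \<Rightarrow> nat list" where
  "parent_depths [] = []"
| "parent_depths (v # vs) = depth_of vs v # parent_depths vs"

lemma length_parent_depths [simp]: "length (parent_depths vs) = length vs"
  by (induction vs) auto

lemma nodes_tree_of: "nodes (tree_of vs) = {1..length vs + 1}"
  by (induction vs) (auto simp: single_node_def attach_def)

lemma edges_tree_of_Cons: "edges (tree_of (v # vs)) = insert (v, length vs + 2) (edges (tree_of vs))"
  by (simp add: attach_def)

lemma edges_tree_of:
  assumes "recursive vs" "(x, y) \<in> edges (tree_of vs)"
  shows "x \<in> {1..length vs + 1}" "y \<in> {2..length vs + 1}" "depth_of vs y = Suc (depth_of vs x)"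
proof -
  have "x \<in> {1..length vs + 1} \<and> y \<in> {2..length vs + 1} \<and> depth_of vs y = Suc (depth_of vs x)"
    using assms by (induction vs) (auto simp: single_node_def edges_tree_of_Cons simp del: tree_of.simps(2))
  then show "x \<in> {1..length vs + 1}" "y \<in> {2..length vs + 1}" "depth_of vs y = Suc (depth_of vs x)"
    by auto
qed

lemma finite_edges_tree_of: "finite (edges (tree_of vs))"
  by (induction vs) (auto simp: single_node_def edges_tree_of_Cons simp del: tree_of.simps(2))

lemma outdegree_tree_of_Cons:
  assumes "recursive (v # vs)"
  shows "outdegree (tree_of (v # vs)) u = outdegree (tree_of vs) u + of_bool (u = v)"
proof -
  have new: "(u, length vs + 2) \<notin> edges (tree_of vs)"
    using edges_tree_of(2)[of vs u "length vs + 2"] assms by auto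
  have fin: "finite {w. (u, w) \<in> edges (tree_of vs)}"
    by (rule finite_subset[OF _ finite_imageI[OF finite_edges_tree_of, of snd vs]]) force
  have "{w. (u, w) \<in> edges (tree_of (v # vs))} =
      (if u = v then insert (length vs + 2) {w. (u, w) \<in> edges (tree_of vs)} else {w. (u, w) \<in> edges (tree_of vs)})"
    unfolding edges_tree_of_Cons by auto
  then show ?thesis using new fin by (cases "u = v") (auto simp: outdegree_def simp del: tree_of.simps)
qed

lemma outdegree_new:
  assumes "recursive vs"
  shows "outdegree (tree_of vs) (length vs + 2) = 0"
proof -
  have "{w. (length vs + 2, w) \<in> edges (tree_of vs)} = {}"
    using edges_tree_of(1)[OF assms] by fastforce
  then show ?thesis by (simp add: outdegree_def)
qed

lemma depth_of_1 [simp]: "depth_of vs 1 = 0" "depth_of vs (Suc 0) = 0"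
  by (induction vs) auto

lemma relpow_depth_of:
  assumes "recursive vs" "u \<in> {1..length vs + 1}"
  shows "(1, u) \<in> (edges (tree_of vs) \<union> (edges (tree_of vs))\<inverse>) ^^ depth_of vs u"
  using assms
proof (induction vs arbitrary: u)
  case Nil
  then show ?case by auto
next
  case (Cons v vs)
  let ?R = "\<lambda>vs. edges (tree_of vs) \<union> (edges (tree_of vs))\<inverse>"
  have mono: "?R vs ^^ k \<subseteq> ?R (v # vs) ^^ k" for k
    unfolding edges_tree_of_Cons by (induction k) (auto intro!: relcomp_mono)
  show ?case
  proof (cases "u = length vs + 2")
    case True
    have "(1, v) \<in> ?R vs ^^ depth_of vs v" using Cons by auto
    then have "(1, v) \<in> ?R (v # vs) ^^ depth_of vs v" using mono by blast
    moreover have "(v, u) \<in> ?R (v # vs)" unfolding edges_tree_of_Cons using True by auto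
    ultimately have "(1, u) \<in> ?R (v # vs) ^^ Suc (depth_of vs v)" by auto
    then show ?thesis using True by (simp del: tree_of.simps relpow.simps)
  next
    case False
    then have "(1, u) \<in> ?R vs ^^ depth_of vs u" using Cons by auto
    then show ?thesis using False mono by (auto simp del: tree_of.simps)
  qed
qed

text \<open>Traversing an edge in either direction changes \<open>depth_of\<close> by exactly one,
  so no walk reaches a node faster than its depth.\<close>

lemma depth_of_le_relpow:
  assumes "recursive vs" "(1, u) \<in> (edges (tree_of vs) \<union> (edges (tree_of vs))\<inverse>) ^^ k"
  shows "depth_of vs u \<le> k"
  using assms(2)
proof (induction k arbitrary: u)
  case 0
  then show ?case by auto
next
  case (Suc k)
  then obtain x where x: "(1, x) \<in> (edges (tree_of vs) \<union> (edges (tree_of vs))\<inverse>) ^^ k"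
    "(x, u) \<in> edges (tree_of vs) \<or> (u, x) \<in> edges (tree_of vs)" by auto
  then show ?case
    using Suc.IH[OF x(1)] edges_tree_of(3)[OF assms(1), of x u] edges_tree_of(3)[OF assms(1), of u x] by auto
qed

lemma depth_tree_of:
  assumes "recursive vs" "u \<in> {1..length vs + 1}"
  shows "depth (tree_of vs) u = depth_of vs u"
  unfolding depth_def graph_distance_def
  using relpow_depth_of[OF assms] by (rule Least_equality) (rule depth_of_le_relpow[OF assms(1)])

lemma path_length_tree_of:
  assumes "recursive vs"
  shows "path_length (tree_of vs) = (\<Sum>h\<leftarrow>parent_depths vs. Suc h)"
proof -
  have "path_length (tree_of vs) = (\<Sum>u=1..length vs + 1. depth_of vs u)"
    unfolding path_length_def nodes_tree_of using depth_tree_of[OF assms] by (intro sum.cong) auto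
  also have "\<dots> = (\<Sum>h\<leftarrow>parent_depths vs. Suc h)"
  proof (induction vs)
    case (Cons v vs)
    have "(\<Sum>u=1..length vs + 1. depth_of (v # vs) u) = (\<Sum>u=1..length vs + 1. depth_of vs u)"
      by (intro sum.cong) auto
    then show ?case using Cons by simp
  qed simp
  finally show ?thesis .
qed

section \<open>Attachment weights of the encoded trees\<close>

context depth_urn begin

text \<open>The bridge from trees to the urn: an insertion changes the weight of the parent by
  \<beta> and adds a leaf of weight \<open>m\<close> one level deeper, which is precisely the
  recursion of \<open>tot\<close>.\<close>

lemma sum_weight_tree_of:
  assumes "recursive vs"
  shows "(\<Sum>u=1..length vs + 1. weight \<beta> m (tree_of vs) u * f (depth_of vs u)) = tot f (parent_depths vs)"
  using assms
proof (induction vs)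
  case Nil
  then show ?case by (simp add: weight_def outdegree_def single_node_def)
next
  case (Cons v vs)
  let ?n = "length vs + 2"
  have v: "v \<in> {1..length vs + 1}" using Cons.prems by simp
  have old: "weight \<beta> m (tree_of (v # vs)) u * f (depth_of (v # vs) u)
      = weight \<beta> m (tree_of vs) u * f (depth_of vs u) + (if u = v then b * f (depth_of vs v) else 0)"
    if "u \<in> {1..length vs + 1}" for u
    using that outdegree_tree_of_Cons[OF Cons.prems, of u] by (auto simp: weight_def algebra_simps simp del: tree_of.simps)
  have "(\<Sum>u=1..length vs + 1. weight \<beta> m (tree_of (v # vs)) u * f (depth_of (v # vs) u))
      = (\<Sum>u=1..length vs + 1. weight \<beta> m (tree_of vs) u * f (depth_of vs u) + (if u = v then b * f (depth_of vs v) else 0))"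
    by (rule sum.cong[OF refl old])
  also have "\<dots> = tot f (parent_depths vs) + b * f (depth_of vs v)"
    unfolding sum.distrib using Cons v by (simp del: sum.cl_ivl_Suc)
  finally have "(\<Sum>u=1..length vs + 1. weight \<beta> m (tree_of (v # vs)) u * f (depth_of (v # vs) u))
      = tot f (parent_depths vs) + b * f (depth_of vs v)" .
  moreover have "weight \<beta> m (tree_of (v # vs)) ?n = a"
    using outdegree_tree_of_Cons[OF Cons.prems, of ?n] outdegree_new[of vs] Cons.prems v
    by (auto simp: weight_def simp del: tree_of.simps)
  ultimately show ?case by (simp add: algebra_simps del: tree_of.simps)
qed

lemma sum_weight_total:
  "recursive vs \<Longrightarrow> (\<Sum>u\<in>nodes (tree_of vs). weight \<beta> m (tree_of vs) u) = W (length vs)"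
  using sum_weight_tree_of[of vs "\<lambda>_. 1"] by (simp add: nodes_tree_of tot_const)

end

section \<open>Histories and the law of the parent depths\<close>

locale tree_urn = random_tree_process M T \<beta> m + depth_urn \<beta> m
  for M :: "'w measure" and T \<beta> m
begin

text \<open>Lists are newest first, so the tree at time \<open>k\<close> arises by dropping the
  \<open>length vs + 1 - k\<close> latest parents. All earlier trees are recorded because the
  transition law is conditional on the whole history.\<close>

definition history :: "nat list \<Rightarrow> 'w set" where
  "history vs = {\<omega>\<in>space M. \<forall>k\<in>{1..length vs + 1}. T k \<omega> = tree_of (drop (length vs + 1 - k) vs)}"

lemma T_vimage [measurable]: "n \<ge> 1 \<Longrightarrow> {\<omega>\<in>space M. T n \<omega> = t} \<in> events"
  using measurable_sets[OF measurable_T, of n "{t}"] by (simp add: vimage_def Int_def conj_commute)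

lemma history_Nil: "history [] = {\<omega>\<in>space M. T 1 \<omega> = single_node}"
  by (auto simp: history_def)

lemma history_Cons:
  "history (v # vs) = {\<omega>\<in>history vs. T (length vs + 2) \<omega> = attach (tree_of vs) v (length vs + 2)}"
proof -
  have "{1..length (v # vs) + 1} = insert (length vs + 2) {1..length vs + 1}" by auto
  moreover have "drop (length (v # vs) + 1 - k) (v # vs) = drop (length vs + 1 - k) vs"
    if "k \<in> {1..length vs + 1}" for k
    using that by (cases "length (v # vs) + 1 - k") (auto simp: Suc_diff_le)
  ultimately show ?thesis by (auto simp: history_def simp del: tree_of.simps(1)) 
qed

lemma history_measurable [measurable]: "history vs \<in> events"
proof (induction vs)
  case Nil
  then show ?case unfolding history_Nil by (rule T_vimage) simp
next
  case (Cons v vs)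
  have "history (v # vs) = history vs \<inter> {\<omega>\<in>space M. T (length vs + 2) \<omega> = attach (tree_of vs) v (length vs + 2)}"
    unfolding history_Cons by (auto simp: history_def)
  then show ?case using Cons T_vimage[of "length vs + 2"] by auto
qed

lemma prob_history_Nil: "prob (history []) = 1"
  unfolding history_Nil using T_1 by (subst prob_Collect_eq_1) (auto intro!: T_vimage)

lemma prob_history_Cons:
  assumes "recursive vs" "v \<in> {1..length vs + 1}"
  shows "prob (history (v # vs)) = prob (history vs) * (weight \<beta> m (tree_of vs) v / W (length vs))"
\<comment> \<open>The transition law is given for histories of positive probability; for a null
  history both sides vanish.\<close>
proof (cases "prob (history vs) = 0")
  case True
  have "prob (history (v # vs)) \<le> prob (history vs)"
    by (rule finite_measure_mono) (auto simp: history_Cons)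
  then show ?thesis using True by (simp add: measure_le_0_iff)
next
  case False
  define t where "t k = tree_of (drop (length vs + 1 - k) vs)" for k
  define n where "n = length vs + 2"
  have t: "t (n - 1) = tree_of vs" by (simp add: t_def n_def)
  have hist: "history vs = {\<omega>\<in>space M. \<forall>k\<in>{1..n - 1}. T k \<omega> = t k}"
    by (simp add: history_def t_def n_def)
  have pos: "\<P>(\<omega> in M. \<forall>k\<in>{1..n - 1}. T k \<omega> = t k) > 0"
    using False measure_nonneg[of M "history vs"] unfolding hist by linarith
  have "v \<in> nodes (t (n - 1))" using assms unfolding t nodes_tree_of by simp
  then have "\<P>(\<omega> in M. T n \<omega> = attach (t (n - 1)) v n \<bar> \<forall>k\<in>{1..n - 1}. T k \<omega> = t k)
      = weight \<beta> m (tree_of vs) v / W (length vs)"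
    unfolding sum_weight_total[OF assms(1), symmetric] t[symmetric]
    using T_step[OF _ _ pos, of v] by (simp add: n_def)
  moreover have "\<P>(\<omega> in M. T n \<omega> = attach (t (n - 1)) v n \<bar> \<forall>k\<in>{1..n - 1}. T k \<omega> = t k)
      = prob (history (v # vs)) / prob (history vs)"
  proof -
    have "{\<omega>\<in>space M. T n \<omega> = attach (t (n - 1)) v n \<and> (\<forall>k\<in>{1..n - 1}. T k \<omega> = t k)} = history (v # vs)"
      unfolding history_Cons hist t by (auto simp: n_def)
    then show ?thesis unfolding cond_prob_def hist[symmetric] by simp
  qed
  ultimately show ?thesis using False by (simp add: field_simps)
qed

primrec histories :: "nat \<Rightarrow> nat list set" where
  "histories 0 = {[]}"
| "histories (Suc k) = (\<lambda>(v, vs). v # vs) ` ({1..k + 1} \<times> histories k)"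

lemma histories_eq: "vs \<in> histories k \<longleftrightarrow> length vs = k \<and> recursive vs"
proof (induction k arbitrary: vs)
  case (Suc k)
  then show ?case by (cases vs) (auto simp: image_iff)
qed auto

lemma finite_histories: "finite (histories k)"
  by (induction k) auto

text \<open>Stated for arbitrary \<open>F\<close> so that, in the induction, summing over the latest
  parent turns \<open>F\<close> into its average under the kernel, to which the hypothesis
  applies.\<close>

lemma sum_histories:
  "(\<Sum>vs\<in>histories k. prob (history vs) * F (parent_depths vs)) = EU k F"
proof (induction k arbitrary: F)
  case 0
  then show ?case by (simp add: prob_history_Nil)
next
  case (Suc k)
  have "(\<Sum>vs\<in>histories (Suc k). prob (history vs) * F (parent_depths vs))
      = (\<Sum>(v, vs)\<in>{1..k + 1} \<times> histories k. prob (history (v # vs)) * F (depth_of vs v # parent_depths vs))"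
    unfolding histories.simps by (subst sum.reindex) (auto simp: inj_on_def case_prod_beta intro!: sum.cong)
  also have "\<dots> = (\<Sum>vs\<in>histories k. \<Sum>v=1..k + 1. prob (history (v # vs)) * F (depth_of vs v # parent_depths vs))"
    unfolding sum.cartesian_product[symmetric] by (rule sum.swap)
  also have "\<dots> = (\<Sum>vs\<in>histories k. prob (history vs) * (tot (\<lambda>h. F (h # parent_depths vs)) (parent_depths vs) / W k))"
  proof (rule sum.cong[OF refl])
    fix vs assume "vs \<in> histories k"
    then have vs: "recursive vs" "length vs = k" by (auto simp: histories_eq)
    have "(\<Sum>v=1..k + 1. prob (history (v # vs)) * F (depth_of vs v # parent_depths vs))
      = (\<Sum>v=1..k + 1. prob (history vs) / W k * (weight \<beta> m (tree_of vs) v * F (depth_of vs v # parent_depths vs)))"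
      using vs by (intro sum.cong refl) (subst prob_history_Cons, auto)
    also have "\<dots> = prob (history vs) / W k * tot (\<lambda>h. F (h # parent_depths vs)) (parent_depths vs)"
      unfolding sum_distrib_left[symmetric]
      using sum_weight_tree_of[OF vs(1), of "\<lambda>h. F (h # parent_depths vs)"] unfolding vs(2) by simp
    finally show "(\<Sum>v=1..k + 1. prob (history (v # vs)) * F (depth_of vs v # parent_depths vs))
      = prob (history vs) * (tot (\<lambda>h. F (h # parent_depths vs)) (parent_depths vs) / W k)" by simp
  qed
  also have "\<dots> = EU k (\<lambda>l. tot (\<lambda>h. F (h # l)) l / W k)"
    using Suc.IH[of "\<lambda>l. tot (\<lambda>h. F (h # l)) l / W k"] by simp
  also have "\<dots> = EU (Suc k) F"
    unfolding EU_Suc by (intro EU_cong) (simp add: EK_eq)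
  finally show ?case .
qed

text \<open>The label of the newest node occurs in no earlier edge, so the edge leading to it
  reveals its parent.\<close>

lemma history_disjoint:
  assumes "vs \<noteq> vs'" "length vs = length vs'" "recursive vs" "recursive vs'"
  shows "history vs \<inter> history vs' = {}"
  using assms
proof (induction vs arbitrary: vs')
  case (Cons v vs)
  then obtain v' vs'' where vs': "vs' = v' # vs''" by (cases vs') auto
  show ?case
  proof (cases "vs = vs''")
    case False
    then have "history vs \<inter> history vs'' = {}" using Cons vs' by auto
    then show ?thesis unfolding vs' history_Cons by auto
  next
    case True
    then have "v \<noteq> v'" using Cons.prems vs' by auto
    moreover have "v = v'" if "attach (tree_of vs) v (length vs + 2) = attach (tree_of vs) v' (length vs + 2)"
    proof -
      have "(v, length vs + 2) \<in> edges (attach (tree_of vs) v' (length vs + 2))"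
        unfolding that[symmetric] by (simp add: attach_def)
      moreover have "(v, length vs + 2) \<notin> edges (tree_of vs)"
        using edges_tree_of(2)[of vs v "length vs + 2"] Cons.prems by auto
      ultimately show ?thesis by (simp add: attach_def)
    qed
    ultimately show ?thesis unfolding vs' history_Cons True by auto
  qed
qed auto

text \<open>The histories are disjoint, and the case \<open>F = 1\<close> of
  \<open>sum_histories\<close> shows that their probabilities exhaust the whole mass.\<close>

lemma AE_history: "AE \<omega> in M. \<exists>vs\<in>histories k. \<omega> \<in> history vs"
proof -
  have "prob (\<Union>vs\<in>histories k. history vs) = (\<Sum>vs\<in>histories k. prob (history vs))"
    by (rule finite_measure_finite_Union[OF finite_histories])
      (auto simp: disjoint_family_on_def histories_eq dest: history_disjoint)
  also have "\<dots> = 1" using sum_histories[where k = k and F = "\<lambda>_. 1"] by simp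
  finally have "AE \<omega> in M. \<omega> \<in> (\<Union>vs\<in>histories k. history vs)"
    by (intro AE_prob_1) 
  then show ?thesis by simp
qed

text \<open>An insertion increases the path length by the depth of the parent plus one. Reading the
  depth off this increment gives a random variable on the whole space without selecting a
  history.\<close>

primrec depths :: "nat \<Rightarrow> 'w \<Rightarrow> nat list" where
  "depths 0 \<omega> = []"
| "depths (Suc k) \<omega> = (path_length (T (k + 2) \<omega>) - path_length (T (k + 1) \<omega>) - 1) # depths k \<omega>"

lemma history_T: "\<omega> \<in> history vs \<Longrightarrow> T (length vs + 1) \<omega> = tree_of vs"
  by (auto simp: history_def)

lemma depths_history:
  assumes "\<omega> \<in> history vs" "recursive vs"
  shows "depths (length vs) \<omega> = parent_depths vs"
  using assms
proof (induction vs)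
  case (Cons v vs)
  have "\<omega> \<in> history vs" using Cons.prems by (auto simp: history_Cons)
  then have "T (length vs + 1) \<omega> = tree_of vs" "T (length vs + 2) \<omega> = tree_of (v # vs)"
    "depths (length vs) \<omega> = parent_depths vs"
    using history_T[of \<omega> vs] history_T[of \<omega> "v # vs"] Cons by auto
  moreover have "path_length (tree_of (v # vs)) = path_length (tree_of vs) + Suc (depth_of vs v)"
    using path_length_tree_of[of vs] path_length_tree_of[of "v # vs"] Cons.prems by simp
  ultimately show ?case by (simp del: tree_of.simps)
qed simp

lemma length_depths [simp]: "length (depths k \<omega>) = k"
  by (induction k) auto

lemma AE_path_length: "AE \<omega> in M. path_length (T (k + 1) \<omega>) = (\<Sum>h\<leftarrow>depths k \<omega>. Suc h)"
  using AE_history[of k]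
proof eventually_elim
  case (elim \<omega>)
  then obtain vs where vs: "length vs = k" "recursive vs" "\<omega> \<in> history vs" by (auto simp: histories_eq)
  then show ?case using path_length_tree_of[of vs] history_T[of \<omega> vs] depths_history[of \<omega> vs] by auto
qed

lemma path_length_measurable: "n \<ge> 1 \<Longrightarrow> (\<lambda>\<omega>. path_length (T n \<omega>)) \<in> measurable M (count_space UNIV)"
  using measurable_compose[OF measurable_T, of n path_length "count_space UNIV"] by simp

lemma depths_measurable [measurable]: "depths k \<in> measurable M (count_space UNIV)"
proof (induction k)
  case 0
  then show ?case by simp
next
  case (Suc k)
  define d where "d \<omega> = path_length (T (k + 2) \<omega>) - path_length (T (k + 1) \<omega>) - 1" for \<omega>
  have d [measurable]: "d \<in> measurable M (count_space UNIV)"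
    using path_length_measurable[of "k + 2"] path_length_measurable[of "k + 1"] unfolding d_def by measurable
  note Suc [measurable]
  have "depths (Suc k) -` {l} \<inter> space M \<in> events" for l
  proof (cases l)
    case (Cons x xs)
    have "depths (Suc k) -` {l} \<inter> space M = {\<omega>\<in>space M. d \<omega> = x \<and> depths k \<omega> = xs}"
      using Cons by (auto simp: d_def)
    also have "\<dots> \<in> events" by measurable
    finally show ?thesis .
  next
    case Nil
    then have "depths (Suc k) -` {l} \<inter> space M = {}" by auto
    then show ?thesis by simp
  qed
  then show ?case by (subst measurable_count_space_eq2_countable) auto
qed

text \<open>Almost surely exactly one history of the given length occurs, so the indicator of a
  value of \<open>depths k\<close> is a sum over histories, and \<open>sum_histories\<close>
  evaluates its expectation.\<close>

lemma distr_depths: "distr M (count_space UNIV) (depths k) = measure_pmf (urn k)"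
proof (rule measure_eqI_countable[where A = UNIV])
  fix l :: "nat list"
  have "prob {\<omega>\<in>space M. depths k \<omega> = l} = pmf (urn k) l"
  proof -
    have "prob {\<omega>\<in>space M. depths k \<omega> = l} = (\<integral>\<omega>. indicator {\<omega>\<in>space M. depths k \<omega> = l} \<omega> \<partial>M)"
      by simp
    also have "\<dots> = (\<integral>\<omega>. (\<Sum>vs\<in>histories k. indicator (history vs) \<omega> * indicator {l} (parent_depths vs)) \<partial>M)"
    proof (rule integral_cong_AE)
      show "AE \<omega> in M. indicator {\<omega>\<in>space M. depths k \<omega> = l} \<omega> = (\<Sum>vs\<in>histories k. indicator (history vs) \<omega> * indicator {l} (parent_depths vs) :: real)"
        using AE_history[of k]
      proof eventually_elim
        case (elim \<omega>)
        then obtain vs where vs: "vs \<in> histories k" "\<omega> \<in> history vs" by auto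
        have "\<omega> \<notin> history vs'" if "vs' \<in> histories k" "vs' \<noteq> vs" for vs'
          using history_disjoint[of vs' vs] vs that by (auto simp: histories_eq)
        then have "(\<Sum>vs\<in>histories k. indicator (history vs) \<omega> * indicator {l} (parent_depths vs) :: real)
            = (\<Sum>vs'\<in>{vs}. indicator (history vs') \<omega> * indicator {l} (parent_depths vs'))"
          using vs finite_histories by (intro sum.mono_neutral_right) auto
        moreover have "depths k \<omega> = parent_depths vs" "\<omega> \<in> space M"
          using depths_history[of \<omega> vs] vs by (auto simp: histories_eq history_def)
        ultimately show ?case using vs by (auto simp: indicator_def)
      qed
    qed measurable
    also have "\<dots> = (\<Sum>vs\<in>histories k. prob (history vs) * indicator {l} (parent_depths vs))"
      by (subst Bochner_Integration.integral_sum) (auto simp: less_top[symmetric])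
    also have "\<dots> = EU k (indicator {l})" by (rule sum_histories)
    also have "\<dots> = pmf (urn k) l" by (simp add: measure_pmf_single)
    finally show ?thesis .
  qed
  moreover have "depths k -` {l} \<inter> space M = {\<omega>\<in>space M. depths k \<omega> = l}" by auto
  ultimately show "emeasure (distr M (count_space UNIV) (depths k)) {l} = emeasure (measure_pmf (urn k)) {l}"
    by (simp add: emeasure_distr emeasure_eq_measure emeasure_pmf_single)
qed auto

lemma integral_depths:
  fixes F :: "nat list \<Rightarrow> 'a::{banach, second_countable_topology}"
  shows "(\<integral>\<omega>. F (depths k \<omega>) \<partial>M) = EU k F"
  unfolding distr_depths[symmetric] by (subst integral_distr) auto

definition Z :: "nat \<Rightarrow> 'w \<Rightarrow> real" where
  "Z k \<omega> = A (depths k \<omega>) - alpha k"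

lemma EU_A: "EU k A = alpha k"
proof (induction k)
  case (Suc k)
  have "EU (Suc k) A = EU k (\<lambda>l. A l + a / W (Suc k))"
    unfolding EU_Suc
  proof (rule EU_cong)
    fix l :: "nat list" assume l: "length l = k" "nonneg_mass l"
    have "EK l (\<lambda>h. A (h # l)) = EK l (\<lambda>h. (c / W (Suc k)) * (real h - A l) + 0 * real h + (A l + a / W (Suc k)))"
      by (intro Bochner_Integration.integral_cong) (auto simp: A_Cons l add_divide_distrib)
    also have "\<dots> = A l + a / W (Suc k)" unfolding EK_affine[OF l(2)] EK_centered[OF l(2)] by simp
    finally show "EK l (\<lambda>h. A (h # l)) = A l + a / W (Suc k)" .
  qed
  also have "\<dots> = alpha (Suc k)" unfolding EU_add using Suc by (simp add: alpha_def)
  finally show ?case .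
qed (simp add: alpha_def)

text \<open>A parent of depth \<open>h\<close> adds \<open>h + 1\<close> to the path length and
  \<open>c * (h + 1) - b\<close> to \<open>tot\<close>. Hence \<open>A\<close> is an affine function
  of the path length, with the prescribed denominator as scale.\<close>

lemma tot_id: "tot real l = c * real (\<Sum>h\<leftarrow>l. Suc h) - b * real (length l)"
  by (induction l) (auto simp: c_def algebra_simps)

lemma AE_normalized: "AE \<omega> in M. normalized_path_length M T \<beta> m (Suc k) \<omega> = Z k \<omega>"
proof -
  define f where "f l = real (\<Sum>h\<leftarrow>l. Suc h)" for l
  have f: "f l = (W k / c) * A l + b * real k / c" if "length l = k" for l
    using tot_id[of l] W_pos[of k] c_pos that by (simp add: A_def f_def field_simps)
  have "(\<integral>\<omega>. real (path_length (T (Suc k) \<omega>)) \<partial>M) = (\<integral>\<omega>. f (depths k \<omega>) \<partial>M)"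
  proof (rule integral_cong_AE)
    show "(\<lambda>\<omega>. real (path_length (T (Suc k) \<omega>))) \<in> borel_measurable M"
      using measurable_compose[OF path_length_measurable[of "Suc k"], of real borel] by simp
    show "(\<lambda>\<omega>. f (depths k \<omega>)) \<in> borel_measurable M" by measurable
    show "AE \<omega> in M. real (path_length (T (Suc k) \<omega>)) = f (depths k \<omega>)"
      using AE_path_length[of k] by eventually_elim (simp add: f_def)
  qed
  also have "\<dots> = EU k f" by (rule integral_depths)
  also have "\<dots> = EU k (\<lambda>l. (W k / c) * A l + b * real k / c)" using f by (intro EU_cong) auto
  also have "\<dots> = (W k / c) * alpha k + b * real k / c" unfolding EU_add using EU_A by simp
  finally have mean: "(\<integral>\<omega>. real (path_length (T (Suc k) \<omega>)) \<partial>M) = (W k / c) * alpha k + b * real k / c" .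
  have den: "real (Suc k) - real_of_int \<beta> / real_of_int (\<beta> + m) = W k / c"
    using c_pos by (simp add: W_def c_def field_simps)
  show ?thesis
    using AE_path_length[of k]
  proof eventually_elim
    case (elim \<omega>)
    then have "real (path_length (T (Suc k) \<omega>)) = (W k / c) * A (depths k \<omega>) + b * real k / c"
      using f[of "depths k \<omega>"] by (simp add: f_def)
    then show ?case
      unfolding normalized_path_length_def mean den Z_def using W_pos[of k] c_pos
      by (simp add: field_simps)
  qed
qed

lemma R_depths: "n \<le> k \<Longrightarrow> R n (depths k \<omega>) = Z k \<omega> - Z n \<omega>"
proof (induction k rule: dec_induct)
  case base
  then show ?case by (simp add: R_short)
next
  case (step k)
  then show ?case
    by (simp add: Z_def A_Cons incr_def alpha_def add_divide_distrib)
qed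

lemma Z_measurable [measurable]: "Z k \<in> borel_measurable M"
  unfolding Z_def by measurable

end

section \<open>The limit law and its moments\<close>

text \<open>Truncation at a level \<open>K\<close> gives a bounded continuous function, to which
  weak convergence applies. The truncation error is controlled uniformly in \<open>n\<close>,
  because the square of \<open>\<bar>x\<bar> powr p\<close> is at most
  \<open>1 + x ^ (2 * q)\<close>.\<close>

lemma weak_conv_moments:
  fixes \<mu> :: "nat \<Rightarrow> real measure" and p :: real
  assumes \<mu>: "\<And>n. real_distribution (\<mu> n)" and \<nu>: "real_distribution \<nu>"
    and conv: "weak_conv_m \<mu> \<nu>"
    and int_\<mu>: "\<And>n. n \<ge> N \<Longrightarrow> integrable (\<mu> n) (\<lambda>x. x ^ (2 * q))"
    and bound_\<mu>: "\<And>n. n \<ge> N \<Longrightarrow> (\<integral>x. x ^ (2 * q) \<partial>\<mu> n) \<le> B"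
    and int_\<nu>: "integrable \<nu> (\<lambda>x. x ^ (2 * q))"
    and p: "0 < p" "p \<le> real q"
  shows "(\<lambda>n. \<integral>x. \<bar>x\<bar> powr p \<partial>\<mu> n) \<longlonglongrightarrow> (\<integral>x. \<bar>x\<bar> powr p \<partial>\<nu>)"
proof -
  define f where "f K x = min (\<bar>x\<bar> powr p) K" for K x :: real
  define B' where "B' = max B (\<integral>x. x ^ (2 * q) \<partial>\<nu>)"
  have square_le: "(\<bar>x\<bar> powr p)\<^sup>2 \<le> 1 + x ^ (2 * q)" for x :: real
  proof (cases "\<bar>x\<bar> \<le> 1")
    case True
    then have "\<bar>x\<bar> powr p \<le> 1 powr p" using p by (intro powr_mono2) auto
    then have "(\<bar>x\<bar> powr p)\<^sup>2 \<le> 1" by (simp add: power_le_one)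
    then show ?thesis by (simp add: power_mult add_increasing2)
  next
    case False
    then have "\<bar>x\<bar> powr p \<le> \<bar>x\<bar> powr real q" using p by (intro powr_mono) auto
    then have "(\<bar>x\<bar> powr p)\<^sup>2 \<le> (\<bar>x\<bar> ^ q)\<^sup>2" using False by (intro power_mono) (auto simp: powr_realpow)
    also have "\<dots> = x ^ (2 * q)" by (simp add: power_mult[symmetric] mult.commute power_even_abs)
    finally show ?thesis by simp
  qed
  have trunc: "\<bar>(\<integral>x. \<bar>x\<bar> powr p \<partial>\<rho>) - (\<integral>x. f K x \<partial>\<rho>)\<bar> \<le> (1 + B') / K"
    if \<rho>: "real_distribution \<rho>" "integrable \<rho> (\<lambda>x. x ^ (2 * q))" "(\<integral>x. x ^ (2 * q) \<partial>\<rho>) \<le> B'"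
      and K: "K > 0" for \<rho> K
  proof -
    interpret real_distribution \<rho> by (rule \<rho>(1))
    have le: "\<bar>x\<bar> powr p \<le> 1 + (1 + x ^ (2 * q))" for x :: real
    proof -
      have "0 \<le> (\<bar>x\<bar> powr p - 1)\<^sup>2" by simp
      then have "2 * (\<bar>x\<bar> powr p) \<le> (\<bar>x\<bar> powr p)\<^sup>2 + 1"
        unfolding power2_diff by simp
      then show ?thesis using square_le[of x] powr_ge_zero[of "\<bar>x\<bar>" p] by linarith
    qed
    have int1: "integrable \<rho> (\<lambda>x. \<bar>x\<bar> powr p)"
      by (rule Bochner_Integration.integrable_bound[where f = "\<lambda>x. 1 + (1 + x ^ (2 * q))"])
        (use \<rho>(2) le in \<open>auto intro: order_trans[OF _ abs_ge_self]\<close>)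
    have "f K \<in> borel_measurable borel" unfolding f_def[abs_def] by measurable
    then have int2: "integrable \<rho> (f K)"
      using K by (intro Bochner_Integration.integrable_bound[OF int1]) (auto simp: f_def)
    have pw: "0 \<le> \<bar>x\<bar> powr p - f K x" "\<bar>x\<bar> powr p - f K x \<le> (1 + x ^ (2 * q)) / K" for x
    proof -
      show "0 \<le> \<bar>x\<bar> powr p - f K x" by (simp add: f_def)
      show "\<bar>x\<bar> powr p - f K x \<le> (1 + x ^ (2 * q)) / K"
      proof (cases "\<bar>x\<bar> powr p \<le> K")
        case True
        then show ?thesis using K by (simp add: f_def power_mult)
      next
        \<comment> \<open>Where truncation acts, the excess is at most
          \<open>\<bar>x\<bar> powr p\<close> and \<open>K\<close> is smaller than it, so the excess
          times \<open>K\<close> is below the square.\<close>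
        case False
        have "(\<bar>x\<bar> powr p - f K x) * K \<le> (\<bar>x\<bar> powr p) * (\<bar>x\<bar> powr p)"
          using False K by (intro mult_mono) (auto simp: f_def)
        also have "\<dots> \<le> 1 + x ^ (2 * q)" using square_le[of x] by (simp add: power2_eq_square)
        finally show ?thesis using K by (simp add: le_divide_eq)
      qed
    qed
    have "(\<integral>x. \<bar>x\<bar> powr p \<partial>\<rho>) - (\<integral>x. f K x \<partial>\<rho>) = (\<integral>x. \<bar>x\<bar> powr p - f K x \<partial>\<rho>)"
      by (rule Bochner_Integration.integral_diff[OF int1 int2, symmetric])
    moreover have "0 \<le> (\<integral>x. \<bar>x\<bar> powr p - f K x \<partial>\<rho>)" using pw by (intro Bochner_Integration.integral_nonneg)
    moreover have "(\<integral>x. \<bar>x\<bar> powr p - f K x \<partial>\<rho>) \<le> (\<integral>x. (1 + x ^ (2 * q)) / K \<partial>\<rho>)"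
      by (rule integral_mono) (use int1 int2 \<rho>(2) pw in auto)
    moreover have "(\<integral>x. (1 + x ^ (2 * q)) / K \<partial>\<rho>) \<le> (1 + B') / K"
      using \<rho>(2,3) K prob_space by (simp add: divide_right_mono)
    ultimately show ?thesis by simp
  qed
  show ?thesis
  proof (rule LIMSEQ_I)
    fix e :: real assume e: "e > 0"
    have B': "1 + B' > 0"
    proof -
      have "0 \<le> (\<integral>x. x ^ (2 * q) \<partial>\<nu>)" by (intro Bochner_Integration.integral_nonneg) (simp add: power_mult)
      also have "\<dots> \<le> B'" by (simp add: B'_def)
      finally show ?thesis by simp
    qed
    define K where "K = 3 * (1 + B') / e"
    have K: "K > 0" using B' e by (simp add: K_def)
    have "1 + B' = e / 3 * K" using e by (simp add: K_def)
    then have K': "(1 + B') / K = e / 3" using K by (metis less_irrefl nonzero_mult_div_cancel_right)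
    have "(\<lambda>n. integral\<^sup>L (\<mu> n) (f K)) \<longlonglongrightarrow> integral\<^sup>L \<nu> (f K)"
    proof (rule weak_conv_imp_integral_bdd_continuous_conv[OF \<mu> \<nu> conv])
      have "continuous_on UNIV (f K)" unfolding f_def
        by (intro continuous_on_min continuous_on_powr' continuous_intros) (use p in auto)
      then show "isCont (f K) x" for x by (simp add: continuous_on_eq_continuous_at)
      show "norm (f K x) \<le> K" for x using K by (auto simp: f_def)
    qed
    from LIMSEQ_D[OF this, of "e / 3"] e obtain N1
      where N1: "\<And>n. n \<ge> N1 \<Longrightarrow> norm (integral\<^sup>L (\<mu> n) (f K) - integral\<^sup>L \<nu> (f K)) < e / 3" by auto
    have "norm ((\<integral>x. \<bar>x\<bar> powr p \<partial>\<mu> n) - (\<integral>x. \<bar>x\<bar> powr p \<partial>\<nu>)) < e" if n: "n \<ge> max N N1" for n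
    proof -
      have "\<bar>(\<integral>x. \<bar>x\<bar> powr p \<partial>\<mu> n) - (\<integral>x. f K x \<partial>\<mu> n)\<bar> \<le> e / 3"
        unfolding K'[symmetric]
        using bound_\<mu>[of n] n by (intro trunc \<mu> int_\<mu> K) (auto simp: B'_def)
      moreover have "\<bar>(\<integral>x. \<bar>x\<bar> powr p \<partial>\<nu>) - (\<integral>x. f K x \<partial>\<nu>)\<bar> \<le> e / 3"
        unfolding K'[symmetric]
        by (intro trunc \<nu> int_\<nu> K) (simp add: B'_def)
      moreover have "\<bar>(\<integral>x. f K x \<partial>\<mu> n) - (\<integral>x. f K x \<partial>\<nu>)\<bar> < e / 3"
        using N1[of n] n by simp
      ultimately show ?thesis unfolding real_norm_def by linarith
    qed
    then show "\<exists>N0. \<forall>n\<ge>N0. norm ((\<integral>x. \<bar>x\<bar> powr p \<partial>\<mu> n) - (\<integral>x. \<bar>x\<bar> powr p \<partial>\<nu>)) < e" by blast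
  qed
qed

lemma tailvar_tendsto_0: "tailvar \<longlonglongrightarrow> 0"
  unfolding tailvar_def by real_asymp

section \<open>Passage to the almost sure limit\<close>

context tree_urn begin

lemma integrable_depths:
  fixes F :: "nat list \<Rightarrow> 'a::{banach, second_countable_topology}"
  shows "integrable M (\<lambda>\<omega>. F (depths k \<omega>))"
  using integrable_distr_eq[of "depths k" M "count_space UNIV" F]
  by (simp add: distr_depths)

context
  fixes S :: "'w \<Rightarrow> real"
  assumes S_measurable [measurable]: "S \<in> borel_measurable M"
    and S_limit: "AE \<omega> in M. (\<lambda>n. normalized_path_length M T \<beta> m n \<omega>) \<longlonglongrightarrow> S \<omega>"
begin

lemma Z_tendsto: "AE \<omega> in M. (\<lambda>k. Z k \<omega>) \<longlonglongrightarrow> S \<omega>"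
proof -
  have "AE \<omega> in M. \<forall>k. normalized_path_length M T \<beta> m (Suc k) \<omega> = Z k \<omega>"
    unfolding AE_all_countable using AE_normalized by blast
  then show ?thesis using S_limit
  proof eventually_elim
    case (elim \<omega>)
    then show ?case using LIMSEQ_Suc[of "\<lambda>n. normalized_path_length M T \<beta> m n \<omega>" "S \<omega>"] by simp
  qed
qed

text \<open>The estimate for finite \<open>k\<close> does not depend on \<open>k\<close>: dominated
  convergence handles the left-hand expectation, and \<open>tailvar k\<close> tends to
  \<open>0\<close>.\<close>

lemma tail_char: "\<exists>C\<ge>0. \<forall>u n. 2 \<le> n \<longrightarrow>
  cmod ((\<integral>\<omega>. iexp (u * (S \<omega> - Z n \<omega>)) \<partial>M) - complex_of_real (exp (- (u\<^sup>2 * (\<kappa> * tailvar n) / 2))))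
    \<le> C * (\<bar>u\<bar> ^ 3 * (real n + 1) powr (-3/4) + u\<^sup>2 + u ^ 4 / (real n + 1)) / (real n + 1)"
proof -
  obtain C where C: "C \<ge> 0" "\<And>u n k. 2 \<le> n \<Longrightarrow> n \<le> k \<Longrightarrow>
    cmod (EU k (\<lambda>l. iexp (u * R n l)) - complex_of_real (exp (- (u\<^sup>2 * (\<kappa> * (tailvar n - tailvar k)) / 2))))
    \<le> C * (\<bar>u\<bar> ^ 3 * (real n + 1) powr (-3/4) + u\<^sup>2 + u ^ 4 / (real n + 1)) / (real n + 1)"
    using R_char by blast
  have "cmod ((\<integral>\<omega>. iexp (u * (S \<omega> - Z n \<omega>)) \<partial>M) - complex_of_real (exp (- (u\<^sup>2 * (\<kappa> * tailvar n) / 2))))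
    \<le> C * (\<bar>u\<bar> ^ 3 * (real n + 1) powr (-3/4) + u\<^sup>2 + u ^ 4 / (real n + 1)) / (real n + 1)"
    if n: "2 \<le> n" for u n
  proof -
    have "(\<lambda>k. \<integral>\<omega>. iexp (u * (Z k \<omega> - Z n \<omega>)) \<partial>M) \<longlonglongrightarrow> (\<integral>\<omega>. iexp (u * (S \<omega> - Z n \<omega>)) \<partial>M)"
    proof (rule integral_dominated_convergence[where w = "\<lambda>_. 1"])
      show "AE \<omega> in M. (\<lambda>k. iexp (u * (Z k \<omega> - Z n \<omega>))) \<longlonglongrightarrow> iexp (u * (S \<omega> - Z n \<omega>))"
        using Z_tendsto by eventually_elim (intro tendsto_intros)
    qed auto
    moreover have "(\<lambda>k. complex_of_real (exp (- (u\<^sup>2 * (\<kappa> * (tailvar n - tailvar k)) / 2))))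
        \<longlonglongrightarrow> complex_of_real (exp (- (u\<^sup>2 * (\<kappa> * (tailvar n - 0)) / 2)))"
      by (intro tendsto_intros tailvar_tendsto_0) auto
    ultimately have "(\<lambda>k. cmod ((\<integral>\<omega>. iexp (u * (Z k \<omega> - Z n \<omega>)) \<partial>M)
        - complex_of_real (exp (- (u\<^sup>2 * (\<kappa> * (tailvar n - tailvar k)) / 2)))))
      \<longlonglongrightarrow> cmod ((\<integral>\<omega>. iexp (u * (S \<omega> - Z n \<omega>)) \<partial>M) - complex_of_real (exp (- (u\<^sup>2 * (\<kappa> * (tailvar n - 0)) / 2))))"
      by (intro tendsto_norm tendsto_diff)
    then have "cmod ((\<integral>\<omega>. iexp (u * (S \<omega> - Z n \<omega>)) \<partial>M) - complex_of_real (exp (- (u\<^sup>2 * (\<kappa> * (tailvar n - 0)) / 2))))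
      \<le> C * (\<bar>u\<bar> ^ 3 * (real n + 1) powr (-3/4) + u\<^sup>2 + u ^ 4 / (real n + 1)) / (real n + 1)"
    proof (rule LIMSEQ_le_const2, intro exI[of _ n] allI impI)
      fix k assume k: "n \<le> k"
      have "(\<integral>\<omega>. iexp (u * (Z k \<omega> - Z n \<omega>)) \<partial>M) = EU k (\<lambda>l. iexp (u * R n l))"
        unfolding R_depths[OF k, symmetric] by (rule integral_depths)
      then show "cmod ((\<integral>\<omega>. iexp (u * (Z k \<omega> - Z n \<omega>)) \<partial>M)
          - complex_of_real (exp (- (u\<^sup>2 * (\<kappa> * (tailvar n - tailvar k)) / 2))))
        \<le> C * (\<bar>u\<bar> ^ 3 * (real n + 1) powr (-3/4) + u\<^sup>2 + u ^ 4 / (real n + 1)) / (real n + 1)"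
        using C(2)[OF n k] by simp
    qed
    then show ?thesis by simp
  qed
  then show ?thesis using C by blast
qed

text \<open>Fatou's lemma applied to the bound uniform in \<open>k\<close>. It gives integrability
  of the limit and the same constant at once.\<close>

lemma tail_moments:
  assumes p: "p \<ge> 2"
  shows "\<exists>C\<ge>0. \<forall>n\<ge>1. integrable M (\<lambda>\<omega>. (S \<omega> - Z n \<omega>) ^ (2 * p)) \<and>
    (\<integral>\<omega>. (S \<omega> - Z n \<omega>) ^ (2 * p) \<partial>M) \<le> C * tailvar n ^ p"
proof -
  obtain C where C: "C \<ge> 0" "\<And>n k. n \<ge> 1 \<Longrightarrow> EU k (\<lambda>l. R n l ^ (2 * p)) \<le> C * tailvar n ^ p"
    using R_moments[OF p] by blast
  have "integrable M (\<lambda>\<omega>. (S \<omega> - Z n \<omega>) ^ (2 * p)) \<and>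
    (\<integral>\<omega>. (S \<omega> - Z n \<omega>) ^ (2 * p) \<partial>M) \<le> C * tailvar n ^ p" if n: "n \<ge> 1" for n
  proof -
    let ?f = "\<lambda>\<omega>. (S \<omega> - Z n \<omega>) ^ (2 * p)"
    have "(\<integral>\<^sup>+\<omega>. ennreal (?f \<omega>) \<partial>M) = (\<integral>\<^sup>+\<omega>. liminf (\<lambda>k. ennreal ((Z k \<omega> - Z n \<omega>) ^ (2 * p))) \<partial>M)"
    proof (rule nn_integral_cong_AE)
      show "AE \<omega> in M. ennreal (?f \<omega>) = liminf (\<lambda>k. ennreal ((Z k \<omega> - Z n \<omega>) ^ (2 * p)))"
        using Z_tendsto
      proof eventually_elim
        case (elim \<omega>)
        have "(\<lambda>k. ennreal ((Z k \<omega> - Z n \<omega>) ^ (2 * p))) \<longlonglongrightarrow> ennreal (?f \<omega>)"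
          by (intro tendsto_ennrealI tendsto_intros elim)
        then show ?case by (intro lim_imp_Liminf[symmetric]) auto
      qed
    qed
    also have "\<dots> \<le> liminf (\<lambda>k. \<integral>\<^sup>+\<omega>. ennreal ((Z k \<omega> - Z n \<omega>) ^ (2 * p)) \<partial>M)"
      by (rule nn_integral_liminf) measurable
    also have "\<dots> \<le> ennreal (C * tailvar n ^ p)"
    proof (intro Liminf_le)
      show "\<forall>\<^sub>F k in sequentially. (\<integral>\<^sup>+\<omega>. ennreal ((Z k \<omega> - Z n \<omega>) ^ (2 * p)) \<partial>M) \<le> ennreal (C * tailvar n ^ p)"
        using eventually_ge_at_top[of n]
      proof eventually_elim
        case (elim k)
        have "(\<integral>\<^sup>+\<omega>. ennreal ((Z k \<omega> - Z n \<omega>) ^ (2 * p)) \<partial>M) = ennreal (\<integral>\<omega>. R n (depths k \<omega>) ^ (2 * p) \<partial>M)"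
          unfolding R_depths[OF elim, symmetric]
          using integrable_depths[of "\<lambda>l. R n l ^ (2 * p)" k]
          by (intro nn_integral_eq_integral) (auto simp: power_mult)
        also have "(\<integral>\<omega>. R n (depths k \<omega>) ^ (2 * p) \<partial>M) = EU k (\<lambda>l. R n l ^ (2 * p))"
          by (rule integral_depths)
        finally show ?case using C(2)[OF n, of k] by (simp add: ennreal_leI)
      qed
    qed simp
    finally have le: "(\<integral>\<^sup>+\<omega>. ennreal (?f \<omega>) \<partial>M) \<le> ennreal (C * tailvar n ^ p)" .
    have nonneg: "?f \<omega> \<ge> 0" for \<omega> by (simp add: power_mult)
    have "(\<integral>\<^sup>+\<omega>. ennreal (norm (?f \<omega>)) \<partial>M) = (\<integral>\<^sup>+\<omega>. ennreal (?f \<omega>) \<partial>M)"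
      using nonneg by simp
    also have "\<dots> < \<infinity>" using le by (simp add: le_less_trans[OF _ ennreal_less_top])
    finally have int: "integrable M ?f" by (intro integrableI_bounded) auto
    have "ennreal (\<integral>\<omega>. ?f \<omega> \<partial>M) \<le> ennreal (C * tailvar n ^ p)"
      using le nn_integral_eq_integral[OF int] nonneg by simp
    then show ?thesis using int C tailvar_pos[OF n] by (subst (asm) ennreal_le_iff) auto
  qed
  then show ?thesis using C by blast
qed

definition X :: "nat \<Rightarrow> 'w \<Rightarrow> real" where
  "X n \<omega> = sqrt (real_of_int (\<beta> + m) / real_of_int m) * sqrt (real n / ln (real n)) *
    (normalized_path_length M T \<beta> m n \<omega> - S \<omega>)"

lemma normalized_measurable: "n \<ge> 1 \<Longrightarrow> normalized_path_length M T \<beta> m n \<in> borel_measurable M"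
  unfolding normalized_path_length_def[abs_def]
  using measurable_compose[OF path_length_measurable[of n], of real borel] by simp

lemma X_measurable [measurable]: "X n \<in> borel_measurable M"
proof (cases "n = 0")
  case True
  then have "X n = (\<lambda>_. 0)" by (auto simp: X_def)
  then show ?thesis by simp
next
  case False
  then have [measurable]: "normalized_path_length M T \<beta> m n \<in> borel_measurable M"
    by (intro normalized_measurable) simp
  show ?thesis unfolding X_def by measurable
qed

text \<open>With \<open>n = k + 1\<close> the prescribed normalisation is exactly the reciprocal
  root of \<kappa>\<open>* tailvar k\<close>. The sign is negative because the tail is the limit
  minus the current value. At \<open>k = 0\<close> both factors are \<open>0\<close> by division by
  zero.\<close>

lemma X_eq: "AE \<omega> in M. X (Suc k) \<omega> = (- (1 / sqrt (\<kappa> * tailvar k))) * (S \<omega> - Z k \<omega>)"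
  using AE_normalized[of k]
proof eventually_elim
  case (elim \<omega>)
  have "sqrt (real_of_int (\<beta> + m) / real_of_int m) * sqrt (real (Suc k) / ln (real (Suc k))) = 1 / sqrt (\<kappa> * tailvar k)"
  proof -
    have "(real_of_int (\<beta> + m) / real_of_int m) * (real (Suc k) / ln (real (Suc k))) = 1 / (\<kappa> * tailvar k)"
      by (simp add: \<kappa>_def c_def tailvar_def add.commute)
    then show ?thesis by (simp only: real_sqrt_mult[symmetric]) (simp only: real_sqrt_divide real_sqrt_one)
  qed
  then show ?case unfolding X_def elim by (simp only:) (simp add: algebra_simps diff_divide_distrib)
qed

text \<open>Levy's continuity theorem at \<open>u\<close> of order \<open>sqrt (n / ln n)\<close>.
  The three error terms then have orders \<open>n powr (-1/4)\<close> up to logarithms,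
  \<open>1 / ln n\<close> and \<open>1 / (ln n)^2\<close>.\<close>

lemma weak_conv_X: "weak_conv_m (\<lambda>n. distr M borel (X n)) std_normal_distribution"
proof (rule levy_continuity)
  fix t :: real
  obtain C where C: "C \<ge> 0" "\<And>u n. 2 \<le> n \<Longrightarrow>
    cmod ((\<integral>\<omega>. iexp (u * (S \<omega> - Z n \<omega>)) \<partial>M) - complex_of_real (exp (- (u\<^sup>2 * (\<kappa> * tailvar n) / 2))))
    \<le> C * (\<bar>u\<bar> ^ 3 * (real n + 1) powr (-3/4) + u\<^sup>2 + u ^ 4 / (real n + 1)) / (real n + 1)"
    using tail_char by blast
  define g where "g n = C * (\<bar>t\<bar> ^ 3 / sqrt \<kappa> ^ 3) * ((real n + 1) powr (-3/4) / (sqrt (tailvar n) ^ 3 * (real n + 1)))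
      + C * (t\<^sup>2 / \<kappa>) * (1 / (tailvar n * (real n + 1))) + C * (t ^ 4 / \<kappa>\<^sup>2) * (1 / ((tailvar n)\<^sup>2 * (real n + 1)\<^sup>2))" for n
  have "(\<lambda>n. (real n + 1) powr (-3/4) / (sqrt (tailvar n) ^ 3 * (real n + 1))) \<longlonglongrightarrow> 0"
    "(\<lambda>n. 1 / (tailvar n * (real n + 1))) \<longlonglongrightarrow> 0" "(\<lambda>n. 1 / ((tailvar n)\<^sup>2 * (real n + 1)\<^sup>2)) \<longlonglongrightarrow> 0"
    unfolding tailvar_def by real_asymp+
  then have "g \<longlonglongrightarrow> C * (\<bar>t\<bar> ^ 3 / sqrt \<kappa> ^ 3) * 0 + C * (t\<^sup>2 / \<kappa>) * 0 + C * (t ^ 4 / \<kappa>\<^sup>2) * 0"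
    unfolding g_def by (intro tendsto_intros)
  then have g0: "g \<longlonglongrightarrow> 0" by simp
  have "(\<lambda>k. char (distr M borel (X (Suc k))) t - complex_of_real (exp (- (t\<^sup>2) / 2))) \<longlonglongrightarrow> 0"
  proof (rule Lim_null_comparison[OF _ g0])
    show "\<forall>\<^sub>F k in sequentially. cmod (char (distr M borel (X (Suc k))) t - complex_of_real (exp (- (t\<^sup>2) / 2))) \<le> g k"
      using eventually_ge_at_top[of 2]
    proof eventually_elim
      case (elim k)
      define s where "s = sqrt (\<kappa> * tailvar k)"
      define u where "u = - (t / s)"
      have pos: "\<kappa> > 0" "tailvar k > 0" using kappa_bounds tailvar_pos elim by auto
      have s: "s > 0" "s\<^sup>2 = \<kappa> * tailvar k" using pos by (auto simp: s_def)
      have "char (distr M borel (X (Suc k))) t = (\<integral>\<omega>. iexp (t * X (Suc k) \<omega>) \<partial>M)"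
        unfolding char_def by (subst integral_distr) auto
      also have "\<dots> = (\<integral>\<omega>. iexp (u * (S \<omega> - Z k \<omega>)) \<partial>M)"
      proof (rule integral_cong_AE)
        show "AE \<omega> in M. iexp (t * X (Suc k) \<omega>) = iexp (u * (S \<omega> - Z k \<omega>))"
          using X_eq[of k]
        proof eventually_elim
          case (elim \<omega>)
          have "t * X (Suc k) \<omega> = u * (S \<omega> - Z k \<omega>)" unfolding elim by (simp add: u_def s_def)
          then show ?case by simp
        qed
      qed measurable
      finally have ch: "char (distr M borel (X (Suc k))) t = (\<integral>\<omega>. iexp (u * (S \<omega> - Z k \<omega>)) \<partial>M)" .
      have u: "u\<^sup>2 = t\<^sup>2 / (\<kappa> * tailvar k)" by (simp add: u_def power_divide s)
      have u3: "\<bar>u\<bar> ^ 3 = \<bar>t\<bar> ^ 3 / (sqrt \<kappa> ^ 3 * sqrt (tailvar k) ^ 3)"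
        using s by (simp add: u_def power_divide s_def real_sqrt_mult power_mult_distrib)
      have "u ^ 4 = (u\<^sup>2)\<^sup>2" by simp
      then have u4: "u ^ 4 = t ^ 4 / (\<kappa>\<^sup>2 * (tailvar k)\<^sup>2)" unfolding u by (simp add: power_divide power_mult_distrib)
      have "u\<^sup>2 * (\<kappa> * tailvar k) = t\<^sup>2" unfolding u using pos by simp
      then have "cmod (char (distr M borel (X (Suc k))) t - complex_of_real (exp (- (t\<^sup>2) / 2)))
        \<le> C * (\<bar>u\<bar> ^ 3 * (real k + 1) powr (-3/4) + u\<^sup>2 + u ^ 4 / (real k + 1)) / (real k + 1)"
        using C(2)[OF elim, of u] unfolding ch by simp
      also have "\<dots> = g k"
        unfolding g_def u u3 u4 by (simp add: distrib_left add_divide_distrib power2_eq_square mult_ac)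
      finally show ?case .
    qed
  qed
  then have "(\<lambda>k. char (distr M borel (X (Suc k))) t) \<longlonglongrightarrow> complex_of_real (exp (- (t\<^sup>2) / 2))"
    by (simp only: LIM_zero_iff)
  then show "(\<lambda>n. char (distr M borel (X n)) t) \<longlonglongrightarrow> char std_normal_distribution t"
    unfolding char_std_normal_distribution by (rule LIMSEQ_imp_Suc)
qed (auto intro: real_dist_normal_dist)

lemma moments_X:
  assumes p: "p > 0"
  shows "(\<lambda>n. \<integral>\<omega>. \<bar>X n \<omega>\<bar> powr p \<partial>M) \<longlonglongrightarrow> (\<integral>x. \<bar>x\<bar> powr p \<partial>std_normal_distribution)"
proof -
  \<comment> \<open>An integer at least \<open>p\<close>, as the truncation argument requires, and
    at least \<open>2\<close>, as \<open>tail_moments\<close> requires.\<close>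
  define q where "q = max 2 (nat \<lceil>p\<rceil>)"
  have q: "q \<ge> 2" "p \<le> real q" unfolding q_def by linarith+
  obtain C where C: "C \<ge> 0" "\<And>n. n \<ge> 1 \<Longrightarrow> integrable M (\<lambda>\<omega>. (S \<omega> - Z n \<omega>) ^ (2 * q))"
    "\<And>n. n \<ge> 1 \<Longrightarrow> (\<integral>\<omega>. (S \<omega> - Z n \<omega>) ^ (2 * q) \<partial>M) \<le> C * tailvar n ^ q"
    using tail_moments[OF q(1)] by blast
  have power_eq: "AE \<omega> in M. X (Suc k) \<omega> ^ (2 * q) = (1 / (\<kappa> * tailvar k) ^ q) * (S \<omega> - Z k \<omega>) ^ (2 * q)"
    if k: "k \<ge> 1" for k
    using X_eq[of k]
  proof eventually_elim
    case (elim \<omega>)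
    have pos: "\<kappa> * tailvar k > 0" using kappa_bounds tailvar_pos[OF k] by auto
    have "(- (1 / sqrt (\<kappa> * tailvar k))) ^ (2 * q) = 1 / (\<kappa> * tailvar k) ^ q"
      unfolding power_mult using pos by (simp add: power_divide)
    then show ?case unfolding elim power_mult_distrib by simp
  qed
  have int: "integrable M (\<lambda>\<omega>. X (Suc k) \<omega> ^ (2 * q))" if k: "k \<ge> 1" for k
  proof -
    have "integrable M (\<lambda>\<omega>. (1 / (\<kappa> * tailvar k) ^ q) * (S \<omega> - Z k \<omega>) ^ (2 * q))" using C(2)[OF k] by simp
    then show ?thesis using power_eq[OF k] by (subst integrable_cong_AE) auto
  qed
  have bound: "(\<integral>\<omega>. X (Suc k) \<omega> ^ (2 * q) \<partial>M) \<le> C / \<kappa> ^ q" if k: "k \<ge> 1" for k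
  proof -
    have pos: "\<kappa> > 0" "tailvar k > 0" using kappa_bounds tailvar_pos[OF k] by auto
    have "(\<integral>\<omega>. X (Suc k) \<omega> ^ (2 * q) \<partial>M) = (\<integral>\<omega>. (1 / (\<kappa> * tailvar k) ^ q) * (S \<omega> - Z k \<omega>) ^ (2 * q) \<partial>M)"
      using power_eq[OF k] by (intro integral_cong_AE) auto
    also have "\<dots> = (1 / (\<kappa> * tailvar k) ^ q) * (\<integral>\<omega>. (S \<omega> - Z k \<omega>) ^ (2 * q) \<partial>M)" by simp
    also have "\<dots> \<le> (1 / (\<kappa> * tailvar k) ^ q) * (C * tailvar k ^ q)"
      using pos C(3)[OF k] by (intro mult_left_mono) auto
    also have "\<dots> = C / \<kappa> ^ q" using pos by (simp add: power_mult_distrib)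
    finally show ?thesis .
  qed
  have "(\<lambda>n. \<integral>x. \<bar>x\<bar> powr p \<partial>distr M borel (X n)) \<longlonglongrightarrow> (\<integral>x. \<bar>x\<bar> powr p \<partial>std_normal_distribution)"
  \<comment> \<open>The bounds start at \<open>N = 2\<close> because index \<open>1\<close>
    corresponds to \<open>k = 0\<close>, where \<open>tailvar\<close> vanishes.\<close>
  proof (rule weak_conv_moments[OF _ real_dist_normal_dist weak_conv_X, where q = q and N = 2 and B = "C / \<kappa> ^ q"])
    fix n :: nat
    show "real_distribution (distr M borel (X n))" by (rule real_distribution_distr) simp
    assume "2 \<le> n"
    then obtain k where n: "n = Suc k" "k \<ge> 1" by (cases n) auto
    show "integrable (distr M borel (X n)) (\<lambda>x. x ^ (2 * q))"
      unfolding n using int[OF n(2)] by (subst integrable_distr_eq) auto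
    show "(\<integral>x. x ^ (2 * q) \<partial>distr M borel (X n)) \<le> C / \<kappa> ^ q"
      unfolding n using bound[OF n(2)] by (subst integral_distr) auto
  qed (use p q std_normal_distribution_even_moments in auto)
  then show ?thesis by (simp add: integral_distr)
qed

end
end

theorem theorem2:
  fixes M :: "'w measure" and T :: "nat \<Rightarrow> 'w \<Rightarrow> rtree" and \<beta> m :: int and S :: "'w \<Rightarrow> real"
  assumes parameters: "(\<beta> \<ge> 0 \<and> m = 1) \<or> (\<beta> = -1 \<and> m > 1)"
    and process: "random_tree_process M T \<beta> m"
    and S_measurable: "S \<in> borel_measurable M"
    and S_limit: "AE \<omega> in M. (\<lambda>n. normalized_path_length M T \<beta> m n \<omega>) \<longlonglongrightarrow> S \<omega>"
  shows "weak_conv_m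
      (\<lambda>n. distr M borel (\<lambda>\<omega>. sqrt (real_of_int (\<beta> + m) / real_of_int m) *
        sqrt (real n / ln (real n)) * (normalized_path_length M T \<beta> m n \<omega> - S \<omega>)))
      std_normal_distribution \<and>
    (\<forall>p::real. p > 0 \<longrightarrow>
      (\<lambda>n. (real n / ln (real n)) powr (p / 2) *
          (\<integral>\<omega>. \<bar>normalized_path_length M T \<beta> m n \<omega> - S \<omega>\<bar> powr p \<partial>M))
        \<longlonglongrightarrow> (real_of_int m / real_of_int (\<beta> + m)) powr (p / 2) *
          (\<integral>x. \<bar>x\<bar> powr p \<partial>std_normal_distribution))"
proof (intro conjI allI impI)
  interpret random_tree_process M T \<beta> m by (rule process)
  interpret depth_urn \<beta> m by unfold_locales (rule parameters)
  interpret tree_urn M T \<beta> m by unfold_locales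
  note X_def = X_def[OF S_measurable S_limit]
  show "weak_conv_m
      (\<lambda>n. distr M borel (\<lambda>\<omega>. sqrt (real_of_int (\<beta> + m) / real_of_int m) *
        sqrt (real n / ln (real n)) * (normalized_path_length M T \<beta> m n \<omega> - S \<omega>)))
      std_normal_distribution"
    using weak_conv_X[OF S_measurable S_limit] unfolding X_def .
  fix p :: real assume p: "p > 0"
  let ?r = "real_of_int m / real_of_int (\<beta> + m)"
  have r: "?r > 0" using kappa_bounds by (simp add: \<kappa>_def c_def)
  \<comment> \<open>The variance constant is part of \<open>X\<close>; multiplying its moments by
    \<open>?r powr (p / 2)\<close> moves this constant to the limit.\<close>
  have "(\<lambda>n. ?r powr (p / 2) * (\<integral>\<omega>. \<bar>X S n \<omega>\<bar> powr p \<partial>M))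
      \<longlonglongrightarrow> ?r powr (p / 2) * (\<integral>x. \<bar>x\<bar> powr p \<partial>std_normal_distribution)"
    by (intro tendsto_mult tendsto_const moments_X[OF S_measurable S_limit p])
  moreover have "?r powr (p / 2) * (\<integral>\<omega>. \<bar>X S n \<omega>\<bar> powr p \<partial>M) = (real n / ln (real n)) powr (p / 2) *
      (\<integral>\<omega>. \<bar>normalized_path_length M T \<beta> m n \<omega> - S \<omega>\<bar> powr p \<partial>M)" for n
  proof -
    define y where "y = real n / ln (real n)"
    have y: "y \<ge> 0" by (cases "n = 0") (auto simp: y_def)
    have sq: "sqrt z powr p = z powr (p / 2)" if "z \<ge> 0" for z :: real
      using that by (simp add: powr_half_sqrt[symmetric] powr_powr)
    have "\<bar>X S n \<omega>\<bar> powr p = ((1 / ?r) powr (p / 2) * y powr (p / 2)) *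
        \<bar>normalized_path_length M T \<beta> m n \<omega> - S \<omega>\<bar> powr p" for \<omega>
    proof -
      have "\<bar>X S n \<omega>\<bar> = (sqrt (1 / ?r) * sqrt y) * \<bar>normalized_path_length M T \<beta> m n \<omega> - S \<omega>\<bar>"
      proof -
        have nonneg: "0 \<le> sqrt (1 / ?r)" "0 \<le> sqrt y"
          using y less_imp_le[OF kappa_bounds(1)] real_sqrt_ge_zero[of "1 / ?r"]
          by (auto simp: \<kappa>_def c_def zero_le_divide_iff)
        have "X S n \<omega> = (sqrt (1 / ?r) * sqrt y) * (normalized_path_length M T \<beta> m n \<omega> - S \<omega>)"
          by (simp add: X_def y_def)
        then show ?thesis by (simp only: abs_mult abs_of_nonneg[OF nonneg(1)] abs_of_nonneg[OF nonneg(2)])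
      qed
      moreover have "0 \<le> 1 / ?r" by (rule less_imp_le, rule divide_pos_pos[OF zero_less_one r])
      ultimately show ?thesis by (simp only: powr_mult sq[OF \<open>0 \<le> 1 / ?r\<close>] sq[OF y])
    qed
    then have "(\<integral>\<omega>. \<bar>X S n \<omega>\<bar> powr p \<partial>M) = ((1 / ?r) powr (p / 2) * y powr (p / 2)) *
        (\<integral>\<omega>. \<bar>normalized_path_length M T \<beta> m n \<omega> - S \<omega>\<bar> powr p \<partial>M)" by simp
    moreover have "?r powr (p / 2) * (1 / ?r) powr (p / 2) = 1"
      using a_pos c_pos by (auto simp: powr_mult[symmetric] c_def)
    ultimately show ?thesis by (simp add: y_def mult.assoc[symmetric])
  qed
  ultimately show "(\<lambda>n. (real n / ln (real n)) powr (p / 2) *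
          (\<integral>\<omega>. \<bar>normalized_path_length M T \<beta> m n \<omega> - S \<omega>\<bar> powr p \<partial>M))
        \<longlonglongrightarrow> ?r powr (p / 2) * (\<integral>x. \<bar>x\<bar> powr p \<partial>std_normal_distribution)"
    by simp
qed

end
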